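(* Let $S$ be a reduced information semialgebra and let $n \ge 2$ be an integer. Then the monoid $T_n(S)^\bullet$ is not half-factorial. Moreover, all of the following hold. (Vertical equivalences) (i) $S$ is a bi-FFM if and only if $T_n(S)^\bullet$ is an FFM. (ii) $S$ is a bi-BFM if and only if $T_n(S)^\bullet$ is a BFM. (iii) $S$ is bi-ACCP if and only if $T_n(S)^\bullet$ satisfies the ACCP. (iv) $S$ is bi-atomic if and only if $T_n(S)^\bullet$ is atomic. (Horizontal implications) (v) $S$ is a bi-FFM $\Rightarrow$ $S$ is a bi-BFM $\Rightarrow$ $S$ is bi-ACCP $\Rightarrow$ $S$ is bi-atomic. (vi) $T_n(S)^\bullet$ is an FFM $\Rightarrow$ $T_n(S)^\bullet$ is a BFM $\Rightarrow$ $T_n(S)^\bullet$ satisfies the ACCP $\Rightarrow$ $T_n(S)^\bullet$ is atomic. Finally, none of the implications in (v) and (vi) is reversible in general: for every $n \ge 2$ and for each single implication in (v) and in (vi), there exists a reduced information semialgebra $S$ for which the conclusion of that implication holds but its hypothesis fails.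
   Context: All monoids are cancellative but not necessarily commutative. An information semialgebra is a semiring $S$ with $0$ and $1$ (so $(S,+)$ is a commutative monoid with identity $0$, multiplication has identity $1$ and distributes over addition, and $0\cdot x=0$ for all $x$) such that $(S,+)$ is a cancellative commutative monoid whose only invertible element is $0$, and $(S\setminus\{0\},\cdot)$ is a cancellative commutative monoid (in particular closed under multiplication). Write $S^\bullet=S\setminus\{0\}$. $S$ is reduced if $1$ is the only invertible element of $(S^\bullet,\cdot)$. $T_n(S)$ is the semiring of $n\times n$ upper triangular matrices over $S$. $T_n(S)^\bullet$ is the multiplicative monoid of cancellable elements of $T_n(S)$, i.e. of the upper triangular matrices all of whose diagonal entries are nonzero. Let $M$ be a monoid. An atom is a non-invertible $a\in M$ such that $a=uv$ implies that $u$ or $v$ is invertible. $M$ is atomic if each non-invertible element is a finite product of atoms. A length of a non-invertible $x$ is a number $\ell\ge 1$ such that $x=a_1\cdots a_\ell$ with all $a_i$ atoms; $\mathsf L(x)$ is the set of lengths of $x$, and $\mathsf L(u)=\{0\}$ for invertible $u$. $M$ is a BFM if it is atomic and $\mathsf L(x)$ is finite for all $x\in M$. $M$ is half-factorial if it is atomic and any two expressions of a non-invertible element as a product of atoms have the same number of factors. $M$ satisfies the left (resp. right) ACCP if every ascending chain of principal left ideals $Mx$ (resp. principal right ideals $xM$) stabilizes; $M$ satisfies the ACCP if it satisfies both. If the identity is the only invertible element of $M$ (as is the case for all monoids in the claim), $M$ is an FFM if it is atomic and for every $x\in M$ there are only finitely many finite sequences of atoms $(a_1,\dots,a_\ell)$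 with $a_1\cdots a_\ell=x$ (rigid factorizations; for commutative $M$ this is equivalent to finiteness of the number of factorizations up to order). $S$ is bi-atomic (resp. bi-ACCP, a bi-BFM, a bi-FFM) if both $(S,+)$ and $(S^\bullet,\cdot)$ are atomic (resp. satisfy the ACCP, are BFMs, are FFMs). *)

theory Defs
  imports
    "HOL-Algebra.Coset"
    "HOL-Algebra.Divisibility"
    "HOL-Algebra.Multiplicative_Group"
    "Jordan_Normal_Form.Matrix"
begin

section \<open>Factorization properties of monoids\<close>

text \<open>
  The constant \<^const>\<open>irreducible\<close> of the library is phrased through one-sided proper
  divisibility; for not necessarily commutative monoids atoms are defined directly.
\<close>

definition atoms :: "('a, 'm) monoid_scheme \<Rightarrow> 'a set" where
  "atoms M = {a \<in> carrier M. a \<notin> Units M \<and>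
     (\<forall>u\<in>carrier M. \<forall>v\<in>carrier M. a = u \<otimes>\<^bsub>M\<^esub> v \<longrightarrow> u \<in> Units M \<or> v \<in> Units M)}"

definition rigid_factorizations :: "('a, 'm) monoid_scheme \<Rightarrow> 'a \<Rightarrow> 'a list set" where
  "rigid_factorizations M x = {as. set as \<subseteq> atoms M \<and> foldr (mult M) as \<one>\<^bsub>M\<^esub> = x}"

definition atomic_monoid :: "('a, 'm) monoid_scheme \<Rightarrow> bool" where
  "atomic_monoid M \<longleftrightarrow> (\<forall>x \<in> carrier M - Units M. rigid_factorizations M x \<noteq> {})"

definition lengths :: "('a, 'm) monoid_scheme \<Rightarrow> 'a \<Rightarrow> nat set" where
  "lengths M x = (if x \<in> Units M then {0} else length ` rigid_factorizations M x)"

definition bf_monoid :: "('a, 'm) monoid_scheme \<Rightarrow> bool" where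
  "bf_monoid M \<longleftrightarrow> atomic_monoid M \<and> (\<forall>x\<in>carrier M. finite (lengths M x))"

definition half_factorial :: "('a, 'm) monoid_scheme \<Rightarrow> bool" where
  "half_factorial M \<longleftrightarrow> atomic_monoid M \<and>
     (\<forall>x \<in> carrier M - Units M. \<forall>as \<in> rigid_factorizations M x. \<forall>bs \<in> rigid_factorizations M x.
        length as = length bs)"

text \<open>
  The following definition is meant for monoids in which the identity is the only invertible
  element; in general, factorizations have to be identified up to units.  For commutative monoids,
  finiteness of the set of rigid factorizations is equivalent to finiteness of the set of
  factorizations up to order.
\<close>

definition ff_monoid :: "('a, 'm) monoid_scheme \<Rightarrow> bool" where
  "ff_monoid M \<longleftrightarrow> atomic_monoid M \<and> (\<forall>x\<in>carrier M. finite (rigid_factorizations M x))"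

definition left_accp :: "('a, 'm) monoid_scheme \<Rightarrow> bool" where
  "left_accp M \<longleftrightarrow> (\<forall>x :: nat \<Rightarrow> 'a.
     (\<forall>i. x i \<in> carrier M) \<and> (\<forall>i. carrier M #>\<^bsub>M\<^esub> x i \<subseteq> carrier M #>\<^bsub>M\<^esub> x (Suc i)) \<longrightarrow>
     (\<exists>k. \<forall>i\<ge>k. carrier M #>\<^bsub>M\<^esub> x i = carrier M #>\<^bsub>M\<^esub> x k))"

definition right_accp :: "('a, 'm) monoid_scheme \<Rightarrow> bool" where
  "right_accp M \<longleftrightarrow> (\<forall>x :: nat \<Rightarrow> 'a.
     (\<forall>i. x i \<in> carrier M) \<and> (\<forall>i. x i <#\<^bsub>M\<^esub> carrier M \<subseteq> x (Suc i) <#\<^bsub>M\<^esub> carrier M) \<longrightarrow>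
     (\<exists>k. \<forall>i\<ge>k. x i <#\<^bsub>M\<^esub> carrier M = x k <#\<^bsub>M\<^esub> carrier M))"

definition accp :: "('a, 'm) monoid_scheme \<Rightarrow> bool" where
  "accp M \<longleftrightarrow> left_accp M \<and> right_accp M"

definition cancellable_part :: "('a, 'm) monoid_scheme \<Rightarrow> 'a monoid" where
  "cancellable_part M =
     \<lparr>carrier = {a \<in> carrier M. \<forall>x\<in>carrier M. \<forall>y\<in>carrier M.
        (a \<otimes>\<^bsub>M\<^esub> x = a \<otimes>\<^bsub>M\<^esub> y \<longrightarrow> x = y) \<and> (x \<otimes>\<^bsub>M\<^esub> a = y \<otimes>\<^bsub>M\<^esub> a \<longrightarrow> x = y)},
      mult = mult M, one = one M\<rparr>"


section \<open>Information semialgebras\<close>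

locale information_semialgebra = semiring S for S (structure) +
  assumes add_cancel: "comm_monoid_cancel (add_monoid S)"
    and add_Units: "Units (add_monoid S) = {\<zero>}"
    and mult_cancel: "comm_monoid_cancel (mult_of S)"

locale reduced_information_semialgebra = information_semialgebra +
  assumes mult_Units: "Units (mult_of S) = {\<one>}"

definition bi_atomic :: "('a, 'm) ring_scheme \<Rightarrow> bool" where
  "bi_atomic S \<longleftrightarrow> atomic_monoid (add_monoid S) \<and> atomic_monoid (mult_of S)"

definition bi_accp :: "('a, 'm) ring_scheme \<Rightarrow> bool" where
  "bi_accp S \<longleftrightarrow> accp (add_monoid S) \<and> accp (mult_of S)"

definition bi_bfm :: "('a, 'm) ring_scheme \<Rightarrow> bool" where
  "bi_bfm S \<longleftrightarrow> bf_monoid (add_monoid S) \<and> bf_monoid (mult_of S)"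

definition bi_ffm :: "('a, 'm) ring_scheme \<Rightarrow> bool" where
  "bi_ffm S \<longleftrightarrow> ff_monoid (add_monoid S) \<and> ff_monoid (mult_of S)"


section \<open>Upper triangular matrices\<close>

text \<open>
  The type of matrices serves only as a container: the matrix operations of the library refer to
  type class arithmetic, whereas here entries are combined by the operations of the record
  \<open>S\<close>.  Indices run from \<open>0\<close> to \<open>n - 1\<close>.
\<close>

definition upper_triangular_semiring ::
    "nat \<Rightarrow> ('a, 'm) ring_scheme \<Rightarrow> 'a mat ring" where
  "upper_triangular_semiring n S =
     \<lparr>carrier = {A \<in> carrier_mat n n.
        (\<forall>i<n. \<forall>j<n. A $$ (i, j) \<in> carrier S) \<and> (\<forall>i<n. \<forall>j<i. A $$ (i, j) = \<zero>\<^bsub>S\<^esub>)},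
      mult = (\<lambda>A B. mat n n (\<lambda>(i, j). \<Oplus>\<^bsub>S\<^esub>k\<in>{..<n}. A $$ (i, k) \<otimes>\<^bsub>S\<^esub> B $$ (k, j))),
      one = mat n n (\<lambda>(i, j). if i = j then \<one>\<^bsub>S\<^esub> else \<zero>\<^bsub>S\<^esub>),
      zero = mat n n (\<lambda>_. \<zero>\<^bsub>S\<^esub>),
      add = (\<lambda>A B. mat n n (\<lambda>(i, j). A $$ (i, j) \<oplus>\<^bsub>S\<^esub> B $$ (i, j)))\<rparr>"

text \<open>
  Over an information semialgebra, the cancellable elements are the upper triangular matrices without
  a zero on the diagonal.
\<close>

definition upper_triangular_monoid ::
    "nat \<Rightarrow> ('a, 'm) ring_scheme \<Rightarrow> 'a mat monoid" where
  "upper_triangular_monoid n S = cancellable_part (upper_triangular_semiring n S)"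

end

theory Submission
  imports Defs "HOL-Library.Countable_Set" "HOL-Library.Function_Algebras"
    "HOL-Computational_Algebra.Computational_Algebra"
begin

text \<open>
  Both \<open>(S, +)\<close> and \<open>(S\<^sup>\<bullet>, \<cdot>)\<close> are divisor-closed submonoids of \<open>T\<^sub>n(S)\<^sup>\<bullet>\<close>, as the
  transvections at one position and as the diagonal matrices with one nontrivial entry, so all
  factorization properties descend from \<open>T\<^sub>n(S)\<^sup>\<bullet>\<close> to them.  Conversely these submonoids generate
  \<open>T\<^sub>n(S)\<^sup>\<bullet>\<close>; the finiteness conditions ascend because \<open>(AB)\<^sub>i\<^sub>j\<close> is divisible in \<open>(S, +)\<close> by
  \<open>a\<^sub>i\<^sub>i b\<^sub>i\<^sub>j + a\<^sub>i\<^sub>j b\<^sub>j\<^sub>j\<close> for \<open>i < j\<close>.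

  A bi-BFM that is no bi-FFM is \<open>{0, 1} \<union> [2, \<infinity>)\<close>.  The semiring generated by \<open>x\<close> and
  \<open>2 - 2x\<close> in \<open>\<int>[x]\<close> is bi-atomic, but \<open>2x\<^sup>k = x\<^sup>k (2 - 2x) + 2x\<^sup>k\<^sup>+\<^sup>1\<close> violates the additive ACCP.  A bi-ACCP
  semialgebra that is no bi-BFM consists of functions which are constant up to finitely many
  values.
\<close>

section \<open>Reduced cancellative monoids\<close>

text \<open>Each property has its own remedy. For BFMs the additive length is taken to be the
  maximal one, which cannot drop under scaling by a nonzero element. For FFMs the scaling factor
  divides a diagonal entry of the product and so ranges over a finite set. For the ACCP one waits
  until the diagonals are constant, after which all cofactors have diagonal one. To make this work
  the properties are rephrased so that atoms disappear: a superadditive length function, finite sets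
  of left divisors, stationary divisor chains of elements.

  Missing subtraction also shapes the description of the cancellable matrices: a null vector of a
  matrix with a zero on its diagonal has to be produced as a pair of distinct vectors with equal
  images.

  Two of the three examples are countable sets of polynomials or functions; countability is what
  lets them be copied injectively into the real numbers.\<close>

lemma decseq_nat_eventually_const:
  fixes f :: "nat \<Rightarrow> nat"
  assumes "\<And>i. i \<ge> m \<Longrightarrow> f (Suc i) \<le> f i"
  shows "\<exists>k\<ge>m. \<forall>i\<ge>k. f i = f k"
proof -
  define v where "v = (LEAST v. \<exists>k\<ge>m. f k = v)"
  have "\<exists>k\<ge>m. f k = v"
    unfolding v_def by (rule LeastI_ex) blast
  then obtain k where k: "k \<ge> m" "f k = v" by blast
  have "f i \<le> f k" if "i \<ge> k" for i
    using that
  proof (induction rule: dec_induct)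
    case (step i)
    then show ?case using assms[of i] k(1) by auto
  qed simp
  moreover have "v \<le> f i" if "i \<ge> k" for i
    unfolding v_def by (rule Least_le) (use that k(1) in \<open>auto intro: le_trans\<close>)
  ultimately show ?thesis using k by (metis order_antisym)
qed

locale reduced_monoid = monoid_cancel +
  assumes Units_trivial: "Units G = {\<one>}"
begin

text \<open>A one-sided inverse suffices: \<open>x y = 1\<close> gives \<open>x (y x) = x\<close>,
  and left cancellation makes \<open>y\<close> a two-sided inverse without commutativity.\<close>

lemma mult_eq_one:
  assumes "x \<otimes> y = \<one>" "x \<in> carrier G" "y \<in> carrier G"
  shows "x = \<one>" "y = \<one>"
proof -
  have "x \<otimes> (y \<otimes> x) = x \<otimes> \<one>"
    using assms by (simp flip: m_assoc)
  then have "y \<otimes> x = \<one>"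
    using assms by (blast intro: l_cancel)
  then have "x \<in> Units G" "y \<in> Units G"
    using assms unfolding Units_def by auto
  then show "x = \<one>" "y = \<one>"
    using Units_trivial by auto
qed

lemma atoms_iff:
  "a \<in> atoms G \<longleftrightarrow> a \<in> carrier G \<and> a \<noteq> \<one> \<and>
     (\<forall>u\<in>carrier G. \<forall>v\<in>carrier G. a = u \<otimes> v \<longrightarrow> u = \<one> \<or> v = \<one>)"
  unfolding atoms_def by (auto simp: Units_trivial)

lemma atoms_closed: "a \<in> atoms G \<Longrightarrow> a \<in> carrier G"
  by (simp add: atoms_iff)

lemma foldr_mult_closed [simp]:
  "set as \<subseteq> carrier G \<Longrightarrow> foldr (\<otimes>) as \<one> \<in> carrier G"
  by (induction as) auto

lemma foldr_mult_append:
  assumes "set as \<subseteq> carrier G" "set bs \<subseteq> carrier G"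
  shows "foldr (\<otimes>) (as @ bs) \<one> = foldr (\<otimes>) as \<one> \<otimes> foldr (\<otimes>) bs \<one>"
  using assms(1) by (induction as) (auto simp: assms(2) m_assoc)

lemma Nil_in_rigid_factorizations_one: "[] \<in> rigid_factorizations G \<one>"
  by (simp add: rigid_factorizations_def)

lemma singleton_in_rigid_factorizations: "a \<in> atoms G \<Longrightarrow> [a] \<in> rigid_factorizations G a"
  by (simp add: rigid_factorizations_def atoms_closed)

lemma append_in_rigid_factorizations:
  assumes "as \<in> rigid_factorizations G x" "bs \<in> rigid_factorizations G y"
  shows "as @ bs \<in> rigid_factorizations G (x \<otimes> y)"
proof -
  have "set as \<subseteq> carrier G" "set bs \<subseteq> carrier G"
    using assms atoms_closed by (auto simp: rigid_factorizations_def)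
  from foldr_mult_append[OF this] show ?thesis
    using assms by (simp add: rigid_factorizations_def)
qed

lemma Cons_in_rigid_factorizations_iff:
  "a # as \<in> rigid_factorizations G x \<longleftrightarrow>
     a \<in> atoms G \<and> (\<exists>y\<in>carrier G. as \<in> rigid_factorizations G y \<and> x = a \<otimes> y)"
proof
  assume *: "a # as \<in> rigid_factorizations G x"
  then have "set as \<subseteq> carrier G"
    using atoms_closed by (auto simp: rigid_factorizations_def)
  with * show "a \<in> atoms G \<and> (\<exists>y\<in>carrier G. as \<in> rigid_factorizations G y \<and> x = a \<otimes> y)"
    unfolding rigid_factorizations_def
    by (auto intro!: bexI[of _ "foldr (\<otimes>) as \<one>"])
qed (auto simp: rigid_factorizations_def)

lemma rigid_factorizations_one: "rigid_factorizations G \<one> = {[]}"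
proof -
  have "as = []" if "as \<in> rigid_factorizations G \<one>" for as
  proof (cases as)
    case (Cons a bs)
    with that obtain y where "a \<in> atoms G" "y \<in> carrier G" "\<one> = a \<otimes> y"
      by (auto simp: Cons_in_rigid_factorizations_iff)
    then show ?thesis
      using mult_eq_one(1)[of a y] by (auto simp: atoms_iff)
  qed
  then show ?thesis using Nil_in_rigid_factorizations_one by blast
qed

lemma atomic_iff: "atomic_monoid G \<longleftrightarrow> (\<forall>x\<in>carrier G. rigid_factorizations G x \<noteq> {})"
  unfolding atomic_monoid_def Units_trivial using Nil_in_rigid_factorizations_one by blast

lemma lengths_eq: "lengths G x = length ` rigid_factorizations G x"
  by (simp add: lengths_def Units_trivial rigid_factorizations_one)

section \<open>Length functions and bounded factorization\<close>

definition length_function :: "('a \<Rightarrow> nat) \<Rightarrow> bool" where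
  "length_function l \<longleftrightarrow>
     (\<forall>x\<in>carrier G. \<forall>y\<in>carrier G. l x + l y \<le> l (x \<otimes> y)) \<and>
     (\<forall>x\<in>carrier G. x \<noteq> \<one> \<longrightarrow> 0 < l x)"

text \<open>Formulated for arbitrary factors different from the identity, because
  \<open>T_bfm\<close> applies it to multiples of atoms, which need not be atoms again.\<close>

lemma length_le_length_function:
  assumes l: "length_function l" and "set as \<subseteq> carrier G - {\<one>}"
  shows "length as \<le> l (foldr (\<otimes>) as \<one>)"
  using assms(2)
proof (induction as)
  case (Cons a as)
  then have "0 < l a" "l a + l (foldr (\<otimes>) as \<one>) \<le> l (a \<otimes> foldr (\<otimes>) as \<one>)"
    using l by (auto simp: length_function_def intro!: foldr_mult_closed)
  with Cons show ?case by simp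
qed simp

text \<open>When a product is split into two nonidentity factors, both have strictly smaller
  \<open>l\<close>, so repeated splitting terminates.\<close>

lemma atomic_if_length_function:
  assumes l: "length_function l"
  shows "atomic_monoid G"
proof -
  have "rigid_factorizations G x \<noteq> {}" if "x \<in> carrier G" for x
    using that
  proof (induction "l x" arbitrary: x rule: less_induct)
    case less
    show ?case
    proof (cases "x = \<one> \<or> x \<in> atoms G")
      case True
      then show ?thesis
        using Nil_in_rigid_factorizations_one singleton_in_rigid_factorizations by blast
    next
      case False
      then obtain u v where uv: "u \<in> carrier G" "v \<in> carrier G" "x = u \<otimes> v" "u \<noteq> \<one>" "v \<noteq> \<one>"
        using less.prems by (auto simp: atoms_iff)
      then have "l u + l v \<le> l x" "0 < l u" "0 < l v"
        using l by (auto simp: length_function_def)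
      then show ?thesis
        using less.hyps[of u] less.hyps[of v] uv append_in_rigid_factorizations by fastforce
    qed
  qed
  then show ?thesis by (simp add: atomic_iff)
qed

lemma Max_lengths_attained:
  assumes "bf_monoid G" "x \<in> carrier G"
  shows "\<exists>as\<in>rigid_factorizations G x. length as = Max (lengths G x)"
proof -
  have "finite (lengths G x)" "lengths G x \<noteq> {}"
    using assms by (auto simp: bf_monoid_def atomic_iff lengths_eq)
  then have "Max (lengths G x) \<in> lengths G x" by (rule Max_in)
  then show ?thesis by (auto simp: lengths_eq)
qed

text \<open>Longest factorizations of \<open>x\<close> and \<open>y\<close> concatenate to a
  factorization of the product; a nonidentity element has no empty factorization.\<close>

lemma length_function_Max_lengths:
  assumes bf: "bf_monoid G"
  shows "length_function (\<lambda>x. Max (lengths G x))"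
  unfolding length_function_def
proof (intro conjI ballI impI)
  fix x y assume xy: "x \<in> carrier G" "y \<in> carrier G"
  obtain as bs where "as \<in> rigid_factorizations G x" "length as = Max (lengths G x)"
    "bs \<in> rigid_factorizations G y" "length bs = Max (lengths G y)"
    using Max_lengths_attained[OF bf] xy by metis
  then have "Max (lengths G x) + Max (lengths G y) \<in> lengths G (x \<otimes> y)"
    using append_in_rigid_factorizations[of as x bs y]
    by (auto simp: lengths_eq intro!: image_eqI[of _ _ "as @ bs"])
  moreover have "finite (lengths G (x \<otimes> y))"
    using bf xy by (simp add: bf_monoid_def)
  ultimately show "Max (lengths G x) + Max (lengths G y) \<le> Max (lengths G (x \<otimes> y))"
    by (rule Max_ge[rotated])
next
  fix x assume x: "x \<in> carrier G" "x \<noteq> \<one>"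
  obtain as where as: "as \<in> rigid_factorizations G x" "length as = Max (lengths G x)"
    using Max_lengths_attained[OF bf x(1)] by blast
  then have "as \<noteq> []" using x(2) by (auto simp: rigid_factorizations_def)
  then show "0 < Max (lengths G x)" by (simp flip: as(2))
qed

text \<open>Replaces a statement about atoms by the existence of a function, which can be composed
  with embeddings and summed over matrix entries. Superadditivity at the identity forces the value 0
  there.\<close>

lemma bf_iff_length_function: "bf_monoid G \<longleftrightarrow> (\<exists>l. length_function l)"
proof
  assume "\<exists>l. length_function l"
  then obtain l where l: "length_function l" by blast
  have "length as \<le> l x" if "as \<in> rigid_factorizations G x" for as x
  proof -
    have "set as \<subseteq> carrier G - {\<one>}" "foldr (\<otimes>) as \<one> = x"
      using that by (auto simp: rigid_factorizations_def atoms_iff)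
    then show ?thesis using length_le_length_function[OF l] by blast
  qed
  then have "lengths G x \<subseteq> {..l x}" for x
    by (auto simp: lengths_eq)
  then show "bf_monoid G"
    unfolding bf_monoid_def using atomic_if_length_function[OF l] finite_subset by blast
qed (use length_function_Max_lengths in blast)

section \<open>Finite factorization via finitely many left divisors\<close>

definition left_divisors :: "'a \<Rightarrow> 'a set" where
  "left_divisors x = {y \<in> carrier G. \<exists>z\<in>carrier G. x = y \<otimes> z}"

lemma ff_imp_bf: "ff_monoid G \<Longrightarrow> bf_monoid G"
  unfolding ff_monoid_def bf_monoid_def lengths_eq by auto

text \<open>In an FFM each left divisor of \<open>x\<close> is the product of a prefix of some rigid
  factorization of \<open>x\<close>. Conversely, the first atom of a factorization is one of
  finitely many left divisors and determines the rest of the product; the length function of a BFM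
  makes the induction on that rest well founded.\<close>

lemma ff_iff_finite_left_divisors:
  "ff_monoid G \<longleftrightarrow> bf_monoid G \<and> (\<forall>x\<in>carrier G. finite (left_divisors x))"
proof
  assume ff: "ff_monoid G"
  have "finite (left_divisors x)" if x: "x \<in> carrier G" for x
  proof -
    let ?F = "rigid_factorizations G x"
    have "y \<in> (\<lambda>as. foldr (\<otimes>) as \<one>) ` (\<Union>as\<in>?F. set (map (\<lambda>n. take n as) [0..<Suc (length as)]))"
      if y: "y \<in> left_divisors x" for y
    proof -
      obtain z where yz: "y \<in> carrier G" "z \<in> carrier G" "x = y \<otimes> z"
        using y unfolding left_divisors_def by blast
      then obtain as bs where ab: "as \<in> rigid_factorizations G y" "bs \<in> rigid_factorizations G z"
        using ff unfolding ff_monoid_def atomic_iff by blast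
      then have "as @ bs \<in> ?F"
        using append_in_rigid_factorizations yz by blast
      moreover have "y = foldr (\<otimes>) as \<one>"
        using ab by (simp add: rigid_factorizations_def)
      moreover have "as = take (length as) (as @ bs)" by simp
      ultimately show ?thesis
        by (intro image_eqI[of _ _ as] UN_I[of "as @ bs"]) (auto intro!: image_eqI[of _ _ "length as"])
    qed
    moreover have "finite ?F" using ff x by (simp add: ff_monoid_def)
    ultimately show ?thesis
      by (meson List.finite_set finite_UN_I finite_imageI finite_subset subsetI)
  qed
  with ff_imp_bf[OF ff] show "bf_monoid G \<and> (\<forall>x\<in>carrier G. finite (left_divisors x))" by blast
next
  assume *: "bf_monoid G \<and> (\<forall>x\<in>carrier G. finite (left_divisors x))"
  then obtain l where l: "length_function l" using bf_iff_length_function by blast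
  have "finite (rigid_factorizations G x)" if "x \<in> carrier G" for x
    using that
  proof (induction "l x" arbitrary: x rule: less_induct)
    case less
    \<comment> \<open>The right cofactor of a left divisor, unique by left cancellation. The
      description is meaningful only for left divisors of \<open>x\<close>, and it is used only for
      those.\<close>
    define cof where "cof = (\<lambda>a. THE y. y \<in> carrier G \<and> x = a \<otimes> y)"
    have cof: "cof a = y" if "a \<in> carrier G" "y \<in> carrier G" "x = a \<otimes> y" for a y
      unfolding cof_def using that by (intro the_equality) (auto intro: l_cancel)
    define D where "D = left_divisors x \<inter> atoms G"
    have "finite (rigid_factorizations G (cof a))" if a: "a \<in> D" for a
    proof -
      obtain y where y: "a \<in> carrier G" "y \<in> carrier G" "x = a \<otimes> y" "a \<noteq> \<one>"
        using a by (auto simp: D_def left_divisors_def atoms_iff)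
      then have "l a + l y \<le> l x" "0 < l a"
        using l by (auto simp: length_function_def)
      then show ?thesis
        using less.hyps[of y] y cof by simp
    qed
    moreover have "finite D"
      using * less.prems by (simp add: D_def)
    ultimately have "finite (insert [] (\<Union>a\<in>D. Cons a ` rigid_factorizations G (cof a)))"
      by simp
    moreover have "as \<in> insert [] (\<Union>a\<in>D. Cons a ` rigid_factorizations G (cof a))"
      if "as \<in> rigid_factorizations G x" for as
    proof (cases as)
      case (Cons a bs)
      then obtain y where "a \<in> atoms G" "y \<in> carrier G" "bs \<in> rigid_factorizations G y" "x = a \<otimes> y"
        using \<open>as \<in> _\<close> by (auto simp: Cons_in_rigid_factorizations_iff)
      then show ?thesis
        using Cons cof[of a y] atoms_closed by (auto simp: D_def left_divisors_def)
    qed simp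
    ultimately show ?case by (meson finite_subset subsetI)
  qed
  then show "ff_monoid G" using * by (auto simp: ff_monoid_def bf_monoid_def)
qed

section \<open>Chain conditions\<close>

text \<open>Containment of principal left ideals is divisibility from the right, and a principal
  ideal has only one generator since the monoid is reduced. Hence chains of ideals may be replaced
  by chains of elements.\<close>

lemma left_accp_iff_chains:
  "left_accp G \<longleftrightarrow> (\<forall>x. (\<forall>i. x i \<in> carrier G \<and> (\<exists>m\<in>carrier G. x i = m \<otimes> x (Suc i))) \<longrightarrow>
     (\<exists>k. \<forall>i\<ge>k. x i = x k))" (is "_ \<longleftrightarrow> (\<forall>x. ?chain x \<longrightarrow> _)")
proof -
  have sub: "carrier G #> a \<subseteq> carrier G #> b \<longleftrightarrow> (\<exists>m\<in>carrier G. a = m \<otimes> b)"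
    if "a \<in> carrier G" "b \<in> carrier G" for a b
  proof
    assume "carrier G #> a \<subseteq> carrier G #> b"
    moreover have "a \<in> carrier G #> a"
      unfolding r_coset_def using that by (auto intro!: bexI[of _ \<one>])
    ultimately show "\<exists>m\<in>carrier G. a = m \<otimes> b" unfolding r_coset_def by blast
  next
    assume "\<exists>m\<in>carrier G. a = m \<otimes> b"
    then show "carrier G #> a \<subseteq> carrier G #> b"
      unfolding r_coset_def using that by (auto simp flip: m_assoc)
  qed
  have eq: "carrier G #> a = carrier G #> b \<longleftrightarrow> a = b" if ab: "a \<in> carrier G" "b \<in> carrier G" for a b
  proof
    assume *: "carrier G #> a = carrier G #> b"
    then obtain m m' where m: "m \<in> carrier G" "a = m \<otimes> b" "m' \<in> carrier G" "b = m' \<otimes> a"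
      using sub[OF ab] sub[OF ab(2,1)] by auto
    then have "(m \<otimes> m') \<otimes> a = \<one> \<otimes> a" using ab m by (metis l_one m_assoc)
    then have "m \<otimes> m' = \<one>" using m ab by (blast intro: r_cancel)
    then have "m = \<one>" using mult_eq_one(1)[of m m'] m by blast
    then show "a = b" using m ab by simp
  qed simp
  have chain: "(\<forall>i. x i \<in> carrier G) \<and> (\<forall>i. carrier G #> x i \<subseteq> carrier G #> x (Suc i)) \<longleftrightarrow> ?chain x" for x
    using sub by metis
  have const: "(\<exists>k. \<forall>i\<ge>k. carrier G #> x i = carrier G #> x k) \<longleftrightarrow> (\<exists>k. \<forall>i\<ge>k. x i = x k)"
    if "\<forall>i. x i \<in> carrier G" for x :: "nat \<Rightarrow> 'a"
    using eq that by metis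
  show ?thesis
    unfolding left_accp_def by (intro iff_allI imp_cong chain const) simp
qed

lemma right_accp_iff_chains:
  "right_accp G \<longleftrightarrow> (\<forall>x. (\<forall>i. x i \<in> carrier G \<and> (\<exists>m\<in>carrier G. x i = x (Suc i) \<otimes> m)) \<longrightarrow>
     (\<exists>k. \<forall>i\<ge>k. x i = x k))" (is "_ \<longleftrightarrow> (\<forall>x. ?chain x \<longrightarrow> _)")
proof -
  have sub: "a <# carrier G \<subseteq> b <# carrier G \<longleftrightarrow> (\<exists>m\<in>carrier G. a = b \<otimes> m)"
    if "a \<in> carrier G" "b \<in> carrier G" for a b
  proof
    assume "a <# carrier G \<subseteq> b <# carrier G"
    moreover have "a \<in> a <# carrier G"
      unfolding l_coset_def using that by (auto intro!: bexI[of _ \<one>])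
    ultimately show "\<exists>m\<in>carrier G. a = b \<otimes> m" unfolding l_coset_def by blast
  next
    assume "\<exists>m\<in>carrier G. a = b \<otimes> m"
    then show "a <# carrier G \<subseteq> b <# carrier G"
      unfolding l_coset_def using that by (auto simp: m_assoc)
  qed
  have eq: "a <# carrier G = b <# carrier G \<longleftrightarrow> a = b" if ab: "a \<in> carrier G" "b \<in> carrier G" for a b
  proof
    assume *: "a <# carrier G = b <# carrier G"
    then obtain m m' where m: "m \<in> carrier G" "a = b \<otimes> m" "m' \<in> carrier G" "b = a \<otimes> m'"
      using sub[OF ab] sub[OF ab(2,1)] by auto
    then have "a \<otimes> (m' \<otimes> m) = a \<otimes> \<one>" using ab m by (metis r_one m_assoc)
    then have "m' \<otimes> m = \<one>" using m ab by (blast intro: l_cancel)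
    then have "m = \<one>" using mult_eq_one(2)[of m' m] m by blast
    then show "a = b" using m ab by simp
  qed simp
  have chain: "(\<forall>i. x i \<in> carrier G) \<and> (\<forall>i. x i <# carrier G \<subseteq> x (Suc i) <# carrier G) \<longleftrightarrow> ?chain x" for x
    using sub by metis
  have const: "(\<exists>k. \<forall>i\<ge>k. x i <# carrier G = x k <# carrier G) \<longleftrightarrow> (\<exists>k. \<forall>i\<ge>k. x i = x k)"
    if "\<forall>i. x i \<in> carrier G" for x :: "nat \<Rightarrow> 'a"
    using eq that by metis
  show ?thesis
    unfolding right_accp_def by (intro iff_allI imp_cong chain const) simp
qed

text \<open>Along a divisor chain a length function is weakly decreasing, hence eventually constant;
  once it is constant the cofactors have length 0 and are the identity.\<close>

lemma bf_imp_accp: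
  assumes "bf_monoid G"
  shows "accp G"
proof -
  obtain l where l: "length_function l" using assms bf_iff_length_function by blast
  have *: "\<exists>k. \<forall>i\<ge>k. x i = x k"
    if dec: "\<And>i. l (x (Suc i)) \<le> l (x i)"
      and stat: "\<And>i. l (x (Suc i)) = l (x i) \<Longrightarrow> x (Suc i) = x i" for x :: "nat \<Rightarrow> 'a"
  proof -
    obtain k where k: "\<forall>i\<ge>k. l (x i) = l (x k)"
      using decseq_nat_eventually_const[of 0 "\<lambda>i. l (x i)"] dec by blast
    have "x i = x k" if "i \<ge> k" for i
      using that
    proof (induction rule: dec_induct)
      case (step i)
      then have "l (x (Suc i)) = l (x i)" using k by (metis le_SucI)
      then show ?case using stat step.IH by metis
    qed simp
    then show ?thesis by blast
  qed
  have "left_accp G"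
    unfolding left_accp_iff_chains
  proof (intro allI impI *)
    fix x i assume ch: "\<forall>i. x i \<in> carrier G \<and> (\<exists>m\<in>carrier G. x i = m \<otimes> x (Suc i))"
    then obtain m where m: "m \<in> carrier G" "x i = m \<otimes> x (Suc i)" by blast
    have le: "l m + l (x (Suc i)) \<le> l (x i)"
      using l ch m unfolding length_function_def by metis
    then show "l (x (Suc i)) \<le> l (x i)" by simp
    show "x (Suc i) = x i" if "l (x (Suc i)) = l (x i)"
    proof -
      have "m = \<one>" using le that l m(1) unfolding length_function_def by auto
      then show ?thesis using ch m by simp
    qed
  qed
  moreover have "right_accp G"
    unfolding right_accp_iff_chains
  proof (intro allI impI *)
    fix x i assume ch: "\<forall>i. x i \<in> carrier G \<and> (\<exists>m\<in>carrier G. x i = x (Suc i) \<otimes> m)"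
    then obtain m where m: "m \<in> carrier G" "x i = x (Suc i) \<otimes> m" by blast
    have le: "l (x (Suc i)) + l m \<le> l (x i)"
      using l ch m unfolding length_function_def by metis
    then show "l (x (Suc i)) \<le> l (x i)" by simp
    show "x (Suc i) = x i" if "l (x (Suc i)) = l (x i)"
    proof -
      have "m = \<one>" using le that l m(1) unfolding length_function_def by auto
      then show ?thesis using ch m by simp
    qed
  qed
  ultimately show ?thesis by (simp add: accp_def)
qed

text \<open>
  Right ACCP yields an atom dividing a given non-unit from the left; left ACCP then makes the
  process of splitting off such atoms terminate.
\<close>

lemma accp_imp_atomic:
  assumes "accp G"
  shows "atomic_monoid G"
proof -
  have wfR: "wf {(u, x). x \<in> carrier G \<and> u \<in> carrier G \<and> (\<exists>m\<in>carrier G. m \<noteq> \<one> \<and> x = u \<otimes> m)}"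
    (is "wf ?R")
    unfolding wf_iff_no_infinite_down_chain
  proof
    assume "\<exists>f. \<forall>i. (f (Suc i), f i) \<in> ?R"
    then obtain f where f: "\<And>i. (f (Suc i), f i) \<in> ?R" by blast
    then have "\<forall>i. f i \<in> carrier G \<and> (\<exists>m\<in>carrier G. f i = f (Suc i) \<otimes> m)" by fastforce
    moreover have "right_accp G" using assms by (simp add: accp_def)
    ultimately have "\<exists>k. \<forall>i\<ge>k. f i = f k"
      unfolding right_accp_iff_chains by (elim allE[of _ f]) simp
    then obtain k where "\<forall>i\<ge>k. f i = f k" by blast
    then have "f (Suc k) = f k" by (metis le_SucI le_refl)
    moreover obtain m where m: "m \<in> carrier G" "m \<noteq> \<one>" "f k = f (Suc k) \<otimes> m" "f k \<in> carrier G"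
      using f[of k] unfolding mem_Collect_eq prod.case by metis
    ultimately have "f k \<otimes> m = f k \<otimes> \<one>" by (metis r_one)
    with m show False using l_cancel by blast
  qed
  have wfL: "wf {(u, x). x \<in> carrier G \<and> u \<in> carrier G \<and> (\<exists>m\<in>carrier G. m \<noteq> \<one> \<and> x = m \<otimes> u)}"
    (is "wf ?L")
    unfolding wf_iff_no_infinite_down_chain
  proof
    assume "\<exists>f. \<forall>i. (f (Suc i), f i) \<in> ?L"
    then obtain f where f: "\<And>i. (f (Suc i), f i) \<in> ?L" by blast
    then have "\<forall>i. f i \<in> carrier G \<and> (\<exists>m\<in>carrier G. f i = m \<otimes> f (Suc i))" by fastforce
    moreover have "left_accp G" using assms by (simp add: accp_def)
    ultimately have "\<exists>k. \<forall>i\<ge>k. f i = f k"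
      unfolding left_accp_iff_chains by (elim allE[of _ f]) simp
    then obtain k where "\<forall>i\<ge>k. f i = f k" by blast
    then have "f (Suc k) = f k" by (metis le_SucI le_refl)
    moreover obtain m where m: "m \<in> carrier G" "m \<noteq> \<one>" "f k = m \<otimes> f (Suc k)" "f k \<in> carrier G"
      using f[of k] unfolding mem_Collect_eq prod.case by metis
    ultimately have "m \<otimes> f k = \<one> \<otimes> f k" by (metis l_one)
    with m show False using r_cancel by blast
  qed
  have atom: "x \<in> carrier G \<longrightarrow> x \<noteq> \<one> \<longrightarrow> (\<exists>a\<in>atoms G. \<exists>y\<in>carrier G. x = a \<otimes> y)" for x
    using wfR
  proof (induction x rule: wf_induct_rule)
    case (less x)
    show ?case
    proof (intro impI)
      assume x: "x \<in> carrier G" "x \<noteq> \<one>"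
      show "\<exists>a\<in>atoms G. \<exists>y\<in>carrier G. x = a \<otimes> y"
      proof (cases "x \<in> atoms G")
        case True
        then show ?thesis using x by (intro bexI[of _ x] bexI[of _ \<one>]) auto
      next
        case False
        then obtain u v where uv: "u \<in> carrier G" "v \<in> carrier G" "x = u \<otimes> v" "u \<noteq> \<one>" "v \<noteq> \<one>"
          using x by (auto simp: atoms_iff)
        then obtain a y where "a \<in> atoms G" "y \<in> carrier G" "u = a \<otimes> y"
          using less[of u] x by blast
        then show ?thesis
          using uv atoms_closed by (intro bexI[of _ a] bexI[of _ "y \<otimes> v"]) (auto simp: m_assoc)
      qed
    qed
  qed
  have "x \<in> carrier G \<longrightarrow> rigid_factorizations G x \<noteq> {}" for x
    using wfL
  proof (induction x rule: wf_induct_rule)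
    case (less x)
    show ?case
    proof (cases "x \<in> carrier G \<and> x \<noteq> \<one>")
      case True
      then obtain a y where a: "a \<in> atoms G" "y \<in> carrier G" "x = a \<otimes> y" using atom by blast
      then have "rigid_factorizations G y \<noteq> {}"
        using less[of y] True by (auto simp: atoms_iff)
      then show ?thesis
        using append_in_rigid_factorizations[OF singleton_in_rigid_factorizations[OF a(1)]] a(3) by blast
    qed (use Nil_in_rigid_factorizations_one in auto)
  qed
  then show ?thesis by (simp add: atomic_iff)
qed

end

section \<open>Divisor-closed submonoids\<close>

text \<open>Closure of the image under taking factors is what makes an atom of \<open>M\<close>
  remain an atom in \<open>N\<close> and forces every factorization of \<open>f x\<close> in
  \<open>N\<close> to come from \<open>M\<close>. Factorizations can therefore be carried in both
  directions.\<close>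

locale divisor_closed_embedding = M: reduced_monoid M + N: reduced_monoid N
  for M (structure) and N (structure) +
  fixes f
  assumes f_closed: "x \<in> carrier M \<Longrightarrow> f x \<in> carrier N"
    and f_one: "f \<one>\<^bsub>M\<^esub> = \<one>\<^bsub>N\<^esub>"
    and f_mult: "\<lbrakk>x \<in> carrier M; y \<in> carrier M\<rbrakk> \<Longrightarrow> f (x \<otimes>\<^bsub>M\<^esub> y) = f x \<otimes>\<^bsub>N\<^esub> f y"
    and f_inj: "inj_on f (carrier M)"
    and f_divisor_closed:
      "\<lbrakk>a \<in> carrier N; b \<in> carrier N; x \<in> carrier M; a \<otimes>\<^bsub>N\<^esub> b = f x\<rbrakk>
        \<Longrightarrow> a \<in> f ` carrier M \<and> b \<in> f ` carrier M"
begin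

lemma f_eq_iff: "\<lbrakk>x \<in> carrier M; y \<in> carrier M\<rbrakk> \<Longrightarrow> f x = f y \<longleftrightarrow> x = y"
  using f_inj by (auto dest: inj_onD)

lemma f_atoms_iff:
  assumes "x \<in> carrier M"
  shows "f x \<in> atoms N \<longleftrightarrow> x \<in> atoms M"
proof
  assume a: "f x \<in> atoms N"
  show "x \<in> atoms M"
    unfolding M.atoms_iff
  proof (intro conjI ballI impI)
    fix u v assume uv: "u \<in> carrier M" "v \<in> carrier M" "x = u \<otimes>\<^bsub>M\<^esub> v"
    then have "f u = \<one>\<^bsub>N\<^esub> \<or> f v = \<one>\<^bsub>N\<^esub>"
      using a f_closed by (auto simp: N.atoms_iff f_mult)
    then show "u = \<one>\<^bsub>M\<^esub> \<or> v = \<one>\<^bsub>M\<^esub>"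
      using uv f_eq_iff by (metis f_one M.one_closed)
  qed (use assms a f_one in \<open>auto simp: N.atoms_iff\<close>)
next
  assume a: "x \<in> atoms M"
  show "f x \<in> atoms N"
    unfolding N.atoms_iff
  proof (intro conjI ballI impI)
    fix a b assume ab: "a \<in> carrier N" "b \<in> carrier N" "f x = a \<otimes>\<^bsub>N\<^esub> b"
    then obtain u v where uv: "u \<in> carrier M" "v \<in> carrier M" "a = f u" "b = f v"
      using f_divisor_closed[of a b x] assms by auto
    then have "x = u \<otimes>\<^bsub>M\<^esub> v"
      using ab assms f_eq_iff by (simp flip: f_mult)
    then show "a = \<one>\<^bsub>N\<^esub> \<or> b = \<one>\<^bsub>N\<^esub>"
      using a uv f_one by (auto simp: M.atoms_iff)
  qed (use assms a f_closed f_eq_iff in \<open>auto simp: M.atoms_iff simp flip: f_one\<close>)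
qed

lemma rigid_factorizations_map:
  assumes "as \<in> rigid_factorizations M x"
  shows "map f as \<in> rigid_factorizations N (f x)"
  using assms
proof (induction as arbitrary: x)
  case Nil
  then show ?case using f_one by (simp add: rigid_factorizations_def)
next
  case (Cons a as)
  then show ?case
    using f_atoms_iff M.atoms_closed f_closed f_mult
    by (fastforce simp: M.Cons_in_rigid_factorizations_iff N.Cons_in_rigid_factorizations_iff)
qed

lemma rigid_factorizations_preimage:
  assumes "x \<in> carrier M" "bs \<in> rigid_factorizations N (f x)"
  shows "\<exists>as \<in> rigid_factorizations M x. bs = map f as"
  using assms
proof (induction bs arbitrary: x)
  case Nil
  then have "f x = f \<one>\<^bsub>M\<^esub>" using f_one by (simp add: rigid_factorizations_def)
  then have "x = \<one>\<^bsub>M\<^esub>" using Nil(1) f_eq_iff by blast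
  then show ?case using M.Nil_in_rigid_factorizations_one by auto
next
  case (Cons b bs)
  then obtain y where y: "b \<in> atoms N" "y \<in> carrier N" "bs \<in> rigid_factorizations N y"
      "f x = b \<otimes>\<^bsub>N\<^esub> y"
    by (auto simp: N.Cons_in_rigid_factorizations_iff)
  then obtain u v where uv: "u \<in> carrier M" "v \<in> carrier M" "b = f u" "y = f v"
    using f_divisor_closed[of b y x] Cons.prems N.atoms_closed by auto
  then have "x = u \<otimes>\<^bsub>M\<^esub> v"
    using y Cons.prems f_eq_iff by (simp flip: f_mult)
  moreover obtain as where "as \<in> rigid_factorizations M v" "bs = map f as"
    using Cons.IH[of v] uv y by blast
  ultimately show ?case
    using uv y f_atoms_iff by (intro bexI[of _ "u # as"]) (auto simp: M.Cons_in_rigid_factorizations_iff)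
qed

lemma atomic_pullback: "atomic_monoid N \<Longrightarrow> atomic_monoid M"
  unfolding N.atomic_iff M.atomic_iff using rigid_factorizations_preimage f_closed by blast

lemma bf_pullback: "bf_monoid N \<Longrightarrow> bf_monoid M"
proof -
  assume "bf_monoid N"
  then obtain l where "N.length_function l" using N.bf_iff_length_function by blast
  then have "M.length_function (\<lambda>x. l (f x))"
    unfolding N.length_function_def M.length_function_def
    using f_closed f_mult f_one f_eq_iff M.one_closed by metis
  then show ?thesis using M.bf_iff_length_function by blast
qed

lemma ff_pullback: "ff_monoid N \<Longrightarrow> ff_monoid M"
proof -
  assume ff: "ff_monoid N"
  have "finite (M.left_divisors x)" if "x \<in> carrier M" for x
  proof (rule finite_imageD)
    have "f ` M.left_divisors x \<subseteq> N.left_divisors (f x)"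
      unfolding M.left_divisors_def N.left_divisors_def using f_closed f_mult by blast
    then show "finite (f ` M.left_divisors x)"
      using ff that f_closed finite_subset unfolding N.ff_iff_finite_left_divisors by blast
    show "inj_on f (M.left_divisors x)"
      using f_inj by (rule inj_on_subset) (auto simp: M.left_divisors_def)
  qed
  with ff show ?thesis
    unfolding N.ff_iff_finite_left_divisors M.ff_iff_finite_left_divisors using bf_pullback by blast
qed

lemma accp_pullback: "accp N \<Longrightarrow> accp M"
proof -
  assume N: "accp N"
  have const: "(\<forall>i\<ge>k. f (x i) = f (x k)) \<longleftrightarrow> (\<forall>i\<ge>k. x i = x k)" if "\<forall>i. x i \<in> carrier M" for x :: "nat \<Rightarrow> _" and k
    using that f_eq_iff by blast
  have "left_accp M"
    unfolding M.left_accp_iff_chains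
  proof (intro allI impI)
    fix x assume x: "\<forall>i. x i \<in> carrier M \<and> (\<exists>m\<in>carrier M. x i = m \<otimes>\<^bsub>M\<^esub> x (Suc i))"
    then have "\<forall>i. f (x i) \<in> carrier N \<and> (\<exists>m\<in>carrier N. f (x i) = m \<otimes>\<^bsub>N\<^esub> f (x (Suc i)))"
      using f_closed f_mult by metis
    then have "\<exists>k. \<forall>i\<ge>k. f (x i) = f (x k)"
      using N unfolding accp_def N.left_accp_iff_chains by (elim conjE allE[of _ "\<lambda>i. f (x i)"]) blast
    then show "\<exists>k. \<forall>i\<ge>k. x i = x k" using const x by auto
  qed
  moreover have "right_accp M"
    unfolding M.right_accp_iff_chains
  proof (intro allI impI)
    fix x assume x: "\<forall>i. x i \<in> carrier M \<and> (\<exists>m\<in>carrier M. x i = x (Suc i) \<otimes>\<^bsub>M\<^esub> m)"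
    then have "\<forall>i. f (x i) \<in> carrier N \<and> (\<exists>m\<in>carrier N. f (x i) = f (x (Suc i)) \<otimes>\<^bsub>N\<^esub> m)"
      using f_closed f_mult by metis
    then have "\<exists>k. \<forall>i\<ge>k. f (x i) = f (x k)"
      using N unfolding accp_def N.right_accp_iff_chains by (elim conjE allE[of _ "\<lambda>i. f (x i)"]) blast
    then show "\<exists>k. \<forall>i\<ge>k. x i = x k" using const x by auto
  qed
  ultimately show ?thesis by (simp add: accp_def)
qed

end

section \<open>Upper triangular matrices over a reduced information semialgebra\<close>

context reduced_information_semialgebra
begin

lemma reduced_monoid_add: "reduced_monoid (add_monoid S)"
  using add_cancel add_Units
  by (intro reduced_monoid.intro reduced_monoid_axioms.intro) (simp_all add: comm_monoid_cancel_def)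

lemma reduced_monoid_mult: "reduced_monoid (mult_of S)"
  using mult_cancel mult_Units
  by (intro reduced_monoid.intro reduced_monoid_axioms.intro) (simp_all add: comm_monoid_cancel_def)

sublocale add: reduced_monoid "add_monoid S"
  rewrites "carrier (add_monoid S) = carrier S"
    and "mult (add_monoid S) = add S"
    and "one (add_monoid S) = zero S"
  by (fact reduced_monoid_add) simp_all

sublocale mul: reduced_monoid "mult_of S"
  rewrites "carrier (mult_of S) = carrier S - {\<zero>}"
    and "mult (mult_of S) = mult S"
    and "one (mult_of S) = one S"
  by (fact reduced_monoid_mult) simp_all

lemma one_not_zero [simp]: "\<one> \<noteq> \<zero>" "\<zero> \<noteq> \<one>"
  using mul.one_closed by auto

lemma mult_nonzero: "\<lbrakk>x \<in> carrier S; y \<in> carrier S; x \<noteq> \<zero>; y \<noteq> \<zero>\<rbrakk> \<Longrightarrow> x \<otimes> y \<noteq> \<zero>"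
  using mul.m_closed by blast

lemma mult_eq_zero_iff: "\<lbrakk>x \<in> carrier S; y \<in> carrier S\<rbrakk> \<Longrightarrow> x \<otimes> y = \<zero> \<longleftrightarrow> x = \<zero> \<or> y = \<zero>"
  using mult_nonzero by auto

text \<open>The axiom cancels only within the nonzero elements; the absence of zero divisors settles
  the cases in which \<open>y\<close> or \<open>z\<close> is zero.\<close>

lemma mult_left_cancel:
  assumes "x \<in> carrier S" "y \<in> carrier S" "z \<in> carrier S" "x \<noteq> \<zero>" "x \<otimes> y = x \<otimes> z"
  shows "y = z"
proof (cases "y = \<zero> \<or> z = \<zero>")
  case True
  then show ?thesis using assms mult_eq_zero_iff by (metis r_null)
next
  case False
  then show ?thesis using assms by (intro mul.l_cancel[of x y z]) auto
qed

lemma mult_right_cancel: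
  assumes "x \<in> carrier S" "y \<in> carrier S" "z \<in> carrier S" "x \<noteq> \<zero>" "y \<otimes> x = z \<otimes> x"
  shows "y = z"
proof (cases "y = \<zero> \<or> z = \<zero>")
  case True
  then show ?thesis using assms mult_eq_zero_iff by (metis l_null)
next
  case False
  then show ?thesis using assms by (intro mul.r_cancel[of y x z]) auto
qed

lemma mult_comm: "\<lbrakk>x \<in> carrier S; y \<in> carrier S\<rbrakk> \<Longrightarrow> x \<otimes> y = y \<otimes> x"
proof -
  interpret c: comm_monoid_cancel "mult_of S" by (rule mult_cancel)
  show "x \<otimes> y = y \<otimes> x" if "x \<in> carrier S" "y \<in> carrier S"
    using c.m_comm[of x y] that by (cases "x = \<zero>"; cases "y = \<zero>") simp_all
qed

lemma mult_left_comm: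
  "\<lbrakk>x \<in> carrier S; y \<in> carrier S; z \<in> carrier S\<rbrakk> \<Longrightarrow> x \<otimes> (y \<otimes> z) = y \<otimes> (x \<otimes> z)"
  by (metis m_assoc mult_comm)

lemma finsum_remove:
  assumes "finite I" "i \<in> I" "f \<in> I \<rightarrow> carrier S"
  shows "finsum S f I = f i \<oplus> finsum S f (I - {i})"
proof -
  have "finsum S f (insert i (I - {i})) = f i \<oplus> finsum S f (I - {i})"
    by (rule finsum_insert) (use assms in auto)
  then show ?thesis using assms(2) by (simp add: insert_absorb)
qed

lemma finsum_restrict:
  assumes "finite I" "K \<subseteq> I" "\<And>i. i \<in> I - K \<Longrightarrow> f i = \<zero>" "f \<in> I \<rightarrow> carrier S"
  shows "finsum S f I = finsum S f K"
  by (rule add.finprod_mono_neutral_cong_right[folded finsum_def]) (use assms in auto)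

lemma finsum_single:
  assumes "finite I" "i \<in> I" "f i \<in> carrier S" "\<And>j. j \<in> I \<Longrightarrow> j \<noteq> i \<Longrightarrow> f j = \<zero>"
  shows "finsum S f I = f i"
proof -
  have "f \<in> I \<rightarrow> carrier S" using assms by (metis Pi_I zero_closed)
  then have "finsum S f I = finsum S f {i}"
    by (intro finsum_restrict) (use assms in auto)
  then show ?thesis using assms(3) by (simp add: finsum_insert finsum_empty)
qed

lemma finsum_swap:
  assumes "finite I" "finite J" "\<And>i j. i \<in> I \<Longrightarrow> j \<in> J \<Longrightarrow> f i j \<in> carrier S"
  shows "(\<Oplus>i\<in>I. \<Oplus>j\<in>J. f i j) = (\<Oplus>j\<in>J. \<Oplus>i\<in>I. f i j)"
  using assms(1,3)
proof (induction I)
  case (insert i I)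
  have "(\<Oplus>j\<in>J. \<Oplus>i\<in>insert i I. f i j) = (\<Oplus>j\<in>J. f i j \<oplus> (\<Oplus>i\<in>I. f i j))"
    by (rule finsum_cong') (use insert in \<open>auto intro!: finsum_closed finsum_insert\<close>)
  also have "\<dots> = (\<Oplus>j\<in>J. f i j) \<oplus> (\<Oplus>j\<in>J. \<Oplus>i\<in>I. f i j)"
    by (rule finsum_addf) (use insert in \<open>auto intro!: finsum_closed\<close>)
  also have "(\<Oplus>j\<in>J. \<Oplus>i\<in>I. f i j) = (\<Oplus>i\<in>I. \<Oplus>j\<in>J. f i j)"
    by (rule sym, rule insert.IH) (use insert.prems in auto)
  also have "(\<Oplus>j\<in>J. f i j) \<oplus> \<dots> = (\<Oplus>i\<in>insert i I. \<Oplus>j\<in>J. f i j)"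
    by (rule finsum_insert[symmetric]) (use insert in \<open>auto intro!: finsum_closed\<close>)
  finally show ?case ..
qed (simp add: finsum_empty)

end

section \<open>Products of upper triangular matrices\<close>

locale reduced_semialgebra_matrices = reduced_information_semialgebra +
  fixes n :: nat
begin

abbreviation U where "U \<equiv> upper_triangular_semiring n S"
abbreviation T where "T \<equiv> upper_triangular_monoid n S"

lemma U_carrier_iff:
  "A \<in> carrier U \<longleftrightarrow> A \<in> carrier_mat n n \<and> (\<forall>i<n. \<forall>j<n. A $$ (i, j) \<in> carrier S) \<and>
     (\<forall>i<n. \<forall>j<i. A $$ (i, j) = \<zero>)"
  by (simp add: upper_triangular_semiring_def)

lemma mult_entry:
  "\<lbrakk>i < n; j < n\<rbrakk> \<Longrightarrow> (A \<otimes>\<^bsub>U\<^esub> B) $$ (i, j) = (\<Oplus>k\<in>{..<n}. A $$ (i, k) \<otimes> B $$ (k, j))"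
  by (simp add: upper_triangular_semiring_def)

lemma U_mult_dim: "A \<otimes>\<^bsub>U\<^esub> B \<in> carrier_mat n n"
  by (simp add: upper_triangular_semiring_def)

lemma U_one: "\<one>\<^bsub>U\<^esub> = mat n n (\<lambda>(i, j). if i = j then \<one> else \<zero>)"
  by (simp add: upper_triangular_semiring_def)

lemma U_mat_iff:
  "mat n n f \<in> carrier U \<longleftrightarrow> (\<forall>i<n. \<forall>j<n. f (i, j) \<in> carrier S) \<and> (\<forall>i<n. \<forall>j<i. f (i, j) = \<zero>)"
  by (auto simp: U_carrier_iff)

lemma U_dim: "A \<in> carrier U \<Longrightarrow> dim_row A = n \<and> dim_col A = n"
  by (auto simp: U_carrier_iff)

lemma U_entry [simp]: "\<lbrakk>A \<in> carrier U; i < n; j < n\<rbrakk> \<Longrightarrow> A $$ (i, j) \<in> carrier S"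
  by (simp add: U_carrier_iff)

lemma U_lower: "\<lbrakk>A \<in> carrier U; i < n; j < i\<rbrakk> \<Longrightarrow> A $$ (i, j) = \<zero>"
  by (simp add: U_carrier_iff)

lemma U_eqI:
  "\<lbrakk>A \<in> carrier U; B \<in> carrier U; \<And>i j. \<lbrakk>i \<le> j; j < n\<rbrakk> \<Longrightarrow> A $$ (i, j) = B $$ (i, j)\<rbrakk> \<Longrightarrow> A = B"
  by (rule eq_matI) (auto simp: U_dim, metis U_lower linorder_le_less_linear)

lemma U_mult_closed [simp]:
  assumes A: "A \<in> carrier U" and B: "B \<in> carrier U"
  shows "A \<otimes>\<^bsub>U\<^esub> B \<in> carrier U"
  unfolding U_carrier_iff
proof (intro conjI allI impI)
  show "A \<otimes>\<^bsub>U\<^esub> B \<in> carrier_mat n n"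
    by (rule U_mult_dim)
next
  fix i j assume ij: "i < n" "j < n"
  then show "(A \<otimes>\<^bsub>U\<^esub> B) $$ (i, j) \<in> carrier S"
    using A B by (auto simp: mult_entry intro!: finsum_closed)
next
  fix i j assume ij: "i < n" "j < i"
  have "A $$ (i, k) \<otimes> B $$ (k, j) = \<zero>" if "k < n" for k
    using A B ij that by (cases "k < i") (simp_all add: U_lower)
  then have "(\<Oplus>k\<in>{..<n}. A $$ (i, k) \<otimes> B $$ (k, j)) = (\<Oplus>k\<in>{..<n}. \<zero>)"
    by (intro finsum_cong') auto
  then show "(A \<otimes>\<^bsub>U\<^esub> B) $$ (i, j) = \<zero>"
    using ij by (simp add: mult_entry finsum_zero)
qed

lemma U_one_closed [simp]: "\<one>\<^bsub>U\<^esub> \<in> carrier U"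
  by (simp add: U_one U_mat_iff)

lemma mult_assoc_U:
  assumes A: "A \<in> carrier U" and B: "B \<in> carrier U" and C: "C \<in> carrier U"
  shows "A \<otimes>\<^bsub>U\<^esub> B \<otimes>\<^bsub>U\<^esub> C = A \<otimes>\<^bsub>U\<^esub> (B \<otimes>\<^bsub>U\<^esub> C)"
proof (rule U_eqI)
  fix i j assume "i \<le> j" "j < n"
  then have ij: "i < n" "j < n" by auto
  have "(A \<otimes>\<^bsub>U\<^esub> B \<otimes>\<^bsub>U\<^esub> C) $$ (i, j) =
    (\<Oplus>k\<in>{..<n}. \<Oplus>l\<in>{..<n}. A $$ (i, l) \<otimes> B $$ (l, k) \<otimes> C $$ (k, j))"
    using A B C ij by (subst mult_entry; auto intro!: finsum_cong' finsum_closed simp: mult_entry finsum_ldistr)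
  also have "\<dots> = (\<Oplus>l\<in>{..<n}. \<Oplus>k\<in>{..<n}. A $$ (i, l) \<otimes> B $$ (l, k) \<otimes> C $$ (k, j))"
    using A B C ij by (intro finsum_swap) auto
  also have "\<dots> = (A \<otimes>\<^bsub>U\<^esub> (B \<otimes>\<^bsub>U\<^esub> C)) $$ (i, j)"
    using A B C ij by (subst mult_entry; auto intro!: finsum_cong' finsum_closed simp: mult_entry finsum_rdistr m_assoc)
  finally show "(A \<otimes>\<^bsub>U\<^esub> B \<otimes>\<^bsub>U\<^esub> C) $$ (i, j) = (A \<otimes>\<^bsub>U\<^esub> (B \<otimes>\<^bsub>U\<^esub> C)) $$ (i, j)" .
qed (use A B C in auto)

lemma mult_entry_row:
  assumes A: "A \<in> carrier U" and B: "B \<in> carrier U" and ij: "i < n" "j < n"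
    and K: "K \<subseteq> {..<n}" "\<And>k. \<lbrakk>k < n; k \<notin> K\<rbrakk> \<Longrightarrow> A $$ (i, k) = \<zero>"
  shows "(A \<otimes>\<^bsub>U\<^esub> B) $$ (i, j) = (\<Oplus>k\<in>K. A $$ (i, k) \<otimes> B $$ (k, j))"
  using assms by (auto simp: mult_entry intro!: finsum_restrict)

lemma mult_entry_row_singleton:
  assumes A: "A \<in> carrier U" and B: "B \<in> carrier U" and ij: "i < n" "j < n"
    and K: "\<And>k. \<lbrakk>k < n; k \<noteq> i\<rbrakk> \<Longrightarrow> A $$ (i, k) = \<zero>"
  shows "(A \<otimes>\<^bsub>U\<^esub> B) $$ (i, j) = A $$ (i, i) \<otimes> B $$ (i, j)"
proof -
  have "(A \<otimes>\<^bsub>U\<^esub> B) $$ (i, j) = (\<Oplus>k\<in>{i}. A $$ (i, k) \<otimes> B $$ (k, j))"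
    by (rule mult_entry_row) (use assms in auto)
  then show ?thesis using A B ij by (simp add: finsum_insert finsum_empty)
qed

lemma mult_entry_row_doubleton:
  assumes A: "A \<in> carrier U" and B: "B \<in> carrier U" and ij: "i < n" "j < n" "l < n" "l \<noteq> i"
    and K: "\<And>k. \<lbrakk>k < n; k \<noteq> i; k \<noteq> l\<rbrakk> \<Longrightarrow> A $$ (i, k) = \<zero>"
  shows "(A \<otimes>\<^bsub>U\<^esub> B) $$ (i, j) = A $$ (i, i) \<otimes> B $$ (i, j) \<oplus> A $$ (i, l) \<otimes> B $$ (l, j)"
proof -
  have "(A \<otimes>\<^bsub>U\<^esub> B) $$ (i, j) = (\<Oplus>k\<in>{i, l}. A $$ (i, k) \<otimes> B $$ (k, j))"
    by (rule mult_entry_row) (use assms in auto)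
  then show ?thesis using A B ij by (simp add: finsum_insert finsum_empty)
qed

lemma monoid_U: "monoid U"
proof (rule monoidI)
  fix A assume A: "A \<in> carrier U"
  show "\<one>\<^bsub>U\<^esub> \<otimes>\<^bsub>U\<^esub> A = A"
  proof (rule U_eqI)
    fix i j assume "i \<le> j" "j < n"
    then show "(\<one>\<^bsub>U\<^esub> \<otimes>\<^bsub>U\<^esub> A) $$ (i, j) = A $$ (i, j)"
      using A by (subst mult_entry_row_singleton) (auto simp: U_one U_mat_iff)
  qed (use A in auto)
  show "A \<otimes>\<^bsub>U\<^esub> \<one>\<^bsub>U\<^esub> = A"
  proof (rule U_eqI)
    fix i j assume ij: "i \<le> j" "j < n"
    then have "(\<Oplus>k\<in>{..<n}. A $$ (i, k) \<otimes> \<one>\<^bsub>U\<^esub> $$ (k, j)) = A $$ (i, j) \<otimes> \<one>\<^bsub>U\<^esub> $$ (j, j)"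
      using A by (intro finsum_single) (auto simp: U_one)
    then show "(A \<otimes>\<^bsub>U\<^esub> \<one>\<^bsub>U\<^esub>) $$ (i, j) = A $$ (i, j)"
      using A ij by (simp add: mult_entry, simp add: U_one)
  qed (use A in auto)
qed (auto simp: mult_assoc_U)

lemma diag_mult:
  assumes A: "A \<in> carrier U" and B: "B \<in> carrier U" and i: "i < n"
  shows "(A \<otimes>\<^bsub>U\<^esub> B) $$ (i, i) = A $$ (i, i) \<otimes> B $$ (i, i)"
proof -
  have "A $$ (i, k) \<otimes> B $$ (k, i) = \<zero>" if "k < n" "k \<noteq> i" for k
    using A B i that by (cases "k < i") (simp_all add: U_lower)
  then have "(\<Oplus>k\<in>{..<n}. A $$ (i, k) \<otimes> B $$ (k, i)) = A $$ (i, i) \<otimes> B $$ (i, i)"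
    using A B i by (intro finsum_single) auto
  then show ?thesis using i by (simp add: mult_entry)
qed

text \<open>Only the summands \<open>k = i\<close> and \<open>k = j\<close> are kept, the others go
  into \<open>r\<close>. Each kept summand pairs an off-diagonal entry with a diagonal one, so over
  matrices with nonzero diagonal neither \<open>A $$ (i, j)\<close> nor \<open>B $$ (i, j)\<close>
  can be lost in the product.\<close>

lemma offdiag_mult:
  assumes A: "A \<in> carrier U" and B: "B \<in> carrier U" and ij: "i < j" "j < n"
  shows "\<exists>r\<in>carrier S. (A \<otimes>\<^bsub>U\<^esub> B) $$ (i, j) = (A $$ (i, i) \<otimes> B $$ (i, j) \<oplus> A $$ (i, j) \<otimes> B $$ (j, j)) \<oplus> r"
proof -
  let ?f = "\<lambda>k. A $$ (i, k) \<otimes> B $$ (k, j)"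
  have f: "?f k \<in> carrier S" if "k < n" for k using A B ij that by auto
  let ?r = "finsum S ?f ({..<n} - {i} - {j})"
  have "(A \<otimes>\<^bsub>U\<^esub> B) $$ (i, j) = ?f i \<oplus> finsum S ?f ({..<n} - {i})"
    using ij f by (subst mult_entry) (auto intro!: finsum_remove)
  also have "finsum S ?f ({..<n} - {i}) = ?f j \<oplus> ?r"
    using ij f by (intro finsum_remove) auto
  finally have "(A \<otimes>\<^bsub>U\<^esub> B) $$ (i, j) = (?f i \<oplus> ?f j) \<oplus> ?r"
    using ij f by (simp add: a_assoc finsum_closed)
  moreover have "?r \<in> carrier S" using f by (auto intro!: finsum_closed)
  ultimately show ?thesis by blast
qed

section \<open>The cancellable upper triangular matrices\<close>

text \<open>Triangular solving by cancellation: the summands known to agree are cancelled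
  additively, then the diagonal entry is cancelled multiplicatively. For a left factor
  \<open>A\<close> the rows are treated from the bottom up, for a right factor the columns from left
  to right.\<close>

lemma cancellable_if_diag_nonzero:
  assumes A: "A \<in> carrier U" and diag: "\<And>i. i < n \<Longrightarrow> A $$ (i, i) \<noteq> \<zero>"
    and X: "X \<in> carrier U" and Y: "Y \<in> carrier U"
  shows "A \<otimes>\<^bsub>U\<^esub> X = A \<otimes>\<^bsub>U\<^esub> Y \<Longrightarrow> X = Y" "X \<otimes>\<^bsub>U\<^esub> A = Y \<otimes>\<^bsub>U\<^esub> A \<Longrightarrow> X = Y"
proof -
  assume eq: "A \<otimes>\<^bsub>U\<^esub> X = A \<otimes>\<^bsub>U\<^esub> Y"
  have "X $$ (i, j) = Y $$ (i, j)" if "i < n" "j < n" for i j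
    using that
  proof (induction "n - i" arbitrary: i rule: less_induct)
    case less
    let ?f = "\<lambda>Z k. A $$ (i, k) \<otimes> Z $$ (k, j)"
    have split: "(A \<otimes>\<^bsub>U\<^esub> Z) $$ (i, j) = ?f Z i \<oplus> finsum S (?f Z) ({..<n} - {i})"
      if "Z \<in> carrier U" for Z
      using A that less.prems by (subst mult_entry) (auto intro!: finsum_remove)
    have "?f X k = ?f Y k" if "k < n" "k \<noteq> i" for k
      using that less A X Y by (cases "k < i") (auto simp: U_lower)
    then have "finsum S (?f X) ({..<n} - {i}) = finsum S (?f Y) ({..<n} - {i})"
      using A Y less.prems by (intro finsum_cong') auto
    moreover have "finsum S (?f Y) ({..<n} - {i}) \<in> carrier S"
      using A Y less.prems by (auto intro!: finsum_closed)
    moreover have "?f X i \<oplus> finsum S (?f X) ({..<n} - {i}) = ?f Y i \<oplus> finsum S (?f Y) ({..<n} - {i})"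
      using split[OF X] split[OF Y] eq by metis
    ultimately have "?f X i = ?f Y i"
      using A X Y less.prems by (intro add.r_cancel[of "?f X i" "finsum S (?f Y) ({..<n} - {i})" "?f Y i"]) auto
    then show ?case by (rule mult_left_cancel[rotated 4]) (use A X Y less.prems diag in auto)
  qed
  then show "X = Y" using X Y by (intro U_eqI) auto
next
  assume eq: "X \<otimes>\<^bsub>U\<^esub> A = Y \<otimes>\<^bsub>U\<^esub> A"
  have "X $$ (i, j) = Y $$ (i, j)" if "i < n" "j < n" for i j
    using that
  proof (induction j rule: less_induct)
    case (less j)
    let ?f = "\<lambda>Z k. Z $$ (i, k) \<otimes> A $$ (k, j)"
    have split: "(Z \<otimes>\<^bsub>U\<^esub> A) $$ (i, j) = ?f Z j \<oplus> finsum S (?f Z) ({..<n} - {j})"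
      if "Z \<in> carrier U" for Z
      using A that less.prems by (subst mult_entry) (auto intro!: finsum_remove)
    have "?f X k = ?f Y k" if "k < n" "k \<noteq> j" for k
      using that less A X Y by (cases "k < j") (auto simp: U_lower)
    then have "finsum S (?f X) ({..<n} - {j}) = finsum S (?f Y) ({..<n} - {j})"
      using A Y less.prems by (intro finsum_cong') auto
    moreover have "finsum S (?f Y) ({..<n} - {j}) \<in> carrier S"
      using A Y less.prems by (auto intro!: finsum_closed)
    moreover have "?f X j \<oplus> finsum S (?f X) ({..<n} - {j}) = ?f Y j \<oplus> finsum S (?f Y) ({..<n} - {j})"
      using split[OF X] split[OF Y] eq by metis
    ultimately have "?f X j = ?f Y j"
      using A X Y less.prems by (intro add.r_cancel[of "?f X j" "finsum S (?f Y) ({..<n} - {j})" "?f Y j"]) auto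
    then show ?case by (rule mult_right_cancel[rotated 4]) (use A X Y less.prems diag in auto)
  qed
  then show "X = Y" using X Y by (intro U_eqI) auto
qed

text \<open>
  Back substitution without subtraction: \<open>x - y\<close> is a null vector, with last entry \<open>d\<close>, of the
  rows \<open>m, \<dots>, i - 1\<close> of \<open>A\<close> cut off after column \<open>i\<close>; multiplying by the next diagonal entry
  makes it possible to solve the next row.
\<close>

lemma back_substitution:
  assumes A: "A \<in> carrier U" and i: "i < n" and diag: "\<And>k. k < i \<Longrightarrow> A $$ (k, k) \<noteq> \<zero>" and m: "m \<le> i"
  shows "\<exists>x y d. (\<forall>k. x k \<in> carrier S \<and> y k \<in> carrier S) \<and> d \<in> carrier S \<and> d \<noteq> \<zero> \<and>
    (\<forall>k. m \<le> k \<and> k < i \<longrightarrow>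
      (\<Oplus>l\<in>{m..<i}. A $$ (k, l) \<otimes> x l) \<oplus> A $$ (k, i) \<otimes> d = (\<Oplus>l\<in>{m..<i}. A $$ (k, l) \<otimes> y l))"
  using m
proof (induction m rule: inc_induct)
  case base
  \<comment> \<open>For \<open>m = i\<close> there are no rows to satisfy; \<open>d\<close> just has
    to be nonzero.\<close>
  show ?case by (intro exI[of _ "\<lambda>_. \<zero>"] exI[of _ \<one>]) auto
next
  case (step m)
  then obtain x y d where xy: "\<And>k. x k \<in> carrier S" "\<And>k. y k \<in> carrier S" and d: "d \<in> carrier S" "d \<noteq> \<zero>"
    and eq: "\<And>k. Suc m \<le> k \<Longrightarrow> k < i \<Longrightarrow>
      (\<Oplus>l\<in>{Suc m..<i}. A $$ (k, l) \<otimes> x l) \<oplus> A $$ (k, i) \<otimes> d = (\<Oplus>l\<in>{Suc m..<i}. A $$ (k, l) \<otimes> y l)"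
    by blast
  define a where "a = A $$ (m, m)"
  have a: "a \<in> carrier S" "a \<noteq> \<zero>" using A i step.hyps diag by (auto simp: a_def)
  let ?s = "\<lambda>k z. (\<Oplus>l\<in>{Suc m..<i}. A $$ (k, l) \<otimes> z l)"
  have s: "?s k z \<in> carrier S" if "k < n" "\<And>l. z l \<in> carrier S" for k z
    using A i that by (auto intro!: finsum_closed)
  \<comment> \<open>The new coordinate of each vector receives what row \<open>m\<close> contributes
    on the opposite side. After multiplication by \<open>a\<close> both sides of row
    \<open>m\<close> are then the same sum in a different order. The rows below \<open>m\<close> are
    merely scaled by \<open>a\<close>, as they have a zero in column \<open>m\<close>.\<close>
  define x' where "x' = (\<lambda>l. if l = m then ?s m y else a \<otimes> x l)"
  define y' where "y' = (\<lambda>l. if l = m then ?s m x \<oplus> A $$ (m, i) \<otimes> d else a \<otimes> y l)"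
  have x'y': "x' l \<in> carrier S" "y' l \<in> carrier S" for l
    using A i step.hyps a xy d s by (auto simp: x'_def y'_def)
  have split: "(\<Oplus>l\<in>{m..<i}. A $$ (k, l) \<otimes> z' l) = A $$ (k, m) \<otimes> z' m \<oplus> a \<otimes> ?s k z"
    if z: "\<And>l. z l \<in> carrier S" "\<And>l. z' l \<in> carrier S" "\<And>l. l \<noteq> m \<Longrightarrow> z' l = a \<otimes> z l" and k: "k < n" for z z' k
  proof -
    have "(\<Oplus>l\<in>{m..<i}. A $$ (k, l) \<otimes> z' l) =
      A $$ (k, m) \<otimes> z' m \<oplus> (\<Oplus>l\<in>{m..<i} - {m}. A $$ (k, l) \<otimes> z' l)"
      using A i k z step.hyps by (intro finsum_remove) auto
    also have "{m..<i} - {m} = {Suc m..<i}" by auto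
    also have "(\<Oplus>l\<in>{Suc m..<i}. A $$ (k, l) \<otimes> z' l) = (\<Oplus>l\<in>{Suc m..<i}. a \<otimes> (A $$ (k, l) \<otimes> z l))"
    proof (rule finsum_cong')
      fix l assume l: "l \<in> {Suc m..<i}"
      then have c: "A $$ (k, l) \<in> carrier S" using A i k by auto
      have "A $$ (k, l) \<otimes> (a \<otimes> z l) = a \<otimes> (A $$ (k, l) \<otimes> z l)"
        using c a z(1)[of l] by (intro mult_left_comm)
      then show "A $$ (k, l) \<otimes> z' l = a \<otimes> (A $$ (k, l) \<otimes> z l)"
        using z(3) l by simp
    qed (use A i k z a in auto)
    also have "\<dots> = a \<otimes> ?s k z"
      using A i k z a by (intro finsum_rdistr[symmetric]) auto
    finally show ?thesis .
  qed
  have "(\<Oplus>l\<in>{m..<i}. A $$ (k, l) \<otimes> x' l) \<oplus> A $$ (k, i) \<otimes> (a \<otimes> d) = (\<Oplus>l\<in>{m..<i}. A $$ (k, l) \<otimes> y' l)"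
    if k: "m \<le> k" "k < i" for k
  proof -
    have kn: "k < n" using k i by simp
    have cc: "A $$ (k, i) \<in> carrier S" "A $$ (k, m) \<in> carrier S" using A i k by auto
    have ad: "A $$ (k, i) \<otimes> (a \<otimes> d) = a \<otimes> (A $$ (k, i) \<otimes> d)"
      using cc a d by (intro mult_left_comm)
    have L: "(\<Oplus>l\<in>{m..<i}. A $$ (k, l) \<otimes> x' l) = A $$ (k, m) \<otimes> x' m \<oplus> a \<otimes> ?s k x"
      by (rule split) (use xy x'y' kn in \<open>auto simp: x'_def\<close>)
    have R: "(\<Oplus>l\<in>{m..<i}. A $$ (k, l) \<otimes> y' l) = A $$ (k, m) \<otimes> y' m \<oplus> a \<otimes> ?s k y"
      by (rule split) (use xy x'y' kn in \<open>auto simp: y'_def\<close>)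
    have sx: "?s k x \<in> carrier S" and sy: "?s k y \<in> carrier S" using s kn xy by auto
    have "a \<otimes> ?s k x \<oplus> a \<otimes> (A $$ (k, i) \<otimes> d) = a \<otimes> (?s k x \<oplus> A $$ (k, i) \<otimes> d)"
      using a sx cc d by (simp add: r_distr)
    then have L': "(\<Oplus>l\<in>{m..<i}. A $$ (k, l) \<otimes> x' l) \<oplus> A $$ (k, i) \<otimes> (a \<otimes> d) =
        A $$ (k, m) \<otimes> x' m \<oplus> a \<otimes> (?s k x \<oplus> A $$ (k, i) \<otimes> d)"
      unfolding L ad using a sx cc d x'y' by (simp add: a_assoc)
    show ?thesis
    proof (cases "k = m")
      case True
      have "x' m = ?s m y" "y' m = ?s m x \<oplus> A $$ (m, i) \<otimes> d"
        by (simp_all add: x'_def y'_def)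
      then show ?thesis
        unfolding L' R using True a sx sy cc d by (simp add: a_def[symmetric] a_comm)
    next
      case False
      then have "A $$ (k, m) = \<zero>" using A k kn by (simp add: U_lower)
      moreover have "?s k x \<oplus> A $$ (k, i) \<otimes> d = ?s k y" using eq[of k] False k by simp
      ultimately show ?thesis unfolding L' R using a sx sy cc d x'y' by simp
    qed
  qed
  moreover have "a \<otimes> d \<noteq> \<zero>" "a \<otimes> d \<in> carrier S" using a d mult_nonzero by auto
  ultimately show ?case using x'y' by blast
qed

text \<open>Let \<open>p\<close> be the least index with a zero on the diagonal, so that
  \<open>back_substitution\<close> applies to the rows above it. Its two vectors, placed in column
  \<open>p\<close> with diagonal entries \<open>d\<close> and zero, give distinct matrices. Their
  images under \<open>A\<close> agree in the rows above \<open>p\<close> by construction and vanish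
  in the others, where \<open>A\<close> is zero up to column \<open>p\<close>.\<close>

lemma not_cancellable_if_diag_zero:
  assumes A: "A \<in> carrier U" and "i < n" "A $$ (i, i) = \<zero>"
  shows "\<exists>X\<in>carrier U. \<exists>Y\<in>carrier U. A \<otimes>\<^bsub>U\<^esub> X = A \<otimes>\<^bsub>U\<^esub> Y \<and> X \<noteq> Y"
proof -
  have "\<exists>i. i < n \<and> A $$ (i, i) = \<zero>" using assms by blast
  then obtain p where p: "p < n" "A $$ (p, p) = \<zero>" "\<And>k. k < p \<Longrightarrow> A $$ (k, k) \<noteq> \<zero>"
    unfolding exists_least_iff[of "\<lambda>i. i < n \<and> A $$ (i, i) = \<zero>"] by (metis order_less_trans)
  have "\<exists>x y d. (\<forall>k. x k \<in> carrier S \<and> y k \<in> carrier S) \<and> d \<in> carrier S \<and> d \<noteq> \<zero> \<and>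
    (\<forall>k. 0 \<le> k \<and> k < p \<longrightarrow>
      (\<Oplus>l\<in>{0..<p}. A $$ (k, l) \<otimes> x l) \<oplus> A $$ (k, p) \<otimes> d = (\<Oplus>l\<in>{0..<p}. A $$ (k, l) \<otimes> y l))"
    by (rule back_substitution) (use A p in simp_all)
  then obtain x y d where B: "(\<forall>k. x k \<in> carrier S \<and> y k \<in> carrier S) \<and> d \<in> carrier S \<and> d \<noteq> \<zero> \<and>
    (\<forall>k. 0 \<le> k \<and> k < p \<longrightarrow>
      (\<Oplus>l\<in>{0..<p}. A $$ (k, l) \<otimes> x l) \<oplus> A $$ (k, p) \<otimes> d = (\<Oplus>l\<in>{0..<p}. A $$ (k, l) \<otimes> y l))"
    by (elim exE) (erule that)
  then have xy: "\<And>k. x k \<in> carrier S" "\<And>k. y k \<in> carrier S" and d: "d \<in> carrier S" "d \<noteq> \<zero>"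
    by simp_all
  have eq: "(\<Oplus>l\<in>{0..<p}. A $$ (k, l) \<otimes> x l) \<oplus> A $$ (k, p) \<otimes> d = (\<Oplus>l\<in>{0..<p}. A $$ (k, l) \<otimes> y l)"
    if "k < p" for k
    using B that by simp
  \<comment> \<open>All columns but \<open>p\<close> are zero; column \<open>p\<close> carries
    \<open>z\<close> above the diagonal and \<open>e\<close> on it, which keeps the matrix upper
    triangular.\<close>
  define M where "M = (\<lambda>z e. mat n n (\<lambda>(k, l). if l = p then (if k < p then z k else if k = p then e else \<zero>) else \<zero>))"
  have M: "M z e \<in> carrier U" if "\<And>k. z k \<in> carrier S" "e \<in> carrier S" for z e
    using that by (auto simp: M_def U_mat_iff)
  have ent: "(A \<otimes>\<^bsub>U\<^esub> M z e) $$ (k, p) =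
      (if k < p then (\<Oplus>l\<in>{0..<p}. A $$ (k, l) \<otimes> z l) \<oplus> A $$ (k, p) \<otimes> e else \<zero>)"
    if z: "\<And>k. z k \<in> carrier S" "e \<in> carrier S" and k: "k < n" for z e k
  proof -
    have "(A \<otimes>\<^bsub>U\<^esub> M z e) $$ (k, p) = (\<Oplus>l\<in>{..<n}. A $$ (k, l) \<otimes> M z e $$ (l, p))"
      using k p by (simp add: mult_entry)
    also have "\<dots> = (\<Oplus>l\<in>insert p {0..<p}. A $$ (k, l) \<otimes> M z e $$ (l, p))"
      using A k p(1) z by (intro finsum_restrict) (auto simp: M_def)
    also have "\<dots> = A $$ (k, p) \<otimes> e \<oplus> (\<Oplus>l\<in>{0..<p}. A $$ (k, l) \<otimes> M z e $$ (l, p))"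
      using A k p(1) z by (subst finsum_insert) (auto simp: M_def)
    also have "(\<Oplus>l\<in>{0..<p}. A $$ (k, l) \<otimes> M z e $$ (l, p)) = (\<Oplus>l\<in>{0..<p}. A $$ (k, l) \<otimes> z l)"
      using A k p(1) z by (intro finsum_cong') (auto simp: M_def)
    finally have *: "(A \<otimes>\<^bsub>U\<^esub> M z e) $$ (k, p) = A $$ (k, p) \<otimes> e \<oplus> (\<Oplus>l\<in>{0..<p}. A $$ (k, l) \<otimes> z l)" .
    have c: "(\<Oplus>l\<in>{0..<p}. A $$ (k, l) \<otimes> z l) \<in> carrier S"
      using A k p(1) z by (auto intro!: finsum_closed)
    show ?thesis
    proof (cases "k < p")
      case True
      then show ?thesis unfolding * using c A k p(1) z by (simp add: a_comm)
    next
      case False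
      then have "A $$ (k, l) = \<zero>" if "l \<le> p" for l
        using A k p that by (cases "k = l") (auto simp: U_lower)
      then have "A $$ (k, p) = \<zero>" "(\<Oplus>l\<in>{0..<p}. A $$ (k, l) \<otimes> z l) = (\<Oplus>l\<in>{0..<p}. \<zero>)"
        using z by (simp, intro finsum_cong') auto
      then show ?thesis unfolding * using False z by (simp add: finsum_zero)
    qed
  qed
  have "A \<otimes>\<^bsub>U\<^esub> M x d = A \<otimes>\<^bsub>U\<^esub> M y \<zero>"
  proof (rule U_eqI)
    fix k j assume kj: "k \<le> j" "j < n"
    then have k: "k < n" by simp
    show "(A \<otimes>\<^bsub>U\<^esub> M x d) $$ (k, j) = (A \<otimes>\<^bsub>U\<^esub> M y \<zero>) $$ (k, j)"
    proof (cases "j = p")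
      case True
      have "(\<Oplus>l\<in>{0..<p}. A $$ (k, l) \<otimes> y l) \<in> carrier S"
        using A k p(1) xy by (auto intro!: finsum_closed)
      then show ?thesis
        unfolding True using ent[OF xy(1) d(1) k] ent[OF xy(2) zero_closed k] eq[of k] A k p(1) by simp
    next
      case False
      have "(A \<otimes>\<^bsub>U\<^esub> M z e) $$ (k, j) = \<zero>" for z e
      proof -
        have "(A \<otimes>\<^bsub>U\<^esub> M z e) $$ (k, j) = (\<Oplus>l\<in>{..<n}. \<zero>)"
          unfolding mult_entry[OF k kj(2)] using False A k kj by (intro finsum_cong') (auto simp: M_def)
        then show ?thesis by (simp add: finsum_zero)
      qed
      then show ?thesis by simp
    qed
  qed (use A M xy d in auto)
  moreover have "M x d $$ (p, p) \<noteq> M y \<zero> $$ (p, p)"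
    using p(1) d by (simp add: M_def)
  ultimately show ?thesis using M xy d by (intro bexI[of _ "M x d"] bexI[of _ "M y \<zero>"]) auto
qed

lemma T_carrier_iff: "A \<in> carrier T \<longleftrightarrow> A \<in> carrier U \<and> (\<forall>i<n. A $$ (i, i) \<noteq> \<zero>)"
proof
  assume "A \<in> carrier T"
  then have "A \<in> carrier U \<and> (\<forall>X\<in>carrier U. \<forall>Y\<in>carrier U. A \<otimes>\<^bsub>U\<^esub> X = A \<otimes>\<^bsub>U\<^esub> Y \<longrightarrow> X = Y)"
    unfolding upper_triangular_monoid_def cancellable_part_def partial_object.simps by blast
  then show "A \<in> carrier U \<and> (\<forall>i<n. A $$ (i, i) \<noteq> \<zero>)"
    using not_cancellable_if_diag_zero by blast
next
  assume "A \<in> carrier U \<and> (\<forall>i<n. A $$ (i, i) \<noteq> \<zero>)"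
  then show "A \<in> carrier T"
    unfolding upper_triangular_monoid_def cancellable_part_def partial_object.simps
    using cancellable_if_diag_nonzero[of A] by blast
qed

lemma T_mult [simp]: "mult T = mult U" and T_one [simp]: "one T = one U"
  by (simp_all add: upper_triangular_monoid_def cancellable_part_def)

lemma T_in_U: "A \<in> carrier T \<Longrightarrow> A \<in> carrier U"
  by (simp add: T_carrier_iff)

lemma T_diag: "\<lbrakk>A \<in> carrier T; i < n\<rbrakk> \<Longrightarrow> A $$ (i, i) \<in> carrier S - {\<zero>}"
  by (simp add: T_carrier_iff)

lemma factor_diag_one:
  assumes A: "A \<in> carrier T" and B: "B \<in> carrier T" and i: "i < n" "(A \<otimes>\<^bsub>U\<^esub> B) $$ (i, i) = \<one>"
  shows "A $$ (i, i) = \<one>" "B $$ (i, i) = \<one>"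
  using mul.mult_eq_one[of "A $$ (i, i)" "B $$ (i, i)"] diag_mult[of A B i] assms T_diag T_in_U by metis+

text \<open>Zero is the only additively invertible element, so both summands kept in
  \<open>offdiag_mult\<close> vanish; their diagonal factors are nonzero. This gives both the
  triviality of the units and the divisor-closedness of the embedded submonoids.\<close>

lemma factor_offdiag_zero:
  assumes A: "A \<in> carrier T" and B: "B \<in> carrier T" and ij: "i < j" "j < n" "(A \<otimes>\<^bsub>U\<^esub> B) $$ (i, j) = \<zero>"
  shows "A $$ (i, j) = \<zero>" "B $$ (i, j) = \<zero>"
proof -
  have c: "A $$ (i, i) \<in> carrier S - {\<zero>}" "B $$ (j, j) \<in> carrier S - {\<zero>}"
    "A $$ (i, j) \<in> carrier S" "B $$ (i, j) \<in> carrier S"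
    using A B ij T_diag T_in_U by auto
  obtain r where r: "r \<in> carrier S"
    "\<zero> = (A $$ (i, i) \<otimes> B $$ (i, j) \<oplus> A $$ (i, j) \<otimes> B $$ (j, j)) \<oplus> r"
    using offdiag_mult[OF T_in_U[OF A] T_in_U[OF B] ij(1,2)] ij(3) by auto
  then have "A $$ (i, i) \<otimes> B $$ (i, j) \<oplus> A $$ (i, j) \<otimes> B $$ (j, j) = \<zero>"
    using c add.mult_eq_one(1)[of _ r] by (metis DiffD1 a_closed m_closed)
  then have "A $$ (i, i) \<otimes> B $$ (i, j) = \<zero>" "A $$ (i, j) \<otimes> B $$ (j, j) = \<zero>"
    using c add.mult_eq_one by (metis DiffD1 m_closed)+
  then show "A $$ (i, j) = \<zero>" "B $$ (i, j) = \<zero>"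
    using c mult_eq_zero_iff by auto
qed

sublocale T: reduced_monoid T
  rewrites "mult T = mult U" and "one T = one U"
proof -
  interpret U: monoid U by (rule monoid_U)
  have cl: "A \<otimes>\<^bsub>U\<^esub> B \<in> carrier T" if "A \<in> carrier T" "B \<in> carrier T" for A B
    using that diag_mult mult_nonzero by (auto simp: T_carrier_iff)
  have one: "\<one>\<^bsub>U\<^esub> \<in> carrier T"
    by (simp add: T_carrier_iff, simp add: U_one)
  have canc: "\<lbrakk>C \<otimes>\<^bsub>U\<^esub> A = C \<otimes>\<^bsub>U\<^esub> B \<or> A \<otimes>\<^bsub>U\<^esub> C = B \<otimes>\<^bsub>U\<^esub> C; A \<in> carrier T; B \<in> carrier T; C \<in> carrier T\<rbrakk> \<Longrightarrow> A = B" for A B C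
    using cancellable_if_diag_nonzero[of C A B] by (auto simp: T_carrier_iff)
  have "monoid_cancel T"
    by unfold_locales (auto simp: cl one T_in_U U.m_assoc intro: canc)
  \<comment> \<open>A factor of the identity matrix inherits ones on the diagonal and zeros above
    it.\<close>
  moreover have "Units T \<subseteq> {\<one>\<^bsub>U\<^esub>}"
  proof
    fix A assume "A \<in> Units T"
    then obtain B where AB: "A \<in> carrier T" "B \<in> carrier T" "A \<otimes>\<^bsub>U\<^esub> B = \<one>\<^bsub>U\<^esub>"
      unfolding Units_def by auto
    have "A = \<one>\<^bsub>U\<^esub>"
    proof (rule U_eqI)
      fix i j assume ij: "i \<le> j" "j < n"
      show "A $$ (i, j) = \<one>\<^bsub>U\<^esub> $$ (i, j)"
      proof (cases "i = j")
        case True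
        then show ?thesis using factor_diag_one(1)[OF AB(1,2), of i] ij unfolding AB(3) by (simp add: U_one)
      next
        case False
        then show ?thesis using factor_offdiag_zero(1)[OF AB(1,2), of i j] ij unfolding AB(3) by (simp add: U_one)
      qed
    qed (use AB T_in_U in auto)
    then show "A \<in> {\<one>\<^bsub>U\<^esub>}" by simp
  qed
  ultimately show "reduced_monoid T"
    using monoid.Units_one_closed[of T] one
    by (intro reduced_monoid.intro reduced_monoid_axioms.intro) (auto simp: monoid_cancel_def)
qed simp_all

end

section \<open>Transvections and diagonal matrices as embedded submonoids\<close>

context reduced_semialgebra_matrices
begin

definition elem :: "nat \<Rightarrow> nat \<Rightarrow> 'a \<Rightarrow> 'a mat" where
  "elem i j x = mat n n (\<lambda>(k, l). if k = l then \<one> else if k = i \<and> l = j then x else \<zero>)"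

definition diag_elem :: "nat \<Rightarrow> 'a \<Rightarrow> 'a mat" where
  "diag_elem i s = mat n n (\<lambda>(k, l). if k = l then (if k = i then s else \<one>) else \<zero>)"

lemma elem_entry:
  "\<lbrakk>k < n; l < n\<rbrakk> \<Longrightarrow> elem i j x $$ (k, l) = (if k = l then \<one> else if k = i \<and> l = j then x else \<zero>)"
  by (simp add: elem_def)

lemma diag_elem_entry:
  "\<lbrakk>k < n; l < n\<rbrakk> \<Longrightarrow> diag_elem i s $$ (k, l) = (if k = l then (if k = i then s else \<one>) else \<zero>)"
  by (simp add: diag_elem_def)

lemma elem_closed: "\<lbrakk>i < j; x \<in> carrier S\<rbrakk> \<Longrightarrow> elem i j x \<in> carrier T"
  by (auto simp: T_carrier_iff elem_def U_mat_iff)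

lemma diag_elem_closed: "s \<in> carrier S - {\<zero>} \<Longrightarrow> diag_elem i s \<in> carrier T"
  by (auto simp: T_carrier_iff diag_elem_def U_mat_iff)

lemma T_eqI:
  assumes "A \<in> carrier T" "B \<in> carrier T"
    "\<And>i. i < n \<Longrightarrow> A $$ (i, i) = B $$ (i, i)"
    "\<And>i j. \<lbrakk>i < j; j < n\<rbrakk> \<Longrightarrow> A $$ (i, j) = B $$ (i, j)"
  shows "A = B"
  using assms T_in_U by (intro U_eqI) (auto simp: le_less)

lemma elem_mult_entry:
  assumes "i < j" "j < n" "x \<in> carrier S" "B \<in> carrier U" "k < n" "l < n"
  shows "(elem i j x \<otimes>\<^bsub>U\<^esub> B) $$ (k, l) =
    (if k = i then B $$ (i, l) \<oplus> x \<otimes> B $$ (j, l) else B $$ (k, l))"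
proof (cases "k = i")
  case True
  have "(elem i j x \<otimes>\<^bsub>U\<^esub> B) $$ (i, l) =
      elem i j x $$ (i, i) \<otimes> B $$ (i, l) \<oplus> elem i j x $$ (i, j) \<otimes> B $$ (j, l)"
    using assms elem_closed T_in_U by (intro mult_entry_row_doubleton) (auto simp: elem_entry)
  then show ?thesis using assms True by (simp add: elem_entry)
next
  case False
  have "(elem i j x \<otimes>\<^bsub>U\<^esub> B) $$ (k, l) = elem i j x $$ (k, k) \<otimes> B $$ (k, l)"
    using assms False elem_closed T_in_U by (intro mult_entry_row_singleton) (auto simp: elem_entry)
  then show ?thesis using assms False by (simp add: elem_entry)
qed

lemma diag_elem_mult_entry:
  assumes "s \<in> carrier S - {\<zero>}" "B \<in> carrier U" "k < n" "l < n"
  shows "(diag_elem i s \<otimes>\<^bsub>U\<^esub> B) $$ (k, l) = (if k = i then s \<otimes> B $$ (i, l) else B $$ (k, l))"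
proof -
  have "(diag_elem i s \<otimes>\<^bsub>U\<^esub> B) $$ (k, l) = diag_elem i s $$ (k, k) \<otimes> B $$ (k, l)"
    using assms diag_elem_closed[OF assms(1)] T_in_U by (intro mult_entry_row_singleton) (auto simp: diag_elem_entry)
  then show ?thesis using assms by (auto simp: diag_elem_entry)
qed

lemma one_entry: "\<lbrakk>k < n; l < n\<rbrakk> \<Longrightarrow> \<one>\<^bsub>U\<^esub> $$ (k, l) = (if k = l then \<one> else \<zero>)"
  by (simp add: U_one)

text \<open>Transvections at a fixed position multiply by adding their entries. Factors of a
  transvection have ones on the diagonal and zeros at every other position above it, so they are
  transvections at the same position.\<close>

lemma elem_embedding:
  assumes ij: "i < j" "j < n"
  shows "divisor_closed_embedding (add_monoid S) T (elem i j)"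
proof -
  have img: "A \<in> elem i j ` carrier S"
    if A: "A \<in> carrier T" and unip: "\<And>k. k < n \<Longrightarrow> A $$ (k, k) = \<one>"
      and off: "\<And>k l. \<lbrakk>k < l; l < n; (k, l) \<noteq> (i, j)\<rbrakk> \<Longrightarrow> A $$ (k, l) = \<zero>" for A
  proof -
    have c: "A $$ (i, j) \<in> carrier S" using A ij T_in_U by auto
    have "A = elem i j (A $$ (i, j))"
      using A elem_closed[OF ij(1) c] unip off ij by (intro T_eqI) (auto simp: elem_entry)
    then show ?thesis using c by blast
  qed
  have "divisor_closed_embedding_axioms (add_monoid S) T (elem i j)"
  proof (unfold_locales, goal_cases)
    case (1 x)
    then show ?case using elem_closed ij by simp
  next
    case 2
    show ?case
      using elem_closed[of i j \<zero>] ij by (intro T_eqI) (auto simp: elem_entry one_entry)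
  next
    case (3 x y)
    then have xy: "x \<in> carrier S" "y \<in> carrier S" by simp_all
    note cl = elem_closed[OF ij(1) xy(1)] elem_closed[OF ij(1) xy(2)]
    have "elem i j (x \<oplus> y) = elem i j x \<otimes>\<^bsub>U\<^esub> elem i j y"
    proof (rule T_eqI)
      show "elem i j (x \<oplus> y) \<in> carrier T" "elem i j x \<otimes>\<^bsub>U\<^esub> elem i j y \<in> carrier T"
        using cl xy ij elem_closed T.m_closed by auto
    qed (use xy ij cl T_in_U in \<open>auto simp: elem_mult_entry elem_entry a_comm\<close>)
    then show ?case by simp
  next
    case 4
    show ?case
    proof (rule inj_onI)
      fix x y assume "elem i j x = elem i j y"
      then have "elem i j x $$ (i, j) = elem i j y $$ (i, j)" by simp
      then show "x = y" using ij by (simp add: elem_entry)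
    qed
  next
    case (5 A B x)
    then have AB: "A \<in> carrier T" "B \<in> carrier T" "A \<otimes>\<^bsub>U\<^esub> B = elem i j x" by simp_all
    have d: "A $$ (k, k) = \<one>" "B $$ (k, k) = \<one>" if "k < n" for k
      using factor_diag_one[OF AB(1,2) that] that unfolding AB(3) by (auto simp: elem_entry)
    have o: "A $$ (k, l) = \<zero>" "B $$ (k, l) = \<zero>" if "k < l" "l < n" "(k, l) \<noteq> (i, j)" for k l
      using factor_offdiag_zero[OF AB(1,2) that(1,2)] that unfolding AB(3) by (auto simp: elem_entry)
    show ?case using img[OF AB(1)] img[OF AB(2)] d o by simp
  qed
  then show ?thesis
    using reduced_monoid_add T.reduced_monoid_axioms by (intro divisor_closed_embedding.intro)
qed

lemma diag_elem_embedding: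
  assumes i: "i < n"
  shows "divisor_closed_embedding (mult_of S) T (diag_elem i)"
proof -
  have img: "A \<in> diag_elem i ` (carrier S - {\<zero>})"
    if A: "A \<in> carrier T" and unip: "\<And>k. \<lbrakk>k < n; k \<noteq> i\<rbrakk> \<Longrightarrow> A $$ (k, k) = \<one>"
      and off: "\<And>k l. \<lbrakk>k < l; l < n\<rbrakk> \<Longrightarrow> A $$ (k, l) = \<zero>" for A
  proof -
    have c: "A $$ (i, i) \<in> carrier S - {\<zero>}" using A i T_diag by auto
    have "A = diag_elem i (A $$ (i, i))"
      using A diag_elem_closed[OF c] unip off i by (intro T_eqI) (auto simp: diag_elem_entry)
    then show ?thesis using c by blast
  qed
  have "divisor_closed_embedding_axioms (mult_of S) T (diag_elem i)"
  proof (unfold_locales, goal_cases)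
    case (1 x)
    then show ?case using diag_elem_closed by simp
  next
    case 2
    show ?case
      using diag_elem_closed[of \<one> i] by (intro T_eqI) (auto simp: diag_elem_entry one_entry)
  next
    case (3 x y)
    then have xy: "x \<in> carrier S - {\<zero>}" "y \<in> carrier S - {\<zero>}" by simp_all
    note cl = diag_elem_closed[OF xy(1), of i] diag_elem_closed[OF xy(2), of i]
    have "diag_elem i (x \<otimes> y) = diag_elem i x \<otimes>\<^bsub>U\<^esub> diag_elem i y"
    proof (rule T_eqI)
      show "diag_elem i (x \<otimes> y) \<in> carrier T" "diag_elem i x \<otimes>\<^bsub>U\<^esub> diag_elem i y \<in> carrier T"
        using cl diag_elem_closed[of "x \<otimes> y"] mul.m_closed[OF xy] T.m_closed by auto
    qed (use xy i cl T_in_U in \<open>auto simp: diag_elem_mult_entry diag_elem_entry\<close>)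
    then show ?case by simp
  next
    case 4
    show ?case
    proof (rule inj_onI)
      fix x y assume "diag_elem i x = diag_elem i y"
      then have "diag_elem i x $$ (i, i) = diag_elem i y $$ (i, i)" by simp
      then show "x = y" using i by (simp add: diag_elem_entry)
    qed
  next
    case (5 A B x)
    then have AB: "A \<in> carrier T" "B \<in> carrier T" "A \<otimes>\<^bsub>U\<^esub> B = diag_elem i x" by simp_all
    have d: "A $$ (k, k) = \<one>" "B $$ (k, k) = \<one>" if "k < n" "k \<noteq> i" for k
      using factor_diag_one[OF AB(1,2) that(1)] that unfolding AB(3) by (auto simp: diag_elem_entry)
    have o: "A $$ (k, l) = \<zero>" "B $$ (k, l) = \<zero>" if "k < l" "l < n" for k l
      using factor_offdiag_zero[OF AB(1,2) that] that unfolding AB(3) by (auto simp: diag_elem_entry)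
    show ?case using img[OF AB(1)] img[OF AB(2)] d o by simp
  qed
  then show ?thesis
    using reduced_monoid_mult T.reduced_monoid_axioms by (intro divisor_closed_embedding.intro)
qed

section \<open>Ascent of the factorization properties to the matrix monoid\<close>

text \<open>
  Peeling off the last nontrivial column: left multiplication by a diagonal matrix supplies its
  diagonal entry, left multiplications by transvections its remaining entries.
\<close>

lemma T_atomic:
  assumes bi: "bi_atomic S"
  shows "atomic_monoid T"
proof -
  \<comment> \<open>Factorizability is closed under products, and it holds for both kinds of
    generators because the embeddings send atoms to atoms. It remains to write every matrix as a
    product of generators.\<close>
  define P where "P = {A \<in> carrier T. rigid_factorizations T A \<noteq> {}}"
  have P_mult: "A \<otimes>\<^bsub>U\<^esub> B \<in> P" if "A \<in> P" "B \<in> P" for A B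
    using that T.append_in_rigid_factorizations T.m_closed unfolding P_def by blast
  have P_elem: "elem i j x \<in> P" if ij: "i < j" "j < n" "x \<in> carrier S" for i j x
  proof -
    interpret e: divisor_closed_embedding "add_monoid S" T "elem i j" using ij by (intro elem_embedding)
    obtain as where "as \<in> rigid_factorizations (add_monoid S) x"
      using bi ij(3) unfolding bi_atomic_def add.atomic_iff by blast
    then show ?thesis
      using e.rigid_factorizations_map elem_closed[OF ij(1,3)] unfolding P_def by blast
  qed
  have P_diag: "diag_elem i s \<in> P" if si: "i < n" "s \<in> carrier S - {\<zero>}" for i s
  proof -
    interpret e: divisor_closed_embedding "mult_of S" T "diag_elem i" using si by (intro diag_elem_embedding)
    obtain as where "as \<in> rigid_factorizations (mult_of S) s"
      using bi si(2) unfolding bi_atomic_def mul.atomic_iff by blast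
    then show ?thesis
      using e.rigid_factorizations_map diag_elem_closed[OF si(2)] unfolding P_def by blast
  qed
  \<comment> \<open>Outer induction: the columns from \<open>m\<close> on are already those of the
    identity matrix.\<close>
  have "A \<in> P" if "A \<in> carrier T" "m \<le> n"
    "\<And>k l. \<lbrakk>k \<le> l; m \<le> l; l < n\<rbrakk> \<Longrightarrow> A $$ (k, l) = (if k = l then \<one> else \<zero>)" for A m
    using that
  proof (induction m arbitrary: A)
    case 0
    have "A = \<one>\<^bsub>U\<^esub>"
      using 0 by (intro T_eqI) (auto simp: one_entry)
    then show ?case
      using T.one_closed T.Nil_in_rigid_factorizations_one unfolding P_def by blast
  next
    case (Suc m)
    then have m: "m < n" by simp
    \<comment> \<open>Inner induction: column \<open>m\<close> has diagonal entry one and may be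
      nonzero above the diagonal only in the rows before \<open>r\<close>.\<close>
    have inner: "B \<in> P" if "r \<le> m" "B \<in> carrier T" "B $$ (m, m) = \<one>"
      "\<And>k l. \<lbrakk>k \<le> l; Suc m \<le> l; l < n\<rbrakk> \<Longrightarrow> B $$ (k, l) = (if k = l then \<one> else \<zero>)"
      "\<And>k. \<lbrakk>r \<le> k; k < m\<rbrakk> \<Longrightarrow> B $$ (k, m) = \<zero>" for B r
      using that
    proof (induction r arbitrary: B)
      case 0
      have "B $$ (k, l) = (if k = l then \<one> else \<zero>)" if "k \<le> l" "m \<le> l" "l < n" for k l
        using 0 that by (cases "l = m") auto
      then show ?case using Suc.IH[of B] 0 m by simp
    next
      case (Suc r)
      define B' where "B' = mat n n (\<lambda>(k, l). if k = r \<and> l = m then \<zero> else B $$ (k, l))"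
      have r: "r < m" "r < n" using Suc.prems m by auto
      have BU: "B \<in> carrier U" using Suc.prems T_in_U by blast
      have B': "B' \<in> carrier T"
        using Suc.prems(2) BU r m by (auto simp: T_carrier_iff B'_def U_mat_iff U_lower)
      have a: "B $$ (r, m) \<in> carrier S" using BU r m by auto
      \<comment> \<open>Row \<open>m\<close> is a unit row, so adding a multiple of it to row
        \<open>r\<close> changes the entry \<open>(r, m)\<close> and nothing else. This is why the
        diagonal entry of column \<open>m\<close> is split off before the entries above it.\<close>
      have rowm: "B $$ (m, l) = (if l = m then \<one> else \<zero>)" if "l < n" for l
        using Suc.prems(3) Suc.prems(4)[of m l] BU m that by (cases l m rule: linorder_cases) (auto simp: U_lower)
      have "B' \<in> P"
      proof (rule Suc.IH)
        show "\<And>k l. \<lbrakk>k \<le> l; Suc m \<le> l; l < n\<rbrakk> \<Longrightarrow> B' $$ (k, l) = (if k = l then \<one> else \<zero>)"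
          using Suc.prems(4) by (auto simp: B'_def)
        show "\<And>k. \<lbrakk>r \<le> k; k < m\<rbrakk> \<Longrightarrow> B' $$ (k, m) = \<zero>"
          using Suc.prems(5) m by (auto simp: B'_def)
      qed (use B' r Suc.prems m in \<open>auto simp: B'_def\<close>)
      moreover have "B = elem r m (B $$ (r, m)) \<otimes>\<^bsub>U\<^esub> B'"
      proof (rule U_eqI)
        fix k l assume kl: "k \<le> l" "l < n"
        have c: "B $$ (k, l) \<in> carrier S" using BU kl by simp
        show "B $$ (k, l) = (elem r m (B $$ (r, m)) \<otimes>\<^bsub>U\<^esub> B') $$ (k, l)"
          using r a B' T_in_U kl m rowm[of l] c
          by (subst elem_mult_entry) (auto simp: B'_def)
      qed (use BU B' elem_closed[OF r(1) a] T_in_U in auto)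
      ultimately show ?case
        using P_mult[OF P_elem[OF r(1) m a]] by metis
    qed
    define B where "B = mat n n (\<lambda>(k, l). if k = m \<and> l = m then \<one> else A $$ (k, l))"
    have AU: "A \<in> carrier U" using Suc.prems T_in_U by blast
    have B: "B \<in> carrier T"
      using Suc.prems(1) AU m by (auto simp: T_carrier_iff B_def U_mat_iff U_lower)
    have a: "A $$ (m, m) \<in> carrier S - {\<zero>}" using T_diag[OF Suc.prems(1) m] .
    have "B \<in> P"
      by (rule inner[of m]) (use B m Suc.prems(3) in \<open>auto simp: B_def\<close>)
    moreover have "A = diag_elem m (A $$ (m, m)) \<otimes>\<^bsub>U\<^esub> B"
    proof (rule U_eqI)
      fix k l assume kl: "k \<le> l" "l < n"
      have c: "A $$ (k, l) \<in> carrier S" using AU kl by simp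
      \<comment> \<open>Right of the diagonal, row \<open>m\<close> lies in columns that are already
        trivial; scaling that row therefore affects just its diagonal entry.\<close>
      have "A $$ (m, l) = \<zero>" if "l \<noteq> m" "k = m"
        using Suc.prems(3)[of m l] kl that by auto
      then show "A $$ (k, l) = (diag_elem m (A $$ (m, m)) \<otimes>\<^bsub>U\<^esub> B) $$ (k, l)"
        using a B T_in_U kl m c by (subst diag_elem_mult_entry) (auto simp: B_def)
    qed (use AU B diag_elem_closed[OF a] T_in_U in auto)
    ultimately show ?case
      using P_mult[OF P_diag[OF m a]] by metis
  qed
  from this[of _ n] have "carrier T \<subseteq> P" by auto
  then show ?thesis unfolding T.atomic_iff P_def by blast
qed

text \<open>Multiplicative lengths of the diagonal entries plus additive lengths of the entries
  above the diagonal form a length function on the matrices. Superadditivity in position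
  \<open>(i, j)\<close> comes from \<open>offdiag_mult\<close>, provided that scaling by a nonzero
  element does not lower the additive length.\<close>

lemma T_bfm:
  assumes bi: "bi_bfm S"
  shows "bf_monoid T"
proof -
  define la where "la = (\<lambda>x. Max (lengths (add_monoid S) x))"
  obtain lm where lm: "mul.length_function lm"
    using bi mul.bf_iff_length_function unfolding bi_bfm_def by blast
  have bfa: "bf_monoid (add_monoid S)" using bi by (simp add: bi_bfm_def)
  have la: "add.length_function la"
    unfolding la_def using add.length_function_Max_lengths[OF bfa] .
  have la_add: "la x + la y \<le> la (x \<oplus> y)" if "x \<in> carrier S" "y \<in> carrier S" for x y
    using la that by (simp add: add.length_function_def)
  have lm_mult: "lm x + lm y \<le> lm (x \<otimes> y)" if "x \<in> carrier S - {\<zero>}" "y \<in> carrier S - {\<zero>}" for x y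
    using lm that by (simp add: mul.length_function_def)
  have sum_map: "foldr (\<oplus>) (map (\<lambda>a. a \<otimes> y) as) \<zero> = foldr (\<oplus>) as \<zero> \<otimes> y \<and>
      foldr (\<oplus>) (map (\<lambda>a. y \<otimes> a) as) \<zero> = y \<otimes> foldr (\<oplus>) as \<zero>"
    if "set as \<subseteq> carrier S" "y \<in> carrier S" for as y
    using that by (induction as) (auto simp: l_distr r_distr)
  \<comment> \<open>Scaling a longest additive factorization of \<open>x\<close> writes the multiple
    of \<open>x\<close> as a sum of equally many nonzero terms. This is why \<open>la\<close> is the
    maximal length instead of some given length function.\<close>
  have la_mono: "la x \<le> la (x \<otimes> y)" "la x \<le> la (y \<otimes> x)"
    if x: "x \<in> carrier S" and y: "y \<in> carrier S - {\<zero>}" for x y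
  proof -
    obtain as where as: "as \<in> rigid_factorizations (add_monoid S) x" "length as = la x"
      using add.Max_lengths_attained[OF bfa x] unfolding la_def by blast
    then have s: "set as \<subseteq> carrier S - {\<zero>}" "foldr (\<oplus>) as \<zero> = x"
      by (auto simp: rigid_factorizations_def add.atoms_iff)
    then have s': "set as \<subseteq> carrier S" by blast
    have "length (map (\<lambda>a. a \<otimes> y) as) \<le> la (foldr (\<oplus>) (map (\<lambda>a. a \<otimes> y) as) \<zero>)"
      using s(1) y mult_nonzero by (intro add.length_le_length_function[OF la]) auto
    then show "la x \<le> la (x \<otimes> y)" using sum_map[OF s', of y] s(2) y as(2) by simp
    have "length (map (\<lambda>a. y \<otimes> a) as) \<le> la (foldr (\<oplus>) (map (\<lambda>a. y \<otimes> a) as) \<zero>)"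
      using s(1) y mult_nonzero by (intro add.length_le_length_function[OF la]) auto
    then show "la x \<le> la (y \<otimes> x)" using sum_map[OF s', of y] s(2) y as(2) by simp
  qed
  define l where "l = (\<lambda>A. (\<Sum>i<n. lm (A $$ (i, i))) + (\<Sum>i<n. \<Sum>j\<in>{i<..<n}. la (A $$ (i, j))))"
  have "T.length_function l"
    unfolding T.length_function_def
  proof (intro conjI ballI impI)
    fix A B assume AB: "A \<in> carrier T" "B \<in> carrier T"
    then have U: "A \<in> carrier U" "B \<in> carrier U" using T_in_U by auto
    have d: "lm (A $$ (i, i)) + lm (B $$ (i, i)) \<le> lm ((A \<otimes>\<^bsub>U\<^esub> B) $$ (i, i))" if "i < n" for i
      using lm_mult[OF T_diag[OF AB(1) that] T_diag[OF AB(2) that]] U that by (simp add: diag_mult)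
    have o: "la (A $$ (i, j)) + la (B $$ (i, j)) \<le> la ((A \<otimes>\<^bsub>U\<^esub> B) $$ (i, j))" if ij: "i < j" "j < n" for i j
    proof -
      have c: "A $$ (i, i) \<in> carrier S - {\<zero>}" "B $$ (j, j) \<in> carrier S - {\<zero>}"
        "A $$ (i, j) \<in> carrier S" "B $$ (i, j) \<in> carrier S"
        using AB U ij T_diag by auto
      let ?b = "A $$ (i, i) \<otimes> B $$ (i, j)" and ?a = "A $$ (i, j) \<otimes> B $$ (j, j)"
      obtain r where r: "r \<in> carrier S" "(A \<otimes>\<^bsub>U\<^esub> B) $$ (i, j) = (?b \<oplus> ?a) \<oplus> r"
        using offdiag_mult[OF U ij] by blast
      have "la ?b + la ?a \<le> la (?b \<oplus> ?a)" "la (?b \<oplus> ?a) + la r \<le> la ((?b \<oplus> ?a) \<oplus> r)"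
        using la_add c r(1) by auto
      moreover have "la (B $$ (i, j)) \<le> la ?b" "la (A $$ (i, j)) \<le> la ?a"
        using la_mono c by auto
      ultimately show ?thesis unfolding r(2) by linarith
    qed
    have "(\<Sum>i<n. lm (A $$ (i, i))) + (\<Sum>i<n. lm (B $$ (i, i))) \<le> (\<Sum>i<n. lm ((A \<otimes>\<^bsub>U\<^esub> B) $$ (i, i)))"
      unfolding sum.distrib[symmetric] using d by (intro sum_mono) auto
    moreover have "(\<Sum>i<n. \<Sum>j\<in>{i<..<n}. la (A $$ (i, j))) + (\<Sum>i<n. \<Sum>j\<in>{i<..<n}. la (B $$ (i, j)))
        \<le> (\<Sum>i<n. \<Sum>j\<in>{i<..<n}. la ((A \<otimes>\<^bsub>U\<^esub> B) $$ (i, j)))"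
      unfolding sum.distrib[symmetric] using o by (intro sum_mono) auto
    ultimately show "l A + l B \<le> l (A \<otimes>\<^bsub>U\<^esub> B)" unfolding l_def by linarith
  next
    fix A assume A: "A \<in> carrier T" "A \<noteq> \<one>\<^bsub>U\<^esub>"
    show "0 < l A"
    proof (rule ccontr)
      assume "\<not> 0 < l A"
      then have z: "\<And>i. i < n \<Longrightarrow> lm (A $$ (i, i)) = 0" "\<And>i j. \<lbrakk>i < j; j < n\<rbrakk> \<Longrightarrow> la (A $$ (i, j)) = 0"
        by (auto simp: l_def)
      have "A $$ (i, i) = \<one>" if "i < n" for i
        using z(1)[OF that] lm T_diag[OF A(1) that] unfolding mul.length_function_def by force
      moreover have "A $$ (i, j) = \<zero>" if "i < j" "j < n" for i j
        using z(2)[OF that] la T_in_U[OF A(1)] that unfolding add.length_function_def by force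
      ultimately have "A = \<one>\<^bsub>U\<^esub>"
        using A(1) by (intro T_eqI) (auto simp: one_entry)
      then show False using A(2) by simp
    qed
  qed
  then show ?thesis using T.bf_iff_length_function by blast
qed

text \<open>Let \<open>A = B C\<close>. The diagonal entries of \<open>B\<close> and
  \<open>C\<close> divide those of \<open>A\<close>, so there are finitely many candidates. For
  \<open>i < j\<close> the product of \<open>B $$ (i, j)\<close> and \<open>C $$ (j, j)\<close> is
  an additive divisor of \<open>A $$ (i, j)\<close>, and cancelling the diagonal entry leaves
  finitely many values for \<open>B $$ (i, j)\<close>.\<close>

lemma T_ffm:
  assumes bi: "bi_ffm S"
  shows "ff_monoid T"
  unfolding T.ff_iff_finite_left_divisors
proof (intro conjI ballI)
  have ffa: "ff_monoid (add_monoid S)" and ffm: "ff_monoid (mult_of S)"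
    using bi by (simp_all add: bi_ffm_def)
  then show "bf_monoid T"
    by (intro T_bfm) (simp add: bi_bfm_def add.ff_imp_bf mul.ff_imp_bf)
  fix A assume A: "A \<in> carrier T"
  define D where "D = (\<lambda>j. mul.left_divisors (A $$ (j, j)))"
  \<comment> \<open>Candidates for the entries of a left divisor. The union runs over all possible
    diagonal entries \<open>c\<close> of the unknown cofactor; below the diagonal the only candidate
    is zero.\<close>
  define F where "F = (\<lambda>(i, j). if i = j then D i else if i < j then
    \<Union>c\<in>D j. {b \<in> carrier S. b \<otimes> c \<in> add.left_divisors (A $$ (i, j))} else {\<zero>})"
  have D: "finite (D j)" "D j \<subseteq> carrier S - {\<zero>}" if "j < n" for j
    using ffm T_diag[OF A that] unfolding D_def mul.ff_iff_finite_left_divisors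
    by (auto simp: mul.left_divisors_def)
  have "finite (F (i, j))" if ij: "i < n" "j < n" for i j
  proof -
    have "finite {b \<in> carrier S. b \<otimes> c \<in> add.left_divisors (A $$ (i, j))}" if c: "c \<in> D j" for c
    proof (rule finite_imageD)
      have "finite (add.left_divisors (A $$ (i, j)))"
        using ffa T_in_U[OF A] ij unfolding add.ff_iff_finite_left_divisors by auto
      then show "finite ((\<lambda>b. b \<otimes> c) ` {b \<in> carrier S. b \<otimes> c \<in> add.left_divisors (A $$ (i, j))})"
        by (rule finite_subset[rotated]) auto
      show "inj_on (\<lambda>b. b \<otimes> c) {b \<in> carrier S. b \<otimes> c \<in> add.left_divisors (A $$ (i, j))}"
        using D(2)[OF ij(2)] c by (intro inj_onI) (auto dest: mult_right_cancel[rotated 4])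
    qed
    then show ?thesis using D ij by (simp add: F_def)
  qed
  then have "finite ((\<lambda>f. mat n n f) ` PiE ({..<n} \<times> {..<n}) F)"
    by (intro finite_imageI finite_PiE) auto
  moreover have "T.left_divisors A \<subseteq> (\<lambda>f. mat n n f) ` PiE ({..<n} \<times> {..<n}) F"
  proof
    fix B assume "B \<in> T.left_divisors A"
    then obtain C where BC: "B \<in> carrier T" "C \<in> carrier T" "A = B \<otimes>\<^bsub>U\<^esub> C"
      unfolding T.left_divisors_def by blast
    then have U: "B \<in> carrier U" "C \<in> carrier U" using T_in_U by auto
    have Bd: "B $$ (i, i) \<in> D i" if "i < n" for i
      using T_diag[OF BC(1) that] T_diag[OF BC(2) that] diag_mult[OF U that]
      unfolding D_def mul.left_divisors_def BC(3) by blast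
    have Cd: "C $$ (i, i) \<in> D i" if "i < n" for i
      using T_diag[OF BC(1) that] T_diag[OF BC(2) that] diag_mult[OF U that] mult_comm
      unfolding D_def mul.left_divisors_def BC(3) by fastforce
    have off: "B $$ (i, j) \<otimes> C $$ (j, j) \<in> add.left_divisors (A $$ (i, j))" if ij: "i < j" "j < n" for i j
    proof -
      have c: "B $$ (i, i) \<in> carrier S" "C $$ (j, j) \<in> carrier S"
        "B $$ (i, j) \<in> carrier S" "C $$ (i, j) \<in> carrier S"
        using U ij by auto
      obtain r where r: "r \<in> carrier S"
        "A $$ (i, j) = (B $$ (i, i) \<otimes> C $$ (i, j) \<oplus> B $$ (i, j) \<otimes> C $$ (j, j)) \<oplus> r"
        using offdiag_mult[OF U ij] BC(3) by blast
      then have "A $$ (i, j) = B $$ (i, j) \<otimes> C $$ (j, j) \<oplus> (B $$ (i, i) \<otimes> C $$ (i, j) \<oplus> r)"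
        using c by (simp add: a_ac)
      then show ?thesis
        using c r(1) unfolding add.left_divisors_def by blast
    qed
    have "B $$ (i, j) \<in> F (i, j)" if "i < n" "j < n" for i j
      using Bd Cd off[of i j] U that by (cases i j rule: linorder_cases) (auto simp: F_def U_lower)
    then have "restrict (\<lambda>(i, j). B $$ (i, j)) ({..<n} \<times> {..<n}) \<in> PiE ({..<n} \<times> {..<n}) F"
      by auto
    moreover have "B = mat n n (restrict (\<lambda>(i, j). B $$ (i, j)) ({..<n} \<times> {..<n}))"
      using U_dim[OF U(1)] by (intro eq_matI) auto
    ultimately show "B \<in> (\<lambda>f. mat n n f) ` PiE ({..<n} \<times> {..<n}) F" by blast
  qed
  ultimately show "finite (T.left_divisors A)" by (rule finite_subset[rotated])
qed

lemma eventually_constI: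
  fixes X :: "nat \<Rightarrow> 'a mat"
  assumes "\<And>i j. \<lbrakk>i \<le> j; j < n\<rbrakk> \<Longrightarrow> \<exists>k. \<forall>m\<ge>k. X m $$ (i, j) = X k $$ (i, j)" "\<And>m. X m \<in> carrier U"
  shows "\<exists>k. \<forall>m\<ge>k. X m = X k"
proof -
  have "\<exists>K. \<forall>i j. i \<le> j \<longrightarrow> j < n \<longrightarrow> (\<forall>m\<ge>K i j. X m $$ (i, j) = X (K i j) $$ (i, j))"
    using assms(1) by metis
  then obtain K where K: "\<And>i j m. \<lbrakk>i \<le> j; j < n; K i j \<le> m\<rbrakk> \<Longrightarrow> X m $$ (i, j) = X (K i j) $$ (i, j)"
    by blast
  \<comment> \<open>The sum serves as a common upper bound of the finitely many thresholds.\<close>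
  define k where "k = (\<Sum>i<n. \<Sum>j<n. K i j)"
  have "K i j \<le> k" if "i < n" "j < n" for i j
  proof -
    have "K i j \<le> (\<Sum>j<n. K i j)" using that by (intro member_le_sum) auto
    also have "\<dots> \<le> k" unfolding k_def using that by (intro member_le_sum[of i _ "\<lambda>i. \<Sum>j<n. K i j"]) auto
    finally show ?thesis .
  qed
  then have "X m = X k" if "m \<ge> k" for m
    using that assms(2) K by (intro U_eqI) (metis order_trans le_less_trans)+
  then show ?thesis by blast
qed

text \<open>The entries above the diagonal need not form a divisor chain while the diagonals still
  change. Once these are constant, cancellation gives the cofactors diagonal one, and from there on
  each entry above the diagonal runs through an additive divisor chain.\<close>

lemma T_accp:
  assumes bi: "bi_accp S"
  shows "accp T"
proof -
  have la: "left_accp (add_monoid S)" "left_accp (mult_of S)"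
    using bi by (simp_all add: bi_accp_def accp_def)
  have chain_add: "\<exists>k. \<forall>i\<ge>k. x i = x k" if "\<And>i. x i \<in> carrier S" "\<And>i. \<exists>r\<in>carrier S. x i = r \<oplus> x (Suc i)" for x
    using la(1) that unfolding add.left_accp_iff_chains by blast
  have chain_mult: "\<exists>k. \<forall>i\<ge>k. x i = x k"
    if "\<And>i. x i \<in> carrier S - {\<zero>}" "\<And>i. \<exists>r\<in>carrier S - {\<zero>}. x i = r \<otimes> x (Suc i)" for x
    using la(2) that unfolding mul.left_accp_iff_chains by blast
  have shift: "\<exists>k. \<forall>m\<ge>k. f m = f k" if ex: "\<exists>k. \<forall>m\<ge>k. f (m + d) = f (k + d)" for f :: "nat \<Rightarrow> 'a" and d
  proof -
    obtain k where k: "\<And>m. m \<ge> k \<Longrightarrow> f (m + d) = f (k + d)" using ex by blast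
    have "f m = f (k + d)" if "m \<ge> k + d" for m using k[of "m - d"] that by simp
    then show ?thesis by blast
  qed
  \<comment> \<open>Common core of the left and right case, which differ only in the side of the
    cofactor \<open>M m\<close>. The diagonal condition looks the same for both since multiplication
    in \<open>S\<close> is commutative.\<close>
  have main: "\<exists>k. \<forall>m\<ge>k. X m = X k"
    if X: "\<And>m. X m \<in> carrier T"
      and M: "\<And>m. M m \<in> carrier T"
      and diag: "\<And>m i. i < n \<Longrightarrow> X m $$ (i, i) = M m $$ (i, i) \<otimes> X (Suc m) $$ (i, i)"
      and off: "\<And>m i j. \<lbrakk>i < j; j < n; M m $$ (i, i) = \<one>; M m $$ (j, j) = \<one>\<rbrakk>
        \<Longrightarrow> \<exists>r\<in>carrier S. X m $$ (i, j) = r \<oplus> X (Suc m) $$ (i, j)" for X M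
  proof (rule eventually_constI)
    have "\<exists>k. \<forall>m\<ge>k. X m $$ (i, i) = X k $$ (i, i)" if "i < n" for i
      using T_diag[OF X that] T_diag[OF M that] diag[OF that] by (intro chain_mult) blast+
    then have "\<exists>K. \<forall>i<n. \<forall>m\<ge>K i. X m $$ (i, i) = X (K i) $$ (i, i)" by metis
    then obtain K where K: "\<And>i m. \<lbrakk>i < n; K i \<le> m\<rbrakk> \<Longrightarrow> X m $$ (i, i) = X (K i) $$ (i, i)" by blast
    have M1: "M m $$ (i, i) = \<one>" if "i < n" "K i \<le> m" for m i
    proof (rule mult_right_cancel)
      show "M m $$ (i, i) \<otimes> X m $$ (i, i) = \<one> \<otimes> X m $$ (i, i)"
        using diag[OF that(1), of m] K[OF that] K[of i "Suc m"] that T_diag[OF X that(1), of m] by simp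
    qed (use T_diag[OF X that(1), of m] T_diag[OF M that(1), of m] in auto)
    fix i j assume ij: "i \<le> j" "j < n"
    show "\<exists>k. \<forall>m\<ge>k. X m $$ (i, j) = X k $$ (i, j)"
    proof (cases "i = j")
      case True
      then show ?thesis using K ij by blast
    next
      case False
      show ?thesis
      \<comment> \<open>From this index on, the cofactors have a one in both diagonal positions
        \<open>i\<close> and \<open>j\<close>.\<close>
      proof (rule shift[of _ "K i + K j"], rule chain_add)
        fix m
        show "X (m + (K i + K j)) $$ (i, j) \<in> carrier S"
          using X T_in_U ij by auto
        show "\<exists>r\<in>carrier S. X (m + (K i + K j)) $$ (i, j) = r \<oplus> X (Suc m + (K i + K j)) $$ (i, j)"
          using off[of i j "m + (K i + K j)"] M1 ij False by simp
      qed
    qed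
  qed (use X T_in_U in blast)
  have "left_accp T"
    unfolding T.left_accp_iff_chains
  proof (intro allI impI)
    fix X assume *: "\<forall>i. X i \<in> carrier T \<and> (\<exists>m\<in>carrier T. X i = m \<otimes>\<^bsub>U\<^esub> X (Suc i))"
    then obtain M where X: "\<And>m. X m \<in> carrier T" and M: "\<And>m. M m \<in> carrier T" "\<And>m. X m = M m \<otimes>\<^bsub>U\<^esub> X (Suc m)"
      by metis
    show "\<exists>k. \<forall>i\<ge>k. X i = X k"
    proof (rule main)
      fix m i assume i: "i < n"
      show "X m $$ (i, i) = M m $$ (i, i) \<otimes> X (Suc m) $$ (i, i)"
        using diag_mult[OF T_in_U[OF M(1)] T_in_U[OF X] i] M(2) by metis
    next
      fix m i j assume ij: "i < j" "j < n" "M m $$ (i, i) = \<one>" "M m $$ (j, j) = \<one>"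
      have c: "M m $$ (i, j) \<in> carrier S" "X (Suc m) $$ (i, j) \<in> carrier S" "X (Suc m) $$ (j, j) \<in> carrier S"
        using T_in_U[OF M(1)] T_in_U[OF X] ij by auto
      obtain r where r: "r \<in> carrier S"
        "X m $$ (i, j) = (\<one> \<otimes> X (Suc m) $$ (i, j) \<oplus> M m $$ (i, j) \<otimes> X (Suc m) $$ (j, j)) \<oplus> r"
        using offdiag_mult[OF T_in_U[OF M(1)] T_in_U[OF X] ij(1,2), of m "Suc m"] M(2)[of m] ij by auto
      then have "X m $$ (i, j) = (M m $$ (i, j) \<otimes> X (Suc m) $$ (j, j) \<oplus> r) \<oplus> X (Suc m) $$ (i, j)"
        using c by (simp add: a_ac)
      then show "\<exists>r\<in>carrier S. X m $$ (i, j) = r \<oplus> X (Suc m) $$ (i, j)"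
        using c r(1) by blast
    qed (use X M(1) in auto)
  qed
  moreover have "right_accp T"
    unfolding T.right_accp_iff_chains
  proof (intro allI impI)
    fix X assume *: "\<forall>i. X i \<in> carrier T \<and> (\<exists>m\<in>carrier T. X i = X (Suc i) \<otimes>\<^bsub>U\<^esub> m)"
    then obtain M where X: "\<And>m. X m \<in> carrier T" and M: "\<And>m. M m \<in> carrier T" "\<And>m. X m = X (Suc m) \<otimes>\<^bsub>U\<^esub> M m"
      by metis
    show "\<exists>k. \<forall>i\<ge>k. X i = X k"
    proof (rule main)
      fix m i assume i: "i < n"
      show "X m $$ (i, i) = M m $$ (i, i) \<otimes> X (Suc m) $$ (i, i)"
        using diag_mult[OF T_in_U[OF X] T_in_U[OF M(1)] i] M(2) mult_comm T_diag[OF X i] T_diag[OF M(1) i]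
        by (metis DiffD1)
    next
      fix m i j assume ij: "i < j" "j < n" "M m $$ (i, i) = \<one>" "M m $$ (j, j) = \<one>"
      have c: "M m $$ (i, j) \<in> carrier S" "X (Suc m) $$ (i, j) \<in> carrier S" "X (Suc m) $$ (i, i) \<in> carrier S"
        using T_in_U[OF M(1)] T_in_U[OF X] ij by auto
      obtain r where r: "r \<in> carrier S"
        "X m $$ (i, j) = (X (Suc m) $$ (i, i) \<otimes> M m $$ (i, j) \<oplus> X (Suc m) $$ (i, j) \<otimes> \<one>) \<oplus> r"
        using offdiag_mult[OF T_in_U[OF X] T_in_U[OF M(1)] ij(1,2), of "Suc m" m] M(2)[of m] ij by auto
      then have "X m $$ (i, j) = (X (Suc m) $$ (i, i) \<otimes> M m $$ (i, j) \<oplus> r) \<oplus> X (Suc m) $$ (i, j)"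
        using c by (simp add: a_ac)
      then show "\<exists>r\<in>carrier S. X m $$ (i, j) = r \<oplus> X (Suc m) $$ (i, j)"
        using c r(1) by blast
    qed (use X M(1) in auto)
  qed
  ultimately show ?thesis by (simp add: accp_def)
qed

section \<open>Failure of half-factoriality and the vertical equivalences\<close>

text \<open>
  Write \<open>2 = \<one> \<oplus> \<one>\<close>.  An additive atom \<open>a\<close> gives the two expressions
  \<open>elem 0 1 a \<otimes> diag_elem 1 2 = diag_elem 1 2 \<otimes> elem 0 1 a \<otimes> elem 0 1 a\<close> of the same matrix.
\<close>

lemma T_not_half_factorial:
  assumes n: "n \<ge> 2"
  shows "\<not> half_factorial T"
proof
  assume hf: "half_factorial T"
  interpret e: divisor_closed_embedding "add_monoid S" T "elem 0 1"
    using n by (intro elem_embedding) auto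
  have at: "atomic_monoid T" using hf by (simp add: half_factorial_def)
  \<comment> \<open>Half-factoriality includes atomicity, which descends to the additive monoid;
    there the nonzero element \<open>\<one>\<close> has a nonempty factorization, whose head is the
    required atom.\<close>
  then have "rigid_factorizations (add_monoid S) \<one> \<noteq> {}"
    using e.atomic_pullback by (simp add: add.atomic_iff)
  then obtain as where as: "set as \<subseteq> atoms (add_monoid S)" "foldr (\<oplus>) as \<zero> = \<one>"
    unfolding rigid_factorizations_def by auto
  then obtain a where a: "a \<in> atoms (add_monoid S)" by (cases as) auto
  then have ac: "a \<in> carrier S" "a \<noteq> \<zero>" by (auto simp: add.atoms_iff)
  define t where "t = \<one> \<oplus> \<one>"
  have t: "t \<in> carrier S - {\<zero>}" unfolding t_def using add.mult_eq_one[of \<one> \<one>] by auto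
  let ?E = "elem 0 1 a" and ?D = "diag_elem 1 t"
  have E: "?E \<in> carrier T" and D: "?D \<in> carrier T" using elem_closed ac diag_elem_closed t by auto
  have eq: "?E \<otimes>\<^bsub>U\<^esub> ?D = ?D \<otimes>\<^bsub>U\<^esub> (?E \<otimes>\<^bsub>U\<^esub> ?E)"
  proof (rule U_eqI)
    fix i j assume "i \<le> j" "j < n"
    then show "(?E \<otimes>\<^bsub>U\<^esub> ?D) $$ (i, j) = (?D \<otimes>\<^bsub>U\<^esub> (?E \<otimes>\<^bsub>U\<^esub> ?E)) $$ (i, j)"
      using ac t E D T_in_U n
      by (auto simp: elem_mult_entry diag_elem_mult_entry elem_entry diag_elem_entry) (simp add: t_def r_distr)
  qed (use E D T_in_U in auto)
  have Ea: "[?E] \<in> rigid_factorizations T ?E"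
    using e.f_atoms_iff a ac by (intro T.singleton_in_rigid_factorizations) simp
  \<comment> \<open>Any factorization of the diagonal matrix will do: the two products then have
    lengths \<open>1 + length ds\<close> and \<open>length ds + 2\<close>.\<close>
  obtain ds where ds: "ds \<in> rigid_factorizations T ?D"
    using at D unfolding T.atomic_iff by blast
  have "[?E] @ ds \<in> rigid_factorizations T (?E \<otimes>\<^bsub>U\<^esub> ?D)"
    using T.append_in_rigid_factorizations Ea ds by blast
  moreover have "ds @ [?E] @ [?E] \<in> rigid_factorizations T (?E \<otimes>\<^bsub>U\<^esub> ?D)"
    unfolding eq using T.append_in_rigid_factorizations Ea ds by blast
  moreover have "?E \<otimes>\<^bsub>U\<^esub> ?D \<noteq> \<one>\<^bsub>U\<^esub>"
  proof
    assume "?E \<otimes>\<^bsub>U\<^esub> ?D = \<one>\<^bsub>U\<^esub>"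
    then have "?E = \<one>\<^bsub>U\<^esub>" using T.mult_eq_one(1) E D by blast
    then have "?E $$ (0, 1) = \<one>\<^bsub>U\<^esub> $$ (0, 1)" by simp
    then show False using n ac by (simp add: elem_entry one_entry)
  qed
  ultimately have "length ([?E] @ ds) = length (ds @ [?E] @ [?E])"
    using hf T.m_closed[OF E D] unfolding half_factorial_def T.Units_trivial by blast
  then show False by simp
qed

lemma T_equivalences:
  assumes n: "n \<ge> 2"
  shows "bi_ffm S \<longleftrightarrow> ff_monoid T" "bi_bfm S \<longleftrightarrow> bf_monoid T"
    "bi_accp S \<longleftrightarrow> accp T" "bi_atomic S \<longleftrightarrow> atomic_monoid T"
proof -
  interpret e: divisor_closed_embedding "add_monoid S" T "elem 0 1"
    using n by (intro elem_embedding) auto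
  interpret d: divisor_closed_embedding "mult_of S" T "diag_elem 0"
    using n by (intro diag_elem_embedding) auto
  show "bi_ffm S \<longleftrightarrow> ff_monoid T"
    using T_ffm e.ff_pullback d.ff_pullback unfolding bi_ffm_def by blast
  show "bi_bfm S \<longleftrightarrow> bf_monoid T"
    using T_bfm e.bf_pullback d.bf_pullback unfolding bi_bfm_def by blast
  show "bi_accp S \<longleftrightarrow> accp T"
    using T_accp e.accp_pullback d.accp_pullback unfolding bi_accp_def by blast
  show "bi_atomic S \<longleftrightarrow> atomic_monoid T"
    using T_atomic e.atomic_pullback d.atomic_pullback unfolding bi_atomic_def by blast
qed

end

section \<open>Implications between the properties of \<open>S\<close>\<close>

context reduced_information_semialgebra
begin

lemma bi_ffm_imp_bi_bfm: "bi_ffm S \<Longrightarrow> bi_bfm S"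
  unfolding bi_ffm_def bi_bfm_def using add.ff_imp_bf mul.ff_imp_bf by blast

lemma bi_bfm_imp_bi_accp: "bi_bfm S \<Longrightarrow> bi_accp S"
  unfolding bi_bfm_def bi_accp_def using add.bf_imp_accp mul.bf_imp_accp by blast

lemma bi_accp_imp_bi_atomic: "bi_accp S \<Longrightarrow> bi_atomic S"
  unfolding bi_accp_def bi_atomic_def using add.accp_imp_atomic mul.accp_imp_atomic by blast

end

section \<open>Separating examples\<close>

text \<open>The injection \<open>h\<close> only serves to transport the semialgebra \<open>C\<close> to the type of real numbers.\<close>

locale positive_cone =
  fixes C :: "'b :: comm_ring_1 set" and h :: "'b \<Rightarrow> real"
  assumes inj: "inj_on h C"
    and zero_mem: "0 \<in> C" and one_mem: "1 \<in> C"
    and add_mem: "\<lbrakk>x \<in> C; y \<in> C\<rbrakk> \<Longrightarrow> x + y \<in> C"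
    and mult_mem: "\<lbrakk>x \<in> C; y \<in> C\<rbrakk> \<Longrightarrow> x * y \<in> C"
    and conical: "\<lbrakk>x \<in> C; y \<in> C; x + y = 0\<rbrakk> \<Longrightarrow> x = 0"
    and mult_cancel: "\<lbrakk>x \<in> C; y \<in> C; z \<in> C; x \<noteq> 0; x * y = x * z\<rbrakk> \<Longrightarrow> y = z"
    and mult_conical: "\<lbrakk>x \<in> C; y \<in> C; x * y = 1\<rbrakk> \<Longrightarrow> x = 1"
begin

abbreviation g where "g \<equiv> inv_into C h"

definition R :: "real ring" where
  "R = \<lparr>carrier = h ` C, mult = (\<lambda>a b. h (g a * g b)), one = h 1, zero = h 0,
    add = (\<lambda>a b. h (g a + g b))\<rparr>"

text \<open>\<open>A\<close> and \<open>M\<close> are the two monoids before the transport along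
  \<open>h\<close>. The examples are computed in them, and \<open>bi_R_iff\<close> carries the
  results over to \<open>R\<close>.\<close>

definition A :: "'b monoid" where "A = \<lparr>carrier = C, mult = (+), one = 0\<rparr>"

definition M :: "'b monoid" where "M = \<lparr>carrier = C - {0}, mult = (*), one = 1\<rparr>"

lemma A_simps [simp]: "carrier A = C" "mult A = (+)" "one A = 0"
  by (simp_all add: A_def)

lemma M_simps [simp]: "carrier M = C - {0}" "mult M = (*)" "one M = 1"
  by (simp_all add: M_def)

lemma mult_nonzero: "\<lbrakk>x \<in> C; y \<in> C; x \<noteq> 0; y \<noteq> 0\<rbrakk> \<Longrightarrow> x * y \<noteq> 0"
  using mult_cancel[of x y 0] zero_mem by auto

lemma mult_right_cancel: "\<lbrakk>x \<in> C; y \<in> C; z \<in> C; x \<noteq> 0; y * x = z * x\<rbrakk> \<Longrightarrow> y = z"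
  using mult_cancel[of x y z] by (simp add: mult.commute)

lemma gh [simp]: "x \<in> C \<Longrightarrow> g (h x) = x"
  by (rule inv_into_f_f[OF inj])

lemma h_eq_iff: "\<lbrakk>x \<in> C; y \<in> C\<rbrakk> \<Longrightarrow> h x = h y \<longleftrightarrow> x = y"
  using inj by (auto dest: inj_onD)

sublocale A: reduced_monoid A
proof (intro reduced_monoid.intro reduced_monoid_axioms.intro)
  show "monoid_cancel A"
    by unfold_locales (auto simp: add_mem zero_mem)
  show "Units A = {\<one>\<^bsub>A\<^esub>}"
    unfolding Units_def using conical zero_mem by auto
qed

sublocale M: reduced_monoid M
proof (intro reduced_monoid.intro reduced_monoid_axioms.intro)
  have "monoid M"
    by (rule monoidI) (auto simp: mult_mem mult_nonzero one_mem mult.assoc)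
  then show "monoid_cancel M"
    by (rule monoid.monoid_cancelI) (auto dest: mult_cancel mult_right_cancel)
  show "Units M = {\<one>\<^bsub>M\<^esub>}"
    unfolding Units_def using mult_conical one_mem by auto
qed

sublocale R: reduced_information_semialgebra R
proof -
  have s: "carrier R = h ` C" "mult R = (\<lambda>a b. h (g a * g b))" "one R = h 1" "zero R = h 0"
    "add R = (\<lambda>a b. h (g a + g b))"
    by (simp_all add: R_def)
  have sr: "semiring R"
  proof (intro semiring.intro semiring_axioms.intro abelian_monoidI monoidI)
  qed (auto simp: s add_mem mult_mem zero_mem one_mem algebra_simps)
  have add: "comm_monoid_cancel (add_monoid R)"
  proof (intro comm_monoid_cancelI comm_monoidI)
  qed (auto simp: s add_mem zero_mem algebra_simps h_eq_iff)
  have "comm_monoid (mult_of R)"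
    by (rule comm_monoidI) (auto simp: s mult_mem mult_nonzero one_mem zero_mem h_eq_iff ac_simps)
  then have mult: "comm_monoid_cancel (mult_of R)"
    by (rule comm_monoid_cancelI) (auto simp: s mult_mem zero_mem h_eq_iff dest: mult_right_cancel)
  have "a = h 0" if a: "a \<in> Units (add_monoid R)" for a
  proof -
    obtain x y where "x \<in> C" "y \<in> C" "a = h x" "h (x + y) = h 0"
      using a unfolding Units_def by (auto simp: s)
    then show ?thesis using conical h_eq_iff add_mem zero_mem by metis
  qed
  then have "Units (add_monoid R) \<subseteq> {h 0}" by blast
  moreover have "h 0 \<in> Units (add_monoid R)"
    using monoid.Units_one_closed[of "add_monoid R"] add
    by (simp add: s comm_monoid_cancel_def comm_monoid_def)
  ultimately have Units_add: "Units (add_monoid R) = {\<zero>\<^bsub>R\<^esub>}"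
    by (auto simp: s)
  have "a = h 1" if a: "a \<in> Units (mult_of R)" for a
  proof -
    obtain b where "a \<in> h ` C" "b \<in> h ` C" "h (g a * g b) = h 1"
      using a unfolding Units_def by (auto simp: s)
    then obtain x y where "x \<in> C" "y \<in> C" "a = h x" "h (x * y) = h 1" by auto
    then show ?thesis using mult_conical h_eq_iff mult_mem one_mem by metis
  qed
  then have "Units (mult_of R) \<subseteq> {h 1}" by blast
  moreover have "h 1 \<in> Units (mult_of R)"
    using monoid.Units_one_closed[of "mult_of R"] mult
    by (simp add: s comm_monoid_cancel_def comm_monoid_def)
  ultimately have Units_mult: "Units (mult_of R) = {\<one>\<^bsub>R\<^esub>}"
    by (auto simp: s)
  show "reduced_information_semialgebra R"
    using sr add mult Units_add Units_mult
    by (intro reduced_information_semialgebra.intro information_semialgebra.intro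
        information_semialgebra_axioms.intro reduced_information_semialgebra_axioms.intro)
qed

text \<open>A bijective homomorphism is a divisor-closed embedding in both directions, so the
  pullback lemmas yield invariance under isomorphism.\<close>

lemma embedding_A: "divisor_closed_embedding A (add_monoid R) h" "divisor_closed_embedding (add_monoid R) A g"
  by (intro divisor_closed_embedding.intro A.reduced_monoid_axioms R.reduced_monoid_add
      divisor_closed_embedding_axioms.intro;
      force simp: R_def inj inj_on_def h_eq_iff zero_mem add_mem image_iff)+

lemma embedding_M: "divisor_closed_embedding M (mult_of R) h" "divisor_closed_embedding (mult_of R) M g"
  by (intro divisor_closed_embedding.intro M.reduced_monoid_axioms R.reduced_monoid_mult
      divisor_closed_embedding_axioms.intro;
      force simp: R_def inj inj_on_def h_eq_iff zero_mem one_mem mult_mem image_iff mult_nonzero)+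

lemma bi_R_iff:
  "bi_ffm R \<longleftrightarrow> ff_monoid A \<and> ff_monoid M"
  "bi_bfm R \<longleftrightarrow> bf_monoid A \<and> bf_monoid M"
  "bi_accp R \<longleftrightarrow> accp A \<and> accp M"
  "bi_atomic R \<longleftrightarrow> atomic_monoid A \<and> atomic_monoid M"
  unfolding bi_ffm_def bi_bfm_def bi_accp_def bi_atomic_def
  using embedding_A embedding_M
  by (blast intro: divisor_closed_embedding.ff_pullback divisor_closed_embedding.bf_pullback
      divisor_closed_embedding.accp_pullback divisor_closed_embedding.atomic_pullback)+

end

section \<open>A bi-BFM that is not a bi-FFM\<close>

text \<open>Rounding down \<open>x\<close> and its binary logarithm gives the two length functions.
  The gap between 1 and 2 keeps the logarithmic one positive away from the identity.\<close>

lemma exists_bfm_not_ffm: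
  "\<exists>S :: real ring. reduced_information_semialgebra S \<and> bi_bfm S \<and> \<not> bi_ffm S"
proof -
  define C :: "real set" where "C = {0, 1} \<union> {2..}"
  have C_iff: "x \<in> C \<longleftrightarrow> x = 0 \<or> x = 1 \<or> 2 \<le> x" for x by (auto simp: C_def)
  have C_mult: "x * y \<in> C" "x * y = 1 \<Longrightarrow> x = 1" if xy: "x \<in> C" "y \<in> C" for x y
  proof -
    have "2 \<le> x * y" if "1 \<le> x" "1 \<le> y" "2 \<le> x \<or> 2 \<le> y"
      using that mult_mono[of 1 x 2 y] mult_mono[of 2 x 1 y] by auto
    then show "x * y \<in> C" "x * y = 1 \<Longrightarrow> x = 1"
      using xy by (auto simp: C_iff)
  qed
  interpret positive_cone C "\<lambda>x. x"
  proof
    show "x * y \<in> C" if "x \<in> C" "y \<in> C" for x y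
      using C_mult(1)[OF that] .
    show "x = 1" if "x \<in> C" "y \<in> C" "x * y = 1" for x y
      using C_mult(2)[OF that] .
  qed (auto simp: C_iff)
  have "A.length_function (\<lambda>x. nat \<lfloor>x\<rfloor>)"
    unfolding A.length_function_def
  proof (intro conjI ballI impI)
    fix x y assume "x \<in> carrier A" "y \<in> carrier A"
    then have xy: "x \<ge> 0" "y \<ge> 0" by (auto simp: C_iff)
    then have "nat \<lfloor>x\<rfloor> + nat \<lfloor>y\<rfloor> = nat (\<lfloor>x\<rfloor> + \<lfloor>y\<rfloor>)"
      by (subst nat_add_distrib) auto
    also have "\<dots> \<le> nat \<lfloor>x + y\<rfloor>"
      by (intro nat_mono le_floor_add)
    finally show "nat \<lfloor>x\<rfloor> + nat \<lfloor>y\<rfloor> \<le> nat \<lfloor>x \<otimes>\<^bsub>A\<^esub> y\<rfloor>" by simp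
  qed (auto simp: C_iff)
  moreover have "M.length_function (\<lambda>x. nat \<lfloor>log 2 x\<rfloor>)"
    unfolding M.length_function_def
  proof (intro conjI ballI impI)
    fix x y assume "x \<in> carrier M" "y \<in> carrier M"
    then have xy: "x \<ge> 1" "y \<ge> 1" by (auto simp: C_iff)
    then have "nat \<lfloor>log 2 x\<rfloor> + nat \<lfloor>log 2 y\<rfloor> = nat (\<lfloor>log 2 x\<rfloor> + \<lfloor>log 2 y\<rfloor>)"
      by (subst nat_add_distrib) auto
    also have "\<dots> \<le> nat \<lfloor>log 2 x + log 2 y\<rfloor>"
      by (intro nat_mono le_floor_add)
    also have "log 2 x + log 2 y = log 2 (x * y)"
      using xy by (simp add: log_mult)
    finally show "nat \<lfloor>log 2 x\<rfloor> + nat \<lfloor>log 2 y\<rfloor> \<le> nat \<lfloor>log 2 (x \<otimes>\<^bsub>M\<^esub> y)\<rfloor>" by simp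
  next
    fix x assume "x \<in> carrier M" "x \<noteq> \<one>\<^bsub>M\<^esub>"
    then have "x \<ge> 2" by (auto simp: C_iff)
    then have "log 2 x \<ge> 1" by (simp add: le_log_iff)
    then show "0 < nat \<lfloor>log 2 x\<rfloor>" by simp
  qed
  ultimately have "bi_bfm R"
    unfolding bi_R_iff A.bf_iff_length_function M.bf_iff_length_function by blast
  moreover have "\<not> ff_monoid A"
  proof
    assume "ff_monoid A"
    \<comment> \<open>For every \<open>x\<close> in the interval from 2 to 3 also
      \<open>5 - x\<close> lies there, so 5 has infinitely many additive divisors.\<close>
    then have "finite (A.left_divisors 5)"
      unfolding A.ff_iff_finite_left_divisors by (auto simp: C_iff)
    moreover have "{2..3} \<subseteq> A.left_divisors 5"
    proof
      fix x :: real assume "x \<in> {2..3}"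
      then show "x \<in> A.left_divisors 5"
        unfolding A.left_divisors_def by (auto simp: C_iff intro!: bexI[of _ "5 - x"])
    qed
    ultimately have "finite {2..3::real}" by (rule finite_subset[rotated])
    then show False by (simp add: infinite_Icc)
  qed
  ultimately show ?thesis using R.reduced_information_semialgebra_axioms bi_R_iff by blast
qed

section \<open>A bi-atomic semialgebra without the ACCP\<close>

text \<open>Bernstein polynomials up to constant factors. With \<open>1 - x\<close> in place of
  \<open>2 - 2x\<close> each of them would be the sum of the two obtained by raising
  \<open>i\<close> or \<open>j\<close> by one, and there would be no additive atoms. The factor 2
  breaks this, since modulo 2 only the powers of \<open>x\<close> survive.\<close>

definition bern :: "nat \<Rightarrow> nat \<Rightarrow> int poly" where
  "bern i j = [:0, 1:] ^ i * [:2, -2:] ^ j"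

inductive_set bern_cone :: "int poly set" where
  zero: "0 \<in> bern_cone"
| step: "s \<in> bern_cone \<Longrightarrow> bern i j + s \<in> bern_cone"

lemma bern_mult: "bern i j * bern k l = bern (i + k) (j + l)"
  by (simp add: bern_def power_add)

lemma bern_in_cone: "bern i j \<in> bern_cone"
  using bern_cone.step[OF bern_cone.zero] by simp

lemma bern_Suc: "bern i (Suc j) = [:2, -2:] * bern i j"
  unfolding bern_def power_Suc by (rule mult.left_commute)

lemma bern_zero: "bern i 0 = monom 1 i"
  by (simp add: bern_def monom_altdef)

lemma bern_nonzero: "bern i j \<noteq> 0"
  by (simp add: bern_def)

lemma bern_cone_add: "\<lbrakk>s \<in> bern_cone; t \<in> bern_cone\<rbrakk> \<Longrightarrow> s + t \<in> bern_cone"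
  by (induction rule: bern_cone.induct) (auto simp: add.assoc intro: bern_cone.step)

lemma bern_cone_mult:
  assumes "s \<in> bern_cone" "t \<in> bern_cone"
  shows "s * t \<in> bern_cone"
proof -
  have bern: "bern i j * t \<in> bern_cone" for i j
    using assms(2)
    by (induction rule: bern_cone.induct) (auto simp: distrib_left bern_mult intro: bern_cone.intros)
  show ?thesis
    using assms(1)
    by (induction rule: bern_cone.induct) (auto simp: distrib_right intro: bern bern_cone.zero bern_cone_add)
qed

lemma poly_bern_one: "poly (bern i j) 1 = (if j = 0 then 1 else 0)"
  by (simp add: bern_def)

lemma poly_bern_cone_one: "s \<in> bern_cone \<Longrightarrow> 0 \<le> poly s 1"
  by (induction rule: bern_cone.induct) (auto simp: poly_bern_one)

text \<open>At 1 every generator has the value 0 or 1. A sum vanishing there consists of generators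
  with \<open>j > 0\<close>, from each of which \<open>2 - 2x\<close> can be removed without leaving
  the cone.\<close>

lemma bern_cone_root_one:
  assumes "s \<in> bern_cone" "poly s 1 = 0"
  shows "\<exists>t\<in>bern_cone. s = [:2, -2:] * t"
  using assms
proof (induction rule: bern_cone.induct)
  case zero
  then show ?case using bern_cone.zero by (intro bexI[of _ 0]) auto
next
  case (step s i j)
  then have "j \<noteq> 0" "poly s 1 = 0"
    using poly_bern_cone_one[OF step.hyps] by (auto simp: poly_bern_one split: if_splits)
  then obtain k t where "j = Suc k" "t \<in> bern_cone" "s = [:2, -2:] * t"
    using step.IH by (metis not0_implies_Suc)
  then have "bern i k + t \<in> bern_cone" "bern i j + s = [:2, -2:] * (bern i k + t)"
    by (auto simp only: bern_Suc distrib_left intro: bern_cone.step)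
  then show ?case by blast
qed

text \<open>Both summands are nonnegative at 1, hence vanish there; dividing them by
  \<open>2 - 2x\<close> lowers the degree.\<close>

lemma bern_cone_conical:
  assumes "u \<in> bern_cone" "v \<in> bern_cone" "u + v = 0"
  shows "u = 0"
  using assms
proof (induction "degree u" arbitrary: u v rule: less_induct)
  case less
  have "poly u 1 + poly v 1 = 0" using less.prems(3) by (metis poly_0 poly_add)
  then have "poly u 1 = 0" "poly v 1 = 0"
    using poly_bern_cone_one less.prems(1,2) by (metis add_nonneg_eq_0_iff)+
  then obtain u' v' where u': "u' \<in> bern_cone" "u = [:2, -2:] * u'" and v': "v' \<in> bern_cone" "v = [:2, -2:] * v'"
    using bern_cone_root_one less.prems(1,2) by metis
  have "[:2, -2:] * (u' + v') = 0" using less.prems(3) unfolding u'(2) v'(2) by (simp only: distrib_left)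
  then have sum: "u' + v' = 0" by (simp only: mult_eq_0_iff) simp
  show ?case
  proof (cases "u' = 0")
    case False
    then have "degree u = Suc (degree u')" unfolding u'(2) by (subst degree_mult_eq) auto
    then have "u' = 0" using less.hyps[of u' v'] u'(1) v'(1) sum by simp
    then show ?thesis using u'(2) by simp
  qed (use u' in simp)
qed

text \<open>Generators with \<open>l > 0\<close> have even coefficients only, so an odd coefficient
  of \<open>x^i\<close> must come from a summand \<open>x^i\<close>.\<close>

lemma bern_cone_odd_coeff:
  assumes "s \<in> bern_cone" "odd (coeff s i)"
  shows "\<exists>t\<in>bern_cone. s = bern i 0 + t"
  using assms
proof (induction rule: bern_cone.induct)
  case (step s k l)
  show ?case
  proof (cases "k = i \<and> l = 0")
    case True
    then show ?thesis using step.hyps by blast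
  next
    case False
    have "even (coeff (bern k l) i)"
    proof (cases l)
      case 0
      then show ?thesis using False by (simp add: bern_zero)
    next
      case (Suc m)
      have "[:2, -2 :: int:] = smult 2 [:1, -1:]" by simp
      then have "bern k l = smult 2 ([:1, -1:] * bern k m)"
        unfolding Suc bern_Suc by (simp only: mult_smult_left)
      then show ?thesis by simp
    qed
    then obtain t where t: "t \<in> bern_cone" "s = bern i 0 + t"
      using step.IH step.prems by auto
    then show ?thesis
      using bern_cone.step[OF t(1), of k l] by (intro bexI[of _ "bern k l + t"]) (auto simp: algebra_simps)
  qed
qed simp

text \<open>In \<open>x^i = u + v\<close> one summand has an odd coefficient at \<open>i\<close>, so
  it contains \<open>x^i\<close>, and conicality kills the rest. For larger \<open>j\<close> both
  summands vanish at 1 and \<open>2 - 2x\<close> can be cancelled.\<close>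

lemma bern_indecomposable:
  assumes "u \<in> bern_cone" "v \<in> bern_cone" "bern i j = u + v"
  shows "u = 0 \<or> v = 0"
  using assms
proof (induction j arbitrary: u v)
  case 0
  have zero: "b = 0" if ab: "a \<in> bern_cone" "b \<in> bern_cone" "bern i 0 = a + b" "odd (coeff a i)" for a b
  proof -
    obtain t where "t \<in> bern_cone" "a = bern i 0 + t"
      using bern_cone_odd_coeff ab by blast
    then show ?thesis using ab bern_cone_conical[of b t] by (simp add: add.commute)
  qed
  have "coeff u i + coeff v i = 1" using 0(3) by (metis bern_zero coeff_add coeff_monom)
  then have "odd (coeff u i) \<or> odd (coeff v i)" by presburger
  then show ?case
    using zero[OF 0(1,2,3)] zero[OF 0(2,1)] 0(3) by (metis add.commute)
next
  case (Suc j)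
  have "poly u 1 + poly v 1 = 0" using Suc.prems(3) poly_bern_one[of i "Suc j"] by simp
  then have "poly u 1 = 0" "poly v 1 = 0"
    using poly_bern_cone_one Suc.prems(1,2) by (metis add_nonneg_eq_0_iff)+
  then obtain u' v' where u': "u' \<in> bern_cone" "u = [:2, -2:] * u'" and v': "v' \<in> bern_cone" "v = [:2, -2:] * v'"
    using bern_cone_root_one Suc.prems(1,2) by metis
  have "[:2, -2:] * bern i j = [:2, -2:] * (u' + v')"
    using Suc.prems(3) unfolding u'(2) v'(2) bern_Suc by (simp only: distrib_left)
  then have "bern i j = u' + v'" by (simp only: mult_cancel_left) simp
  then have "u' = 0 \<or> v' = 0" using Suc.IH[OF u'(1) v'(1)] by blast
  then show ?case unfolding u'(2) v'(2) by (metis mult_zero_right)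
qed

lemma bern_cone_mult_conical:
  assumes "u \<in> bern_cone" "v \<in> bern_cone" "u * v = 1"
  shows "u = 1"
proof -
  have "u \<noteq> 0" "v \<noteq> 0" using assms(3) by auto
  then have "degree u + degree v = 0" using assms(3) by (metis degree_1 degree_mult_eq)
  then obtain c where c: "u = [:c:]" by (metis add_is_0 degree_eq_zeroE)
  have "poly u 1 * poly v 1 = 1" using assms(3) by (metis poly_1 poly_mult)
  then have "poly u 1 = 1" using poly_bern_cone_one[OF assms(1)] by (auto simp: zmult_eq_1_iff)
  then show ?thesis using c by (simp add: one_pCons)
qed

lemma exists_atomic_not_accp:
  "\<exists>S :: real ring. reduced_information_semialgebra S \<and> bi_atomic S \<and> \<not> bi_accp S"
proof -
  \<comment> \<open>Coefficient lists of integers show that the cone is countable; an enumeration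
    embeds it into the real numbers.\<close>
  have "inj (coeffs :: int poly \<Rightarrow> int list)"
    by (auto intro: injI simp: coeffs_eq_iff)
  then have "countable bern_cone"
    by (meson countableI' inj_on_subset subset_UNIV)
  then have inj: "inj_on (real \<circ> to_nat_on bern_cone) bern_cone"
    by (intro comp_inj_on) auto
  interpret positive_cone bern_cone "real \<circ> to_nat_on bern_cone"
  proof
    show "1 \<in> bern_cone" using bern_in_cone[of 0 0] by (simp add: bern_def)
    show "x + y \<in> bern_cone" "x * y \<in> bern_cone" if "x \<in> bern_cone" "y \<in> bern_cone" for x y
      using bern_cone_add[OF that] bern_cone_mult[OF that] .
    show "x = 0" if "x \<in> bern_cone" "y \<in> bern_cone" "x + y = 0" for x y
      using bern_cone_conical[OF that] .
    show "x = 1" if "x \<in> bern_cone" "y \<in> bern_cone" "x * y = 1" for x y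
      using bern_cone_mult_conical[OF that] .
  qed (use inj bern_cone.zero in auto)
  have atom: "bern i j \<in> atoms A" for i j
    using bern_in_cone bern_nonzero bern_indecomposable by (auto simp: A.atoms_iff)
  have "rigid_factorizations A s \<noteq> {}" if "s \<in> bern_cone" for s
    using that
  proof (induction rule: bern_cone.induct)
    case zero
    then show ?case using A.Nil_in_rigid_factorizations_one by auto
  next
    case (step s i j)
    then show ?case
      using A.append_in_rigid_factorizations[OF A.singleton_in_rigid_factorizations[OF atom[of i j]]] by auto
  qed
  then have "atomic_monoid A" by (simp add: A.atomic_iff)
  \<comment> \<open>Degree and number of prime factors of the leading coefficient are both additive.
    They vanish together only at the constants 1 and -1, and -1 is excluded by its negative value at
    1.\<close>
  moreover have "M.length_function (\<lambda>p. degree p + size (prime_factorization (nat \<bar>lead_coeff p\<bar>)))"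
    unfolding M.length_function_def
  proof (intro conjI ballI impI)
    fix p q assume "p \<in> carrier M" "q \<in> carrier M"
    then have pq: "p \<noteq> 0" "q \<noteq> 0" by auto
    then have "nat \<bar>lead_coeff (p * q)\<bar> = nat \<bar>lead_coeff p\<bar> * nat \<bar>lead_coeff q\<bar>"
      by (simp add: lead_coeff_mult abs_mult nat_mult_distrib)
    moreover have "nat \<bar>lead_coeff p\<bar> \<noteq> 0" "nat \<bar>lead_coeff q\<bar> \<noteq> 0"
      using pq by auto
    ultimately show "degree p + size (prime_factorization (nat \<bar>lead_coeff p\<bar>)) +
        (degree q + size (prime_factorization (nat \<bar>lead_coeff q\<bar>)))
      \<le> degree (p \<otimes>\<^bsub>M\<^esub> q) + size (prime_factorization (nat \<bar>lead_coeff (p \<otimes>\<^bsub>M\<^esub> q)\<bar>))"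
      using pq by (simp add: prime_factorization_mult degree_mult_eq del: nat_0_iff)
  next
    fix p assume p: "p \<in> carrier M" "p \<noteq> \<one>\<^bsub>M\<^esub>"
    show "0 < degree p + size (prime_factorization (nat \<bar>lead_coeff p\<bar>))"
    proof (rule ccontr)
      assume "\<not> ?thesis"
      then have d: "degree p = 0" and "prime_factorization (nat \<bar>lead_coeff p\<bar>) = {#}" by auto
      moreover have "nat \<bar>lead_coeff p\<bar> \<noteq> 0" using p by auto
      ultimately have "nat \<bar>lead_coeff p\<bar> = 1"
        by (metis prime_factorization_empty_iff nat_dvd_1_iff_1)
      moreover obtain c where "p = [:c:]" using d by (metis degree_eq_zeroE)
      moreover have "0 \<le> poly p 1" using p poly_bern_cone_one by auto
      ultimately show False using p by (auto simp: one_pCons)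
    qed
  qed
  then have "atomic_monoid M" by (rule M.atomic_if_length_function)
  moreover have "\<not> accp A"
  proof
    assume "accp A"
    then have la: "left_accp A" by (simp add: accp_def)
    define x where "x = (\<lambda>k. bern k 0 + bern k 0)"
    have mem: "x k \<in> bern_cone" for k
      unfolding x_def by (intro bern_cone_add bern_in_cone)
    have x_step: "x k = bern k 1 + x (Suc k)" for k
      by (simp add: x_def bern_def algebra_simps) (simp add: numeral_poly)
    have "x k \<in> carrier A \<and> (\<exists>m\<in>carrier A. x k = m \<otimes>\<^bsub>A\<^esub> x (Suc k))" for k
      unfolding A_simps using mem[of k] bern_in_cone[of k 1] x_step[of k] by blast
    then have "\<exists>k. \<forall>i\<ge>k. x i = x k"
      using la unfolding A.left_accp_iff_chains by (elim allE[of _ x]) simp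
    then obtain k where "x (Suc k) = x k" by (metis le_SucI le_refl)
    moreover have "x k = monom 2 k" for k
      by (simp add: x_def bern_zero add_monom)
    ultimately have "degree (monom (2::int) (Suc k)) = degree (monom (2::int) k)" by metis
    then show False by (simp add: degree_monom_eq)
  qed
  ultimately show ?thesis using R.reduced_information_semialgebra_axioms bi_R_iff by blast
qed


section \<open>A bi-ACCP semialgebra that is not a bi-BFM\<close>

text \<open>
  Allowing a value below \<open>c\<close> at fewer than \<open>c\<close> points only is what forces divisor chains to stop,
  although the constant function \<open>3\<close> is divisible by high powers of elements that differ from
  \<open>1\<close> at a single point.
\<close>

definition almost_constant :: "nat \<Rightarrow> (nat \<Rightarrow> real) \<Rightarrow> bool" where
  "almost_constant c f \<longleftrightarrow> 0 < c \<and> f 0 = c \<and>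
     (\<forall>x. f x \<in> \<rat> \<and> (f x = 1 \<or> 1 + 1 / Suc x \<le> f x)) \<and>
     finite {x. f x \<noteq> c} \<and> card {x. f x < c} < c"

definition almost_constant_cone :: "(nat \<Rightarrow> real) set" where
  "almost_constant_cone = insert 0 {f. \<exists>c. almost_constant c f}"

lemma almost_constant_ge_one: "almost_constant c f \<Longrightarrow> 1 \<le> f x"
proof -
  assume "almost_constant c f"
  then have "f x = 1 \<or> 1 + 1 / Suc x \<le> f x" by (simp add: almost_constant_def)
  moreover have "0 \<le> 1 / real (Suc x)" by simp
  ultimately show ?thesis by linarith
qed

lemma almost_constant_finite_less: "almost_constant c f \<Longrightarrow> finite {x. f x < c}"
  unfolding almost_constant_def by (auto elim: rev_finite_subset)

text \<open>A point where the sum is below \<open>c + d\<close> is one where \<open>f\<close> is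
  below \<open>c\<close> or \<open>g\<close> is below \<open>d\<close>, so the bounds on the
  exceptional points add up. The gap above 1 is harmless because every value of the sum is at least
  2.\<close>

lemma almost_constant_add:
  assumes f: "almost_constant c f" and g: "almost_constant d g"
  shows "almost_constant (c + d) (f + g)"
  unfolding almost_constant_def
proof (intro conjI allI)
  show "(f + g) x \<in> \<rat>" for x using f g by (auto simp: almost_constant_def)
  have "2 \<le> f x + g x" "1 / real (Suc x) \<le> 1" for x
    using almost_constant_ge_one[OF f, of x] almost_constant_ge_one[OF g, of x] by auto
  then show "(f + g) x = 1 \<or> 1 + 1 / real (Suc x) \<le> (f + g) x" for x
    by (smt (verit) plus_fun_apply)
  have "finite ({x. f x \<noteq> c} \<union> {x. g x \<noteq> d})" using f g by (simp add: almost_constant_def)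
  then show "finite {x. (f + g) x \<noteq> real (c + d)}" by (rule rev_finite_subset) auto
  have "card {x. (f + g) x < real (c + d)} \<le> card ({x. f x < c} \<union> {x. g x < d})"
    using almost_constant_finite_less[OF f] almost_constant_finite_less[OF g]
    by (intro card_mono) auto
  also have "\<dots> \<le> card {x. f x < c} + card {x. g x < d}" by (rule card_Un_le)
  also have "\<dots> < c + d" using f g by (simp add: almost_constant_def)
  finally show "card {x. (f + g) x < real (c + d)} < c + d" .
qed (use f g in \<open>auto simp: almost_constant_def\<close>)

text \<open>Exceptional points of the product are exceptional for a factor. If a value of the
  product is not 1, one of the two factors already lies beyond the gap, and the other is at least
  1.\<close>

lemma almost_constant_mult:
  assumes f: "almost_constant c f" and g: "almost_constant d g"
  shows "almost_constant (c * d) (f * g)"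
  unfolding almost_constant_def
proof (intro conjI allI)
  show "(f * g) x \<in> \<rat>" for x using f g by (auto simp: almost_constant_def)
  show "(f * g) x = 1 \<or> 1 + 1 / real (Suc x) \<le> (f * g) x" for x
  proof -
    have "f x = 1 \<or> 1 + 1 / Suc x \<le> f x" "g x = 1 \<or> 1 + 1 / Suc x \<le> g x"
      using f g by (auto simp: almost_constant_def)
    moreover have "f x \<le> f x * g x"
      using almost_constant_ge_one[OF f, of x] almost_constant_ge_one[OF g, of x]
      by (simp add: mult_le_cancel_left1)
    ultimately show ?thesis by auto
  qed
  have "finite ({x. f x \<noteq> c} \<union> {x. g x \<noteq> d})" using f g by (simp add: almost_constant_def)
  then show "finite {x. (f * g) x \<noteq> real (c * d)}" by (rule rev_finite_subset) auto
  have "{x. (f * g) x < real (c * d)} \<subseteq> {x. f x < c} \<union> {x. g x < d}"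
  proof
    fix x assume "x \<in> {x. (f * g) x < real (c * d)}"
    then have "\<not> (real c \<le> f x \<and> real d \<le> g x)"
      using mult_mono[of "real c" "f x" "real d" "g x"] almost_constant_ge_one[OF f, of x] by auto
    then show "x \<in> {x. f x < c} \<union> {x. g x < d}" by auto
  qed
  then have "card {x. (f * g) x < real (c * d)} \<le> card ({x. f x < c} \<union> {x. g x < d})"
    using almost_constant_finite_less[OF f] almost_constant_finite_less[OF g]
    by (intro card_mono) auto
  also have "\<dots> \<le> card {x. f x < c} + card {x. g x < d}" by (rule card_Un_le)
  also have "\<dots> < c * d"
  proof -
    \<comment> \<open>There are at most \<open>(c - 1) + (d - 1)\<close> exceptional points, which
      is less than \<open>c d\<close> because \<open>(c - 1) (d - 1)\<close> is nonnegative.\<close>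
    obtain a b where ab: "c = Suc a" "d = Suc b"
      using f g by (metis almost_constant_def gr0_implies_Suc)
    then have "card {x. f x < c} \<le> a" "card {x. g x < d} \<le> b"
      using f g by (auto simp: almost_constant_def)
    moreover have "c * d = a * b + a + b + 1" using ab by simp
    ultimately show ?thesis by linarith
  qed
  finally show "card {x. (f * g) x < real (c * d)} < c * d" .
qed (use f g in \<open>auto simp: almost_constant_def\<close>)

lemma almost_constant_one: "almost_constant 1 1"
  by (simp add: almost_constant_def)

text \<open>Values are rational and eventually equal to \<open>c\<close>, so a finite list of
  rationals together with \<open>c\<close> determines the function.\<close>

lemma countable_almost_constant_cone: "countable almost_constant_cone"
proof -
  define F :: "nat \<times> rat list \<Rightarrow> nat \<Rightarrow> real" where
    "F = (\<lambda>(c, l) x. if x < length l then of_rat (l ! x) else c)"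
  have "f \<in> range F" if f: "almost_constant c f" for c f
  proof -
    have "finite {x. f x \<noteq> c}" using f by (simp add: almost_constant_def)
    then obtain N where N: "\<And>x. f x \<noteq> c \<Longrightarrow> x < N"
      unfolding finite_nat_set_iff_bounded by auto
    have "\<forall>x. \<exists>q. f x = of_rat q" using f by (auto simp: almost_constant_def Rats_def)
    then obtain q where q: "\<And>x. f x = of_rat (q x)" by metis
    have "f = F (c, map q [0..<N])"
      using N q by (auto simp: F_def fun_eq_iff)
    then show ?thesis by blast
  qed
  then have "almost_constant_cone \<subseteq> insert 0 (range F)"
    unfolding almost_constant_cone_def by blast
  then show ?thesis by (rule countable_subset) simp
qed

text \<open>All values decrease along the chain, and so does the constant, which settles at
  \<open>e\<close>. The set of points below \<open>e\<close> can only grow but stays smaller than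
  \<open>e\<close>, so it settles too. From then on nothing moves outside the finite set
  \<open>Z\<close>, and at each point of \<open>Z\<close> the gap above 1 in the values of the
  cofactors allows only finitely many changes.\<close>

lemma almost_constant_chain:
  assumes F: "\<And>i. \<exists>c. almost_constant c (F i)" and m: "\<And>i. \<exists>c. almost_constant c (m i)"
    and step: "\<And>i. F i = m i * F (Suc i)"
  shows "\<exists>k. \<forall>i\<ge>k. F i = F k"
proof -
  obtain c where c: "\<And>i. almost_constant (c i) (F i)" using F by metis
  obtain d where d: "\<And>i. almost_constant (d i) (m i)" using m by metis
  have ge1: "1 \<le> F i x" "1 \<le> m i x" for i x
    using almost_constant_ge_one c d by blast+
  have st: "F i x = m i x * F (Suc i) x" for i x using step[of i] by simp
  have dec: "F (Suc i) x \<le> F i x" for i x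
    unfolding st[of i x] using ge1[of "Suc i" x] ge1(2)[of i x] by (simp add: mult_le_cancel_right1)
  have "c (Suc i) \<le> c i" for i
    using dec[of i 0] c[of i] c[of "Suc i"] by (simp add: almost_constant_def)
  then obtain k0 where k0: "\<And>i. i \<ge> k0 \<Longrightarrow> c i = c k0"
    using decseq_nat_eventually_const[of 0 c] by metis
  define e where "e = c k0"
  define D where "D = (\<lambda>i. {x. F i x < e})"
  have ac: "almost_constant e (F i)" if "i \<ge> k0" for i
    using c[of i] k0[OF that] by (simp add: e_def)
  have finD: "finite (D i)" and cardD: "card (D i) < e" if "i \<ge> k0" for i
    using almost_constant_finite_less[OF ac[OF that]] ac[OF that] by (auto simp: D_def almost_constant_def)
  have D_mono: "D i \<subseteq> D (Suc i)" for i
    using dec[of i] unfolding D_def by (auto intro: le_less_trans)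
  \<comment> \<open>The growing cardinality is turned into a decreasing sequence of natural numbers;
    as it stays below \<open>e\<close>, truncated subtraction loses no information.\<close>
  have "e - card (D (Suc i)) \<le> e - card (D i)" if "i \<ge> k0" for i
    using card_mono[OF finD[of "Suc i"] D_mono] that by simp
  then obtain k1 where k1: "k1 \<ge> k0" "\<And>i. i \<ge> k1 \<Longrightarrow> e - card (D i) = e - card (D k1)"
    using decseq_nat_eventually_const[of k0 "\<lambda>i. e - card (D i)"] by metis
  have D_const: "D i = D k1" if "i \<ge> k1" for i
    using that
  proof (induction rule: dec_induct)
    case (step i)
    have "card (D i) = card (D (Suc i))"
      using k1(2)[of i] k1(2)[of "Suc i"] cardD[of i] cardD[of "Suc i"] k1(1) step.hyps by simp
    then have "D i = D (Suc i)"
      using finD[of "Suc i"] k1(1) step.hyps D_mono by (intro card_subset_eq) auto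
    then show ?case using step.IH by simp
  qed simp
  define Z where "Z = {x. F k1 x \<noteq> e}"
  have "finite Z" using ac[OF k1(1)] by (simp add: almost_constant_def Z_def)
  have F_le: "F i x \<le> F k1 x" if "i \<ge> k1" for i x
    using that by (induction rule: dec_induct) (auto intro: order_trans[OF dec])
  have outside: "F i x = e" if "i \<ge> k1" "x \<notin> Z" for i x
  proof -
    have "F k1 x = e" using that by (simp add: Z_def)
    moreover from this have "x \<notin> D i" using D_const[OF that(1)] by (simp add: D_def)
    ultimately show ?thesis using F_le[OF that(1), of x] by (simp add: D_def)
  qed
  \<comment> \<open>The base is the least value other than 1 that a cofactor can take at
    \<open>x\<close>, so every change at \<open>x\<close> lowers the logarithm by at least one. The
    base tends to 1 as \<open>x\<close> grows, and so there is no bound uniform in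
    \<open>x\<close>.\<close>
  define l where "l = (\<lambda>i x. nat \<lfloor>log (1 + 1 / Suc x) (F i x)\<rfloor>)"
  have l_dec: "l (Suc i) x \<le> l i x" for i x
    unfolding l_def using dec[of i x] ge1(1)[of "Suc i" x]
    by (intro nat_mono floor_mono) simp
  have l_less: "l (Suc i) x < l i x" if "F (Suc i) x \<noteq> F i x" for i x
  proof -
    define q where "q = 1 + 1 / real (Suc x)"
    have q: "1 < q" by (simp add: q_def)
    have "m i x \<noteq> 1" using that st[of i x] by auto
    then have "q \<le> m i x" using d[of i] unfolding almost_constant_def q_def by blast
    then have "1 \<le> log q (m i x)" using q by (simp add: le_log_iff)
    moreover have "log q (F i x) = log q (m i x) + log q (F (Suc i) x)"
      unfolding st[of i x] using ge1(2)[of i x] ge1(1)[of "Suc i" x] by (simp add: log_mult)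
    ultimately have "log q (F (Suc i) x) + 1 \<le> log q (F i x)" by simp
    then have "\<lfloor>log q (F (Suc i) x)\<rfloor> + 1 \<le> \<lfloor>log q (F i x)\<rfloor>" by linarith
    moreover have "0 \<le> \<lfloor>log q (F (Suc i) x)\<rfloor>" using q ge1(1)[of "Suc i" x] by simp
    ultimately show ?thesis unfolding l_def q_def by linarith
  qed
  have "(\<Sum>x\<in>Z. l (Suc i) x) \<le> (\<Sum>x\<in>Z. l i x)" for i
    by (intro sum_mono l_dec)
  then obtain k2 where k2: "k2 \<ge> k1" "\<And>i. i \<ge> k2 \<Longrightarrow> (\<Sum>x\<in>Z. l i x) = (\<Sum>x\<in>Z. l k2 x)"
    using decseq_nat_eventually_const[of k1 "\<lambda>i. \<Sum>x\<in>Z. l i x"] by metis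
  have stat: "F (Suc i) = F i" if i: "i \<ge> k2" for i
  proof
    fix x
    show "F (Suc i) x = F i x"
    proof (cases "x \<in> Z")
      case True
      show ?thesis
      proof (rule ccontr)
        assume "F (Suc i) x \<noteq> F i x"
        then have "(\<Sum>z\<in>Z. l (Suc i) z) < (\<Sum>z\<in>Z. l i z)"
          using True \<open>finite Z\<close> l_dec l_less[of i x] by (intro sum_strict_mono_ex1) blast+
        then show False using k2(2)[of i] k2(2)[of "Suc i"] i by simp
      qed
    next
      case False
      then show ?thesis using outside[of i x] outside[of "Suc i" x] i k2(1) by simp
    qed
  qed
  have "F i = F k2" if "i \<ge> k2" for i
    using that by (induction rule: dec_induct) (auto simp: stat)
  then show ?thesis by blast
qed

lemma exists_accp_not_bfm:
  "\<exists>S :: real ring. reduced_information_semialgebra S \<and> bi_accp S \<and> \<not> bi_bfm S"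
proof -
  let ?C = almost_constant_cone
  have C_cases: "f = 0 \<or> (\<exists>c. almost_constant c f)" if "f \<in> ?C" for f
    using that by (simp add: almost_constant_cone_def)
  have C_I: "almost_constant c f \<Longrightarrow> f \<in> ?C" for c f
    by (auto simp: almost_constant_cone_def)
  have C_0: "f 0 \<ge> 0" "f \<noteq> 0 \<Longrightarrow> f 0 > 0" if "f \<in> ?C" for f
    using C_cases[OF that] by (auto simp: almost_constant_def)
  have C_nat: "\<exists>c. f 0 = real c" if "f \<in> ?C" for f
    using C_cases[OF that] by (auto simp: almost_constant_def intro: exI[of _ 0])
  have C_ge1: "1 \<le> f x" if "f \<in> ?C" "f \<noteq> 0" for f x
    using C_cases[OF that(1)] that(2) almost_constant_ge_one by blast
  have inj: "inj_on (real \<circ> to_nat_on ?C) ?C"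
    using countable_almost_constant_cone by (intro comp_inj_on) auto
  interpret positive_cone ?C "real \<circ> to_nat_on ?C"
  proof
    show "0 \<in> ?C" by (simp add: almost_constant_cone_def)
    show "1 \<in> ?C" using almost_constant_one by (rule C_I)
    show "f + g \<in> ?C" if "f \<in> ?C" "g \<in> ?C" for f g
      using C_cases[OF that(1)] C_cases[OF that(2)] that by (auto intro: C_I[OF almost_constant_add])
    show "f * g \<in> ?C" if "f \<in> ?C" "g \<in> ?C" for f g
      using C_cases[OF that(1)] C_cases[OF that(2)] that by (auto intro: C_I[OF almost_constant_mult])
    show "f = 0" if fg: "f \<in> ?C" "g \<in> ?C" "f + g = 0" for f g
    proof -
      have "f 0 + g 0 = 0" using fg(3) by (metis plus_fun_apply zero_fun_apply)
      then show ?thesis using C_0[OF fg(1)] C_0(1)[OF fg(2)] by auto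
    qed
    show "g = k" if *: "f \<in> ?C" "g \<in> ?C" "k \<in> ?C" "f \<noteq> 0" "f * g = f * k" for f g k
    proof
      fix x
      have "f x * g x = f x * k x" using *(5) by (metis times_fun_apply)
      then show "g x = k x" using C_ge1[OF *(1,4), of x] by simp
    qed
    show "f = 1" if *: "f \<in> ?C" "g \<in> ?C" "f * g = 1" for f g
    proof
      fix x
      have "f \<noteq> 0" "g \<noteq> 0" using *(3) by auto
      then have "1 \<le> f x" "1 \<le> g x" using C_ge1 * by auto
      moreover have "f x * g x = 1" using *(3) by (metis times_fun_apply one_fun_apply)
      ultimately have "f x = 1" using mult_left_mono[of 1 "g x" "f x"] by simp
      then show "f x = 1 x" by simp
    qed
  qed (rule inj)
  have M_I: "almost_constant c f \<Longrightarrow> f \<in> carrier M" for c f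
    using C_I almost_constant_ge_one[of c f 0] by fastforce
  have M_D: "\<exists>c. almost_constant c f" if "f \<in> carrier M" for f
    using that C_cases by auto
  \<comment> \<open>The value at 0 is the natural number \<open>c\<close>; it is additive and
    positive on nonzero functions.\<close>
  have "A.length_function (\<lambda>f. nat \<lfloor>f 0\<rfloor>)"
    unfolding A.length_function_def
  proof (intro conjI ballI impI)
    fix f g assume "f \<in> carrier A" "g \<in> carrier A"
    then obtain c d where "f 0 = real c" "g 0 = real d" using C_nat by (metis A_simps(1))
    then show "nat \<lfloor>f 0\<rfloor> + nat \<lfloor>g 0\<rfloor> \<le> nat \<lfloor>(f \<otimes>\<^bsub>A\<^esub> g) 0\<rfloor>" by simp
  next
    fix f assume "f \<in> carrier A" "f \<noteq> \<one>\<^bsub>A\<^esub>"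
    then have "1 \<le> f 0" using C_ge1 by simp
    then show "0 < nat \<lfloor>f 0\<rfloor>" by simp
  qed
  then have "accp A" using A.bf_iff_length_function A.bf_imp_accp by blast
  moreover have "left_accp M"
    unfolding M.left_accp_iff_chains
  proof (intro allI impI)
    fix x assume "\<forall>i. x i \<in> carrier M \<and> (\<exists>m\<in>carrier M. x i = m \<otimes>\<^bsub>M\<^esub> x (Suc i))"
    then obtain m where "\<And>i. x i \<in> carrier M" "\<And>i. m i \<in> carrier M" "\<And>i. x i = m i * x (Suc i)"
      by (metis M_simps(2))
    then show "\<exists>k. \<forall>i\<ge>k. x i = x k"
      using M_D by (intro almost_constant_chain) blast+
  qed
  moreover have "right_accp M"
    unfolding M.right_accp_iff_chains
  proof (intro allI impI)
    fix x assume "\<forall>i. x i \<in> carrier M \<and> (\<exists>m\<in>carrier M. x i = x (Suc i) \<otimes>\<^bsub>M\<^esub> m)"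
    then obtain m where "\<And>i. x i \<in> carrier M" "\<And>i. m i \<in> carrier M" "\<And>i. x i = m i * x (Suc i)"
      by (metis M_simps(2) mult.commute)
    then show "\<exists>k. \<forall>i\<ge>k. x i = x k"
      using M_D by (intro almost_constant_chain) blast+
  qed
  moreover have "\<not> bf_monoid M"
  proof
    assume "bf_monoid M"
    then obtain l where l: "M.length_function l" using M.bf_iff_length_function by blast
    \<comment> \<open>The successor makes \<open>n\<close> exceed the supposed length of the
      constant 3 and also nonzero, so that changing values at \<open>n\<close> respects the
      prescribed value at 0.\<close>
    define n where "n = Suc (l (\<lambda>_. 3))"
    define q where "q = 1 + 1 / real (Suc n)"
    define y where "y = (\<lambda>x. if x = n then q else 1)"
    \<comment> \<open>For \<open>k \<le> n\<close> this is \<open>y^k\<close> times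
      \<open>w 0\<close>; at \<open>k = n\<close> the dent at the point \<open>n\<close> is filled
      and the constant function 3 results.\<close>
    define w where "w = (\<lambda>k x. if x = n then 3 / q ^ (n - k) else 3)"
    have q: "1 < q" "q \<in> \<rat>" by (auto simp: q_def)
    have "almost_constant 1 y"
    proof -
      have "finite {x. y x \<noteq> 1}" by (rule finite_subset[of _ "{n}"]) (auto simp: y_def)
      moreover have "{x. y x < 1} = {}" using q by (auto simp: y_def)
      ultimately show ?thesis
        using q unfolding almost_constant_def by (auto simp: y_def n_def q_def)
    qed
    then have y: "y \<in> carrier M" by (rule M_I)
    \<comment> \<open>With \<open>N = n + 1\<close> the power of \<open>1 + 1/N\<close> is at most
      \<open>exp 1\<close>, which explains the constant 3. One factor \<open>q\<close> more than the
      \<open>n\<close> divided out is needed so that \<open>w 0 n\<close> is still at least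
      \<open>q\<close>, beyond the gap.\<close>
    have q_pow: "q ^ Suc n \<le> 3"
    proof -
      have "q ^ Suc n \<le> exp (1 / real (Suc n)) ^ Suc n"
        unfolding q_def by (intro power_mono) (auto intro: exp_ge_add_one_self)
      also have "\<dots> = exp (real (Suc n) * (1 / real (Suc n)))" by (rule exp_of_nat_mult[symmetric])
      also have "\<dots> = exp 1" by simp
      also have "\<dots> \<le> 3" by (rule exp_le)
      finally show ?thesis .
    qed
    have "almost_constant 3 (w 0)"
    proof -
      have "finite {x. w 0 x \<noteq> 3}" by (rule finite_subset[of _ "{n}"]) (auto simp: w_def)
      moreover have "card {x. w 0 x < 3} \<le> card {n}" by (rule card_mono) (auto simp: w_def)
      moreover have "w 0 n \<in> \<rat>" using q by (simp add: w_def)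
      moreover have "q \<le> w 0 n" using q_pow q by (simp add: w_def field_simps)
      moreover have "w 0 x = 3" if "x \<noteq> n" for x using that by (simp add: w_def)
      moreover have "1 + 1 / real (Suc x) \<le> 3" for x by (simp add: field_simps)
      ultimately have "w 0 x \<in> \<rat> \<and> (w 0 x = 1 \<or> 1 + 1 / Suc x \<le> w 0 x)" for x
        by (cases "x = n") (auto simp: q_def)
      moreover have "w 0 0 = 3" by (simp add: w_def n_def)
      ultimately show ?thesis
        unfolding almost_constant_def
        using \<open>finite {x. w 0 x \<noteq> 3}\<close> \<open>card {x. w 0 x < 3} \<le> card {n}\<close> by simp
    qed
    then have w0: "w 0 \<in> carrier M" by (rule M_I)
    have w_Suc: "w (Suc k) = y * w k" if "k < n" for k
      using q that by (auto simp: w_def y_def fun_eq_iff Suc_diff_Suc[symmetric] simp del: Suc_diff_Suc)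
    have "w k \<in> carrier M \<and> k \<le> l (w k)" if "k \<le> n" for k
      using that
    proof (induction k)
      case (Suc k)
      then have IH: "w k \<in> carrier M" "k \<le> l (w k)" and w: "w (Suc k) = y \<otimes>\<^bsub>M\<^esub> w k"
        using w_Suc by auto
      have "y \<noteq> 1" using q by (auto simp: y_def fun_eq_iff)
      then have "0 < l y" "l y + l (w k) \<le> l (w (Suc k))"
        using l y IH(1) unfolding w M.length_function_def by auto
      then have "Suc k \<le> l (w (Suc k))" using IH(2) by linarith
      moreover have "w (Suc k) \<in> carrier M" unfolding w using y IH(1) by (rule M.m_closed)
      ultimately show ?case by blast
    qed (use w0 in simp)
    then have "n \<le> l (w n)" by simp
    moreover have "w n = (\<lambda>_. 3)" by (auto simp: w_def)
    ultimately show False by (simp add: n_def)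
  qed
  ultimately show ?thesis
    using R.reduced_information_semialgebra_axioms bi_R_iff by (auto simp: accp_def)
qed

theorem mainTheorem1:
  fixes n :: nat
  assumes "n \<ge> 2"
  shows
    "(\<forall>S :: ('a, 'm) ring_scheme. reduced_information_semialgebra S \<longrightarrow>
        \<not> half_factorial (upper_triangular_monoid n S) \<and>
        (bi_ffm S \<longleftrightarrow> ff_monoid (upper_triangular_monoid n S)) \<and>
        (bi_bfm S \<longleftrightarrow> bf_monoid (upper_triangular_monoid n S)) \<and>
        (bi_accp S \<longleftrightarrow> accp (upper_triangular_monoid n S)) \<and>
        (bi_atomic S \<longleftrightarrow> atomic_monoid (upper_triangular_monoid n S)) \<and>
        (bi_ffm S \<longrightarrow> bi_bfm S) \<and>
        (bi_bfm S \<longrightarrow> bi_accp S) \<and>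
        (bi_accp S \<longrightarrow> bi_atomic S) \<and>
        (ff_monoid (upper_triangular_monoid n S) \<longrightarrow> bf_monoid (upper_triangular_monoid n S)) \<and>
        (bf_monoid (upper_triangular_monoid n S) \<longrightarrow> accp (upper_triangular_monoid n S)) \<and>
        (accp (upper_triangular_monoid n S) \<longrightarrow> atomic_monoid (upper_triangular_monoid n S))) \<and>
     (\<exists>S :: real ring. reduced_information_semialgebra S \<and> bi_bfm S \<and> \<not> bi_ffm S) \<and>
     (\<exists>S :: real ring. reduced_information_semialgebra S \<and> bi_accp S \<and> \<not> bi_bfm S) \<and>
     (\<exists>S :: real ring. reduced_information_semialgebra S \<and> bi_atomic S \<and> \<not> bi_accp S) \<and>
     (\<exists>S :: real ring. reduced_information_semialgebra S \<and>
        bf_monoid (upper_triangular_monoid n S) \<and> \<not> ff_monoid (upper_triangular_monoid n S)) \<and>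
     (\<exists>S :: real ring. reduced_information_semialgebra S \<and>
        accp (upper_triangular_monoid n S) \<and> \<not> bf_monoid (upper_triangular_monoid n S)) \<and>
     (\<exists>S :: real ring. reduced_information_semialgebra S \<and>
        atomic_monoid (upper_triangular_monoid n S) \<and> \<not> accp (upper_triangular_monoid n S))"
proof (intro conjI allI impI)
  fix S :: "('a, 'm) ring_scheme"
  assume "reduced_information_semialgebra S"
  then interpret reduced_information_semialgebra S .
  interpret reduced_semialgebra_matrices S n ..
  show "\<not> half_factorial (upper_triangular_monoid n S)"
    using assms by (rule T_not_half_factorial)
  show "bi_ffm S \<longleftrightarrow> ff_monoid (upper_triangular_monoid n S)"
    "bi_bfm S \<longleftrightarrow> bf_monoid (upper_triangular_monoid n S)"
    "bi_accp S \<longleftrightarrow> accp (upper_triangular_monoid n S)"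
    "bi_atomic S \<longleftrightarrow> atomic_monoid (upper_triangular_monoid n S)"
    using T_equivalences[OF assms] .
  show "bi_ffm S \<Longrightarrow> bi_bfm S" "bi_bfm S \<Longrightarrow> bi_accp S" "bi_accp S \<Longrightarrow> bi_atomic S"
    by (fact bi_ffm_imp_bi_bfm bi_bfm_imp_bi_accp bi_accp_imp_bi_atomic)+
  show "ff_monoid T \<Longrightarrow> bf_monoid T" "bf_monoid T \<Longrightarrow> accp T" "accp T \<Longrightarrow> atomic_monoid T"
    by (fact T.ff_imp_bf T.bf_imp_accp T.accp_imp_atomic)+
next
  have equiv:
    "bi_ffm S \<longleftrightarrow> ff_monoid (upper_triangular_monoid n S)"
    "bi_bfm S \<longleftrightarrow> bf_monoid (upper_triangular_monoid n S)"
    "bi_accp S \<longleftrightarrow> accp (upper_triangular_monoid n S)"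
    "bi_atomic S \<longleftrightarrow> atomic_monoid (upper_triangular_monoid n S)"
    if "reduced_information_semialgebra S" for S :: "real ring"
    using reduced_semialgebra_matrices.T_equivalences[OF _ assms] that
    by (auto simp: reduced_semialgebra_matrices_def)
  show "\<exists>S :: real ring. reduced_information_semialgebra S \<and>
      bf_monoid (upper_triangular_monoid n S) \<and> \<not> ff_monoid (upper_triangular_monoid n S)"
    using exists_bfm_not_ffm equiv by blast
  show "\<exists>S :: real ring. reduced_information_semialgebra S \<and>
      accp (upper_triangular_monoid n S) \<and> \<not> bf_monoid (upper_triangular_monoid n S)"
    using exists_accp_not_bfm equiv by blast
  show "\<exists>S :: real ring. reduced_information_semialgebra S \<and>
      atomic_monoid (upper_triangular_monoid n S) \<and> \<not> accp (upper_triangular_monoid n S)"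
    using exists_atomic_not_accp equiv by blast
qed (fact exists_bfm_not_ffm exists_accp_not_bfm exists_atomic_not_accp)+

end
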